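(* Let $0<m<\infty$ and let $(M,g)$ be a compact smooth Riemannian manifold of dimension $n$. Let $V$ be an $m$-modified conformal vector field on $(M,g)$, i.e. a smooth vector field satisfying $\frac12\mathcal{L}_V g-\frac1m v\otimes v=\sigma g$ for some smooth function $\sigma$ on $M$. If $V$ satisfies the inequality $$\mathrm{Ric}(V,V)\le \frac{2(1-n)}{n m^2}\Big(\max_M |V|\Big)^4$$ on $M$, then $V$ is zero identically on $M$, and hence trivial.
   Context: $\mathcal{L}_V$ denotes the Lie derivative along $V$, $v=g(V,\cdot)$ is the $1$-form metrically associated to $V$, $\mathrm{Ric}$ is the Ricci tensor of $g$, and $|V|$ is the pointwise $g$-norm of $V$. For $0<m<\infty$, a smooth vector field $V$ is called an $m$-modified conformal vector field if $\frac12\mathcal{L}_V g-\frac1m v\otimes v=\sigma g$ for some smooth function $\sigma$ on $M$. It is called trivial when $V=0$.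
   Formalization: The dimension is assumed to be n ≥ 2: for n = 1 the claim fails (unit field V = d/dθ on the circle, where L_V g = 0, σ = −1/m, and Ric(V,V) = 0 ≤ 0), and for n = 0 the bound divides by zero. *)

theory Defs
  imports "HOL-Analysis.Analysis"
begin

section \<open>Calculus in coordinates\<close>

definition pd :: "'n::finite \<Rightarrow> (real^'n \<Rightarrow> real) \<Rightarrow> real^'n \<Rightarrow> real" where
  "pd i f x = frechet_derivative f (at x) (axis i 1)"

text \<open>Used on open sets only: there, differentiability of all iterated partial
  derivatives is the same as being of class C-infinity.\<close>

definition smooth_on :: "(real^'n) set \<Rightarrow> (real^'n::finite \<Rightarrow> real) \<Rightarrow> bool" where
  "smooth_on S f \<longleftrightarrow> (\<forall>is. \<forall>x\<in>S. foldr pd is f differentiable (at x))"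

section \<open>Smooth manifolds\<close>

text \<open>A chart is a coordinate domain with its coordinate map; values of the map outside the
  domain are irrelevant. A smooth structure is given by an atlas, not necessarily maximal:
  the notions below depend only on the maximal atlas that it generates.\<close>

type_synonym ('a, 'n) chart = "'a set \<times> ('a \<Rightarrow> real^'n)"

abbreviation cdom :: "('a, 'n::finite) chart \<Rightarrow> 'a set" where
  "cdom c \<equiv> fst c"

abbreviation coords :: "('a, 'n::finite) chart \<Rightarrow> 'a \<Rightarrow> real^'n" where
  "coords c \<equiv> snd c"

abbreviation cimg :: "('a, 'n::finite) chart \<Rightarrow> (real^'n) set" where
  "cimg c \<equiv> coords c ` cdom c"

definition point :: "('a, 'n::finite) chart \<Rightarrow> real^'n \<Rightarrow> 'a" where
  "point c = inv_into (cdom c) (coords c)"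

definition transition :: "('a, 'n::finite) chart \<Rightarrow> ('a, 'n) chart \<Rightarrow> real^'n \<Rightarrow> real^'n" where
  "transition c d = coords d \<circ> point c"

definition is_chart :: "'a topology \<Rightarrow> ('a, 'n::finite) chart \<Rightarrow> bool" where
  "is_chart X c \<longleftrightarrow> openin X (cdom c) \<and> open (cimg c) \<and>
     homeomorphic_map (subtopology X (cdom c)) (top_of_set (cimg c)) (coords c)"

definition smooth_atlas :: "'a topology \<Rightarrow> ('a, 'n::finite) chart set \<Rightarrow> bool" where
  "smooth_atlas X A \<longleftrightarrow> (\<forall>c\<in>A. is_chart X c) \<and> (\<Union>c\<in>A. cdom c) = topspace X \<and>
     (\<forall>c\<in>A. \<forall>d\<in>A. \<forall>k. smooth_on (coords c ` (cdom c \<inter> cdom d)) (\<lambda>x. transition c d x $ k))"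

text \<open>The dimension is \<open>CARD('n)\<close>; manifolds have no boundary.\<close>

definition smooth_manifold :: "'a topology \<Rightarrow> ('a, 'n::finite) chart set \<Rightarrow> bool" where
  "smooth_manifold X A \<longleftrightarrow> Hausdorff_space X \<and> second_countable X \<and> smooth_atlas X A"

definition smooth_fun :: "('a, 'n::finite) chart set \<Rightarrow> ('a \<Rightarrow> real) \<Rightarrow> bool" where
  "smooth_fun A f \<longleftrightarrow> (\<forall>c\<in>A. smooth_on (cimg c) (\<lambda>x. f (point c x)))"

section \<open>Tangent vectors, vector fields and metrics\<close>

text \<open>A tangent vector at \<open>p\<close> assigns to each chart around \<open>p\<close> a coordinate vector,
  compatibly with the derivatives of the transition maps. The value 0 on all other charts
  makes equality of tangent vectors the equality of functions.\<close>

type_synonym ('a, 'n) tangent = "('a, 'n) chart \<Rightarrow> real^'n"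

definition tangent_space :: "('a, 'n::finite) chart set \<Rightarrow> 'a \<Rightarrow> ('a, 'n) tangent set" where
  "tangent_space A p = {\<xi>.
     (\<forall>c\<in>A. \<forall>d\<in>A. p \<in> cdom c \<and> p \<in> cdom d \<longrightarrow>
        \<xi> d = frechet_derivative (transition c d) (at (coords c p)) (\<xi> c)) \<and>
     (\<forall>c. \<not> (c \<in> A \<and> p \<in> cdom c) \<longrightarrow> \<xi> c = 0)}"

definition coord_vec ::
  "('a, 'n::finite) chart set \<Rightarrow> ('a, 'n) chart \<Rightarrow> 'n \<Rightarrow> 'a \<Rightarrow> ('a, 'n) tangent" where
  "coord_vec A c i p = (\<lambda>d. if d \<in> A \<and> p \<in> cdom d
     then frechet_derivative (transition c d) (at (coords c p)) (axis i 1) else 0)"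

type_synonym ('a, 'n) vector_field = "'a \<Rightarrow> ('a, 'n) tangent"

definition smooth_vector_field ::
  "'a topology \<Rightarrow> ('a, 'n::finite) chart set \<Rightarrow> ('a, 'n) vector_field \<Rightarrow> bool" where
  "smooth_vector_field X A V \<longleftrightarrow> (\<forall>p\<in>topspace X. V p \<in> tangent_space A p) \<and>
     (\<forall>c\<in>A. \<forall>k. smooth_on (cimg c) (\<lambda>x. V (point c x) c $ k))"

type_synonym ('a, 'n) tensor2 = "'a \<Rightarrow> ('a, 'n) tangent \<Rightarrow> ('a, 'n) tangent \<Rightarrow> real"

definition components ::
  "('a, 'n::finite) chart set \<Rightarrow> ('a, 'n) tensor2 \<Rightarrow> ('a, 'n) chart \<Rightarrow> real^'n \<Rightarrow> real^'n^'n" where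
  "components A T c x =
     (\<chi> i j. T (point c x) (coord_vec A c i (point c x)) (coord_vec A c j (point c x)))"

definition is_inner_product ::
  "('a, 'n::finite) tangent set \<Rightarrow> (('a, 'n) tangent \<Rightarrow> ('a, 'n) tangent \<Rightarrow> real) \<Rightarrow> bool" where
  "is_inner_product E b \<longleftrightarrow>
     (\<forall>\<xi>\<in>E. \<forall>\<eta>\<in>E. b \<xi> \<eta> = b \<eta> \<xi>) \<and>
     (\<forall>\<xi>\<in>E. \<forall>\<eta>\<in>E. \<forall>\<zeta>\<in>E. \<forall>r s. b (\<lambda>c. r *\<^sub>R \<xi> c + s *\<^sub>R \<eta> c) \<zeta> = r * b \<xi> \<zeta> + s * b \<eta> \<zeta>) \<and>
     (\<forall>\<xi>\<in>E. \<xi> \<noteq> (\<lambda>_. 0) \<longrightarrow> b \<xi> \<xi> > 0)"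

definition riemannian_metric ::
  "'a topology \<Rightarrow> ('a, 'n::finite) chart set \<Rightarrow> ('a, 'n) tensor2 \<Rightarrow> bool" where
  "riemannian_metric X A g \<longleftrightarrow>
     (\<forall>p\<in>topspace X. is_inner_product (tangent_space A p) (g p)) \<and>
     (\<forall>c\<in>A. \<forall>i j. smooth_on (cimg c) (\<lambda>x. components A g c x $ i $ j))"

definition vnorm :: "('a, 'n::finite) tensor2 \<Rightarrow> ('a, 'n) vector_field \<Rightarrow> 'a \<Rightarrow> real" where
  "vnorm g V p = sqrt (g p (V p) (V p))"

text \<open>On a nonempty compact manifold with smooth \<open>g\<close> and \<open>V\<close> the supremum is attained.\<close>

definition max_vnorm ::
  "'a topology \<Rightarrow> ('a, 'n::finite) tensor2 \<Rightarrow> ('a, 'n) vector_field \<Rightarrow> real" where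
  "max_vnorm X g V = (SUP p\<in>topspace X. vnorm g V p)"

section \<open>Lie derivative and Ricci tensor\<close>

text \<open>Both tensors are defined by their components in a chart around the point. The result
  does not depend on the chart, so any choice may be made.\<close>

definition chart_at :: "('a, 'n::finite) chart set \<Rightarrow> 'a \<Rightarrow> ('a, 'n) chart" where
  "chart_at A p = (SOME c. c \<in> A \<and> p \<in> cdom c)"

definition lie_components ::
  "('a, 'n::finite) chart set \<Rightarrow> ('a, 'n) vector_field \<Rightarrow> ('a, 'n) tensor2 \<Rightarrow>
     ('a, 'n) chart \<Rightarrow> real^'n \<Rightarrow> 'n \<Rightarrow> 'n \<Rightarrow> real" where
  "lie_components A V T c x i j =
     (\<Sum>k\<in>UNIV. V (point c x) c $ k * pd k (\<lambda>y. components A T c y $ i $ j) x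
        + components A T c x $ k $ j * pd i (\<lambda>y. V (point c y) c $ k) x
        + components A T c x $ i $ k * pd j (\<lambda>y. V (point c y) c $ k) x)"

definition lie_derivative ::
  "('a, 'n::finite) chart set \<Rightarrow> ('a, 'n) vector_field \<Rightarrow> ('a, 'n) tensor2 \<Rightarrow> ('a, 'n) tensor2" where
  "lie_derivative A V T p \<xi> \<eta> = (let c = chart_at A p in
     \<Sum>i\<in>UNIV. \<Sum>j\<in>UNIV. lie_components A V T c (coords c p) i j * \<xi> c $ i * \<eta> c $ j)"

text \<open>\<open>christoffel A g c k i j\<close> has upper index \<open>k\<close> and lower indices \<open>i\<close>, \<open>j\<close>.\<close>

definition christoffel ::
  "('a, 'n::finite) chart set \<Rightarrow> ('a, 'n) tensor2 \<Rightarrow> ('a, 'n) chart \<Rightarrow>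
     'n \<Rightarrow> 'n \<Rightarrow> 'n \<Rightarrow> real^'n \<Rightarrow> real" where
  "christoffel A g c k i j x = (1/2) * (\<Sum>l\<in>UNIV. matrix_inv (components A g c x) $ k $ l *
     (pd i (\<lambda>y. components A g c y $ j $ l) x
      + pd j (\<lambda>y. components A g c y $ i $ l) x
      - pd l (\<lambda>y. components A g c y $ i $ j) x))"

text \<open>The coefficient of the \<open>l\<close>-th coordinate field in \<open>R(e\<^sub>i, e\<^sub>j) e\<^sub>k\<close> for the coordinate
  fields \<open>e\<close>, where \<open>R(Y, Z)\<close> is the commutator of the covariant derivatives along \<open>Y\<close> and \<open>Z\<close>
  minus the covariant derivative along \<open>[Y, Z]\<close>.\<close>

definition curvature ::
  "('a, 'n::finite) chart set \<Rightarrow> ('a, 'n) tensor2 \<Rightarrow> ('a, 'n) chart \<Rightarrow>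
     'n \<Rightarrow> 'n \<Rightarrow> 'n \<Rightarrow> 'n \<Rightarrow> real^'n \<Rightarrow> real" where
  "curvature A g c l i j k x =
     pd i (christoffel A g c l j k) x - pd j (christoffel A g c l i k) x
     + (\<Sum>s\<in>UNIV. christoffel A g c l i s x * christoffel A g c s j k x
                - christoffel A g c l j s x * christoffel A g c s i k x)"

text \<open>\<open>Ric(Y, Z)\<close> is the trace of \<open>W \<mapsto> R(W, Y) Z\<close>, so round spheres have positive
  Ricci curvature.\<close>

definition ricci :: "('a, 'n::finite) chart set \<Rightarrow> ('a, 'n) tensor2 \<Rightarrow> ('a, 'n) tensor2" where
  "ricci A g p \<xi> \<eta> = (let c = chart_at A p in
     \<Sum>j\<in>UNIV. \<Sum>k\<in>UNIV. (\<Sum>i\<in>UNIV. curvature A g c i i j k (coords c p)) * \<xi> c $ j * \<eta> c $ k)"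

section \<open>Modified conformal vector fields\<close>

definition modified_conformal ::
  "'a topology \<Rightarrow> ('a, 'n::finite) chart set \<Rightarrow> ('a, 'n) tensor2 \<Rightarrow> real \<Rightarrow>
     ('a, 'n) vector_field \<Rightarrow> bool" where
  "modified_conformal X A g m V \<longleftrightarrow> smooth_vector_field X A V \<and>
     (\<exists>\<sigma>. smooth_fun A \<sigma> \<and>
        (\<forall>p\<in>topspace X. \<forall>\<xi>\<in>tangent_space A p. \<forall>\<eta>\<in>tangent_space A p.
           (1/2) * lie_derivative A V g p \<xi> \<eta> - (1/m) * (g p (V p) \<xi> * g p (V p) \<eta>)
             = \<sigma> p * g p \<xi> \<eta>))"

end

theory Submission
  imports Defs
begin

text \<open>Let \<open>W = (|V|\<^sup>2/m + (2 - n) \<sigma>) V - grad |V|\<^sup>2 / 2\<close>; by the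
  conformal equation this is \<open>\<nabla>\<^sub>V V - (div V) V\<close>, but in this form it is manifestly a vector field.
  Commuting covariant derivatives gives \<open>div W = Ric(V,V) + tr((\<nabla>V)\<^sup>2) - (div V)\<^sup>2\<close>. Only the
  symmetric part \<open>S = V\<otimes>V/m + \<sigma>g\<close> of \<open>\<nabla>V\<close> contributes positively to the trace, and completing
  the square in \<open>\<sigma>\<close> gives \<open>div W \<le> Ric(V,V) + (n-1)/(n m\<^sup>2) |V|\<^sup>4\<close>. If \<open>V\<close> is not zero, the
  hypothesis makes \<open>div W\<close> negative everywhere, contrary to the divergence theorem on a compact
  manifold. The divergence is handled as half the metric trace of the Lie derivative of the metric,
  so that its independence of the chart follows from that of the Lie derivative.\<close>

section \<open>Partial derivatives\<close>

text \<open>\<open>W\<close> is chosen so that the second derivatives of \<open>V\<close> cancel in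
  its divergence and only curvature and products of first derivatives survive. The obstacle is chart
  dependence: \<open>ricci\<close> and \<open>lie_derivative\<close> are evaluated in one chosen
  chart at each point, and no transformation law for the curvature is proved. The estimate for the
  divergence is therefore derived in exactly that chart, and the divergence, not the Ricci term, is
  carried to other charts. Christoffel symbols do not transform as tensors, whereas the inverse
  metric and the differential of a function do; hence the gradient form of \<open>W\<close>. No
  measure is built on the manifold: all integrals live in charts, weighted by
  \<open>sqrt \<bar>det G\<bar>\<close>, and absolute Jacobians take the place of an orientation.
  The hypothesis offers twice the constant of the estimate, at the maximum of the norm: one half
  absorbs the fourth power of the norm, the other stays strictly negative since
  \<open>CARD('n) \<ge> 2\<close>. On a circle the conclusion fails: a unit field with
  \<open>\<sigma> = -1/m\<close> satisfies the equation, and both sides of the curvature inequality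
  are 0.\<close>

lemma has_derivative_pd:
  fixes f :: "real^'n::finite \<Rightarrow> real"
  assumes "f differentiable (at x)"
  shows "(f has_derivative (\<lambda>h. \<Sum>i\<in>UNIV. pd i f x * h $ i)) (at x)"
proof -
  let ?D = "frechet_derivative f (at x)"
  have D: "(f has_derivative ?D) (at x)"
    using assms frechet_derivative_works by blast
  then have lin: "linear ?D"
    using has_derivative_linear by blast
  have "?D h = (\<Sum>i\<in>UNIV. pd i f x * h $ i)" for h
  proof -
    have "?D h = ?D (\<Sum>i\<in>UNIV. h $ i *\<^sub>R axis i 1)"
      by (simp add: basis_expansion flip: scalar_mult_eq_scaleR)
    also have "\<dots> = (\<Sum>i\<in>UNIV. h $ i *\<^sub>R ?D (axis i 1))"
      by (simp add: linear_sum[OF lin] linear_cmul[OF lin])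
    finally show ?thesis by (simp add: pd_def mult.commute)
  qed
  then show ?thesis using D by (metis (no_types, lifting) ext)
qed

lemma pd_eq:
  assumes "(f has_derivative f') (at x)"
  shows "pd i f x = f' (axis i 1)"
  using frechet_derivative_at[OF assms] by (simp add: pd_def)

lemma has_derivative_cong_open:
  assumes "open S" "x \<in> S" "\<And>y. y \<in> S \<Longrightarrow> f y = g y" "(f has_derivative f') (at x)"
  shows "(g has_derivative f') (at x)"
  using has_derivative_transform_within_open[OF assms(4,1,2)] assms(3) by blast

lemma differentiable_cong_open:
  assumes "open S" "x \<in> S" "\<And>y. y \<in> S \<Longrightarrow> f y = g y"
  shows "f differentiable (at x) \<longleftrightarrow> g differentiable (at x)"
  unfolding differentiable_def
  using has_derivative_cong_open[OF assms(1,2)] assms(3) by metis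

lemma pd_cong_open:
  assumes "open S" "x \<in> S" "\<And>y. y \<in> S \<Longrightarrow> f y = g y"
  shows "pd i f x = pd i g x"
proof -
  have "(f has_derivative f') (at x) \<longleftrightarrow> (g has_derivative f') (at x)" for f'
    using has_derivative_cong_open[OF assms(1,2)] assms(3) by metis
  then show ?thesis by (simp add: pd_def frechet_derivative_def)
qed

lemma pd_const [simp]: "pd i (\<lambda>x. c) x = 0"
  by (rule trans[OF pd_eq[OF has_derivative_const]]) simp

lemma pd_add:
  assumes "f differentiable (at x)" "g differentiable (at x)"
  shows "pd i (\<lambda>y. f y + g y) x = pd i f x + pd i g x"
  using pd_eq[OF has_derivative_add[OF has_derivative_pd[OF assms(1)] has_derivative_pd[OF assms(2)]], of i]
  by (simp add: axis_def if_distrib sum.delta cong: if_cong)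

lemma pd_mult:
  assumes "f differentiable (at x)" "g differentiable (at x)"
  shows "pd i (\<lambda>y. f y * g y) x = f x * pd i g x + pd i f x * g x"
  using pd_eq[OF has_derivative_mult[OF has_derivative_pd[OF assms(1)] has_derivative_pd[OF assms(2)]], of i]
  by (simp add: axis_def if_distrib sum.delta cong: if_cong)

lemma pd_cmult:
  assumes "f differentiable (at x)"
  shows "pd i (\<lambda>y. c * f y) x = c * pd i f x"
  using pd_mult[of "\<lambda>_. c", OF _ assms] by simp

lemma pd_minus:
  assumes "f differentiable (at x)"
  shows "pd i (\<lambda>y. - f y) x = - pd i f x"
  using pd_cmult[OF assms, of i "-1"] by simp

lemma pd_diff:
  assumes "f differentiable (at x)" "g differentiable (at x)"
  shows "pd i (\<lambda>y. f y - g y) x = pd i f x - pd i g x"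
  using pd_add[OF assms(1), of "\<lambda>y. - g y" i] assms(2) by (simp add: pd_minus)

lemma pd_sum:
  assumes "\<And>a. a \<in> I \<Longrightarrow> f a differentiable (at x)"
  shows "pd i (\<lambda>y. \<Sum>a\<in>I. f a y) x = (\<Sum>a\<in>I. pd i (f a) x)"
proof (cases "finite I")
  case True
  then show ?thesis using assms
  proof (induction I rule: finite_induct)
    case (insert a I)
    then show ?case
      by (simp add: pd_add differentiable_sum)
  qed simp
qed simp

lemma pd_real_comp:
  fixes \<phi> :: "real \<Rightarrow> real"
  assumes "f differentiable (at x)" "(\<phi> has_real_derivative D) (at (f x))"
  shows "pd i (\<lambda>y. \<phi> (f y)) x = D * pd i f x"
    and "(\<lambda>y. \<phi> (f y)) differentiable (at x)"
proof -
  have "((\<lambda>y. \<phi> (f y)) has_derivative (\<lambda>h. D * (\<Sum>i\<in>UNIV. pd i f x * h $ i))) (at x)"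
    using has_derivative_compose[OF has_derivative_pd[OF assms(1)] assms(2)[unfolded has_field_derivative_def]]
    by simp
  from pd_eq[OF this, of i] this
  show "pd i (\<lambda>y. \<phi> (f y)) x = D * pd i f x"
    and "(\<lambda>y. \<phi> (f y)) differentiable (at x)"
    by (auto simp add: axis_def if_distrib sum.delta differentiable_def cong: if_cong)
qed

lemma has_derivative_vec_nth_iff:
  fixes f :: "'b::real_normed_vector \<Rightarrow> real^'m::finite"
  shows "(f has_derivative f') (at x) \<longleftrightarrow> (\<forall>k. ((\<lambda>y. f y $ k) has_derivative (\<lambda>h. f' h $ k)) (at x))"
proof
  assume R: "\<forall>k. ((\<lambda>y. f y $ k) has_derivative (\<lambda>h. f' h $ k)) (at x)"
  show "(f has_derivative f') (at x)"
    unfolding has_derivative_componentwise_within[of f f' x UNIV, simplified]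
    by (auto simp: Basis_vec_def inner_axis R)
qed (auto intro: bounded_linear.has_derivative[OF bounded_linear_vec_nth])

lemma has_derivative_vec_pd:
  fixes f :: "real^'n::finite \<Rightarrow> real^'m::finite"
  assumes "\<And>k. (\<lambda>y. f y $ k) differentiable (at x)"
  shows "(f has_derivative (\<lambda>h. \<chi> k. \<Sum>i\<in>UNIV. pd i (\<lambda>y. f y $ k) x * h $ i)) (at x)"
  by (simp add: has_derivative_vec_nth_iff has_derivative_pd assms)

lemma pd_chain:
  fixes f :: "real^'m::finite \<Rightarrow> real" and \<tau> :: "real^'n::finite \<Rightarrow> real^'m"
  assumes "\<And>k. (\<lambda>y. \<tau> y $ k) differentiable (at x)" "f differentiable (at (\<tau> x))"
  shows "pd i (\<lambda>y. f (\<tau> y)) x = (\<Sum>k\<in>UNIV. pd k f (\<tau> x) * pd i (\<lambda>y. \<tau> y $ k) x)"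
    and "(\<lambda>y. f (\<tau> y)) differentiable (at x)"
proof -
  have d: "((\<lambda>y. f (\<tau> y)) has_derivative
      (\<lambda>h. \<Sum>k\<in>UNIV. pd k f (\<tau> x) * (\<chi> k. \<Sum>i\<in>UNIV. pd i (\<lambda>y. \<tau> y $ k) x * h $ i) $ k)) (at x)"
    by (rule has_derivative_compose[OF has_derivative_vec_pd[OF assms(1)] has_derivative_pd[OF assms(2)]])
  show "pd i (\<lambda>y. f (\<tau> y)) x = (\<Sum>k\<in>UNIV. pd k f (\<tau> x) * pd i (\<lambda>y. \<tau> y $ k) x)"
    unfolding pd_eq[OF d] by (simp add: axis_def if_distrib sum.delta cong: if_cong)
  show "(\<lambda>y. f (\<tau> y)) differentiable (at x)"
    using d differentiable_def by blast
qed

text \<open>Finite order of differentiability, in recursive form so that closure properties follow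
  by induction on the order. Full smoothness would not do: the bump functions below are only of
  class C^1, and each step of the calculation costs a known number of derivatives.\<close>

primrec Ck :: "nat \<Rightarrow> (real^'n::finite) set \<Rightarrow> (real^'n \<Rightarrow> real) \<Rightarrow> bool" where
  "Ck 0 S f \<longleftrightarrow> continuous_on S f"
| "Ck (Suc k) S f \<longleftrightarrow> (\<forall>x\<in>S. f differentiable (at x)) \<and> (\<forall>i. Ck k S (pd i f))"

lemma Ck_cong:
  assumes "open S" "\<And>x. x \<in> S \<Longrightarrow> f x = g x"
  shows "Ck k S f \<longleftrightarrow> Ck k S g"
  using assms(2)
proof (induction k arbitrary: f g)
  case (Suc k)
  have "Ck k S (pd i f) \<longleftrightarrow> Ck k S (pd i g)" for i
    using pd_cong_open[OF assms(1)] Suc.prems by (intro Suc.IH) blast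
  moreover have "f differentiable (at x) \<longleftrightarrow> g differentiable (at x)" if "x \<in> S" for x
    using differentiable_cong_open[OF assms(1) that] Suc.prems by blast
  ultimately show ?case by simp
qed (auto cong: continuous_on_cong)

lemma Ck_differentiable: "Ck k S f \<Longrightarrow> k > 0 \<Longrightarrow> x \<in> S \<Longrightarrow> f differentiable (at x)"
  by (cases k) auto

lemma Ck_pd: "Ck (Suc k) S f \<Longrightarrow> Ck k S (pd i f)"
  by simp

lemma Ck_continuous: "Ck k S f \<Longrightarrow> continuous_on S f"
  by (cases k) (auto intro!: differentiable_imp_continuous_on differentiable_at_imp_differentiable_on)

lemma Ck_Suc: "Ck (Suc k) S f \<Longrightarrow> Ck k S f"
proof (induction k arbitrary: f)
  case 0
  then show ?case using Ck_continuous by (metis Ck.simps(1))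
next
  case (Suc k)
  then show ?case by (metis Ck.simps(2))
qed

lemma Ck_mono: "Ck k S f \<Longrightarrow> l \<le> k \<Longrightarrow> Ck l S f"
  by (induction k) (auto simp del: Ck.simps dest: Ck_Suc simp: le_Suc_eq)

lemma smooth_on_pd: "smooth_on S f \<Longrightarrow> smooth_on S (pd i f)"
  unfolding smooth_on_def
proof (intro allI ballI)
  fix "is" x assume *: "\<forall>is. \<forall>x\<in>S. foldr pd is f differentiable at x" "x \<in> S"
  show "foldr pd is (pd i f) differentiable at x"
    using *(1)[rule_format, of x "is @ [i]"] *(2) by simp
qed

lemma smooth_on_Ck: "smooth_on S f \<Longrightarrow> Ck k S f"
proof (induction k arbitrary: f)
  case 0
  have "\<forall>x\<in>S. f differentiable (at x)"
    using 0[unfolded smooth_on_def, rule_format, of _ "[]"] by simp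
  then show ?case
    by (auto intro!: differentiable_imp_continuous_on differentiable_at_imp_differentiable_on)
next
  case (Suc k)
  have "\<forall>x\<in>S. f differentiable (at x)"
    using Suc.prems[unfolded smooth_on_def, rule_format, of _ "[]"] by simp
  then show ?case using Suc by (auto intro: smooth_on_pd)
qed

lemma Ck_const [simp]: "Ck k S (\<lambda>x. c)"
proof (induction k arbitrary: c)
  case (Suc k)
  have "pd i (\<lambda>x. c) = (\<lambda>x. 0)" for i :: 'a by (rule ext) simp
  then show ?case using Suc by simp
qed simp

lemma Ck_add:
  assumes "open S" "Ck k S f" "Ck k S g"
  shows "Ck k S (\<lambda>x. f x + g x)"
  using assms(2,3)
proof (induction k arbitrary: f g)
  case (Suc k)
  have "Ck k S (pd i (\<lambda>x. f x + g x))" for i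
    by (subst Ck_cong[OF assms(1) pd_add]) (use Suc in auto)
  then show ?case using Suc.prems by simp
qed (simp add: continuous_on_add)

lemma Ck_mult:
  assumes "open S" "Ck k S f" "Ck k S g"
  shows "Ck k S (\<lambda>x. f x * g x)"
  using assms(2,3)
proof (induction k arbitrary: f g)
  case (Suc k)
  have "Ck k S (\<lambda>x. f x * pd i g x + pd i f x * g x)" for i
    using Suc by (intro Ck_add assms Suc.IH) (auto intro: Ck_Suc simp del: Ck.simps simp: Ck_pd)
  then have "Ck k S (pd i (\<lambda>x. f x * g x))" for i
    by (subst Ck_cong[OF assms(1) pd_mult]) (use Suc.prems in auto)
  then show ?case using Suc.prems by simp
qed (simp add: continuous_on_mult)

lemma Ck_minus: "open S \<Longrightarrow> Ck k S f \<Longrightarrow> Ck k S (\<lambda>x. - f x)"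
  using Ck_mult[of S k "\<lambda>_. -1" f] by simp

lemma Ck_diff: "open S \<Longrightarrow> Ck k S f \<Longrightarrow> Ck k S g \<Longrightarrow> Ck k S (\<lambda>x. f x - g x)"
  using Ck_add[of S k f "\<lambda>x. - g x"] by (simp add: Ck_minus)

lemma Ck_sum:
  assumes "open S" "\<And>a. a \<in> I \<Longrightarrow> Ck k S (f a)"
  shows "Ck k S (\<lambda>x. \<Sum>a\<in>I. f a x)"
  using assms(2) by (induction I rule: infinite_finite_induct) (auto intro: Ck_add assms(1))

lemma Ck_prod:
  assumes "open S" "\<And>a. a \<in> I \<Longrightarrow> Ck k S (f a)"
  shows "Ck k S (\<lambda>x. \<Prod>a\<in>I. f a x)"
  using assms(2) by (induction I rule: infinite_finite_induct) (auto intro: Ck_mult assms(1))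

text \<open>The outer function is differentiated only at values of \<open>f\<close>, which admits
  the square root of an absolute value away from 0. Order 1 is all that the square of
  \<open>max 0 t\<close> permits.\<close>

lemma Ck_real_comp:
  assumes "open S" "Ck 1 S f" "\<And>x. x \<in> S \<Longrightarrow> (\<phi> has_real_derivative \<phi>' (f x)) (at (f x))"
    and "continuous_on (f ` S) \<phi>'"
  shows "Ck 1 S (\<lambda>x. \<phi> (f x))"
proof -
  have "continuous_on S (\<lambda>x. \<phi>' (f x) * pd i f x)" for i
    using assms(2) by (intro continuous_on_mult continuous_on_compose2[OF assms(4) Ck_continuous[OF assms(2)]])
      auto
  then have "continuous_on S (pd i (\<lambda>x. \<phi> (f x)))" for i
    by (subst continuous_on_cong[OF refl pd_real_comp(1)[OF _ assms(3)]]) (use assms(2) in auto)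
  moreover have "(\<lambda>x. \<phi> (f x)) differentiable (at x)" if "x \<in> S" for x
    by (rule pd_real_comp(2)[where f = f, OF _ assms(3)[OF that]]) (use assms(2) that in auto)
  ultimately show ?thesis by simp
qed

text \<open>The derivative of the reciprocal is a polynomial in the reciprocal and
  \<open>pd i f\<close>, so the induction on \<open>k\<close> closes on the reciprocal
  itself.\<close>

lemma Ck_inverse:
  assumes "open S" "Ck k S f" "\<And>x. x \<in> S \<Longrightarrow> f x \<noteq> 0"
  shows "Ck k S (\<lambda>x. inverse (f x))"
  using assms(2)
proof (induction k)
  case (Suc k)
  have eq: "pd i (\<lambda>x. inverse (f x)) x = - (inverse (f x) * inverse (f x)) * pd i f x" 
    and d: "(\<lambda>x. inverse (f x)) differentiable (at x)" if "x \<in> S" for i x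
    using pd_real_comp[of f x inverse "- (inverse (f x) * inverse (f x))"] Suc.prems that
      DERIV_inverse'[OF DERIV_ident, of "f x"] assms(3)[OF that] by auto
  have "Ck k S (\<lambda>x. - (inverse (f x) * inverse (f x)) * pd i f x)" for i
    using Suc by (intro Ck_mult Ck_minus assms Suc.IH) (auto intro: Ck_Suc simp del: Ck.simps simp: Ck_pd)
  then have "Ck k S (pd i (\<lambda>x. inverse (f x)))" for i
    by (subst Ck_cong[OF assms(1) eq]) 
  then show ?case using d by simp
qed (use assms(3) in \<open>auto intro!: continuous_on_inverse\<close>)

lemma Ck_divide:
  assumes "open S" "Ck k S f" "Ck k S g" "\<And>x. x \<in> S \<Longrightarrow> g x \<noteq> 0"
  shows "Ck k S (\<lambda>x. f x / g x)"
  unfolding divide_inverse using assms by (intro Ck_mult Ck_inverse)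

lemma Ck_compose:
  assumes "open S" "\<And>k. Ck 1 S (\<lambda>x. \<tau> x $ k)" "Ck 1 T f" "\<tau> ` S \<subseteq> T"
  shows "Ck 1 S (\<lambda>x. f (\<tau> x))"
proof -
  have d: "(\<lambda>y. \<tau> y $ k) differentiable (at x)" "f differentiable (at (\<tau> x))" if "x \<in> S" for x k
    using assms that by auto
  have "continuous_on S \<tau>"
    using continuous_on_vec_lambda[of S "\<lambda>k x. \<tau> x $ k", OF Ck_continuous[OF assms(2)]] by simp
  have "continuous_on S (\<lambda>x. pd k f (\<tau> x))" for k
    by (rule continuous_on_compose2[OF _ \<open>continuous_on S \<tau>\<close> assms(4)]) (use assms(3) in simp)
  then have "continuous_on S (\<lambda>x. \<Sum>k\<in>UNIV. pd k f (\<tau> x) * pd i (\<lambda>y. \<tau> y $ k) x)" for i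
    using assms(2) by (intro continuous_on_sum continuous_on_mult) simp_all
  then have "continuous_on S (pd i (\<lambda>x. f (\<tau> x)))" for i
    using pd_chain(1)[OF d] by (simp cong: continuous_on_cong)
  then show ?thesis using pd_chain(2)[OF d] by simp
qed

section \<open>Symmetry of second partial derivatives\<close>

lemma DERIV_along_axis:
  assumes "f differentiable (at (x + s *\<^sub>R axis i 1))"
  shows "((\<lambda>s. f (x + s *\<^sub>R axis i 1)) has_real_derivative pd i f (x + s *\<^sub>R axis i 1)) (at s)"
proof -
  have "((\<lambda>s. f (x + s *\<^sub>R axis i 1)) has_derivative
      (\<lambda>h. \<Sum>k\<in>UNIV. pd k f (x + s *\<^sub>R axis i 1) * (h *\<^sub>R axis i 1) $ k)) (at s)"
    by (rule has_derivative_compose[of "\<lambda>s. x + s *\<^sub>R axis i 1" _ _ _ f, OF _ has_derivative_pd[OF assms]])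
      (auto intro!: derivative_eq_intros)
  then show ?thesis
    by (simp add: has_field_derivative_def axis_def if_distrib sum.delta mult_commute_abs cong: if_cong)
qed

text \<open>Two applications of the mean value theorem: to the increment in direction
  \<open>j\<close> as a function of the step in direction \<open>i\<close>, then to the resulting
  \<open>pd i f\<close> along direction \<open>j\<close>. The radius \<open>2 * h\<close>
  accommodates two steps of length at most \<open>h\<close>.\<close>

lemma second_difference_mvt:
  fixes f :: "real^'a::finite \<Rightarrow> real"
  assumes "Ck 2 S f" "h > 0" "cball x (2 * h) \<subseteq> S"
  obtains p where "p \<in> cball x (2 * h)"
    "f (x + h *\<^sub>R axis i 1 + h *\<^sub>R axis j 1) - f (x + h *\<^sub>R axis i 1) - f (x + h *\<^sub>R axis j 1) + f x
      = h\<^sup>2 * pd j (pd i f) p"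
proof -
  have C: "Ck (Suc (Suc 0)) S f" using assms(1) by (simp add: numeral_2_eq_2)
  have mem: "x + s *\<^sub>R axis i 1 + t *\<^sub>R axis j 1 \<in> cball x (2 * h)"
    if "0 \<le> s" "s \<le> h" "0 \<le> t" "t \<le> h" for s t
  proof -
    have "norm (s *\<^sub>R axis i (1::real) + t *\<^sub>R axis j 1 :: real^'a) \<le> 2 * h"
      using norm_triangle_ineq[of "s *\<^sub>R axis i (1::real) :: real^'a" "t *\<^sub>R axis j 1"] that by simp
    then show ?thesis using norm_minus_cancel[of "s *\<^sub>R axis i (1::real) + t *\<^sub>R axis j 1 :: real^'a"]
      by (simp add: dist_norm algebra_simps)
  qed
  have mem0: "x + s *\<^sub>R axis i 1 \<in> cball x (2 * h)" if "0 \<le> s" "s \<le> h" for s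
    using mem[of s 0] that assms(2) by simp
  let ?\<phi> = "\<lambda>s. f ((x + h *\<^sub>R axis j 1) + s *\<^sub>R axis i 1) - f (x + s *\<^sub>R axis i 1)"
  have d: "(?\<phi> has_real_derivative
      (pd i f ((x + h *\<^sub>R axis j 1) + s *\<^sub>R axis i 1) - pd i f (x + s *\<^sub>R axis i 1))) (at s)"
    if "0 \<le> s" "s \<le> h" for s
    using mem[OF that, of h] mem0[OF that] that assms(2,3) C
    by (intro DERIV_diff DERIV_along_axis) (auto simp: algebra_simps)
  obtain s where s: "0 < s" "s < h" "?\<phi> h - ?\<phi> 0 = (h - 0) *
      (pd i f ((x + h *\<^sub>R axis j 1) + s *\<^sub>R axis i 1) - pd i f (x + s *\<^sub>R axis i 1))"
    using MVT2[OF assms(2) d] by blast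
  let ?\<psi> = "\<lambda>t. pd i f ((x + s *\<^sub>R axis i 1) + t *\<^sub>R axis j 1)"
  have d': "(?\<psi> has_real_derivative pd j (pd i f) ((x + s *\<^sub>R axis i 1) + t *\<^sub>R axis j 1)) (at t)"
    if "0 \<le> t" "t \<le> h" for t
    using mem[OF _ _ that, of s] s(1,2) assms(3) C by (intro DERIV_along_axis) auto
  obtain t where t: "0 < t" "t < h" "?\<psi> h - ?\<psi> 0 =
      (h - 0) * pd j (pd i f) ((x + s *\<^sub>R axis i 1) + t *\<^sub>R axis j 1)"
    using MVT2[OF assms(2) d'] by blast
  show ?thesis
  proof (rule that)
    show "x + s *\<^sub>R axis i 1 + t *\<^sub>R axis j 1 \<in> cball x (2 * h)"
      using mem s t by simp
    show "f (x + h *\<^sub>R axis i 1 + h *\<^sub>R axis j 1) - f (x + h *\<^sub>R axis i 1) - f (x + h *\<^sub>R axis j 1) + f x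
      = h\<^sup>2 * pd j (pd i f) (x + s *\<^sub>R axis i 1 + t *\<^sub>R axis j 1)"
      using s(3) t(3) by (simp add: power2_eq_square algebra_simps)
  qed
qed

text \<open>The second difference is unchanged when the two directions are exchanged, so some value
  of one mixed derivative near \<open>x\<close> equals some value of the other; continuity moves
  this to \<open>x\<close>.\<close>

lemma pd_commute:
  assumes "open S" "Ck 2 S f" "x \<in> S"
  shows "pd i (pd j f) x = pd j (pd i f) x"
proof (rule ccontr)
  assume ne: "\<not> ?thesis"
  let ?A = "pd i (pd j f)" and ?B = "pd j (pd i f)"
  \<comment> \<open>Half of the gap, so that two deviations below \<open>e\<close> cannot bridge
    it.\<close>
  define e where "e = \<bar>?A x - ?B x\<bar> / 2"
  have e: "e > 0" using ne by (simp add: e_def)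
  have "continuous_on S ?A" "continuous_on S ?B"
    using assms(2) by (auto simp: numeral_2_eq_2)
  then have "isCont ?A x" "isCont ?B x"
    using assms continuous_on_eq_continuous_at by blast+
  then obtain d1 d2 where d: "d1 > 0" "\<And>y. dist y x < d1 \<Longrightarrow> dist (?A y) (?A x) < e"
    "d2 > 0" "\<And>y. dist y x < d2 \<Longrightarrow> dist (?B y) (?B x) < e"
    using e unfolding continuous_at_eps_delta by metis
  obtain d3 where d3: "d3 > 0" "cball x d3 \<subseteq> S"
    using assms open_contains_cball by blast
  define h where "h = min (min d1 d2) d3 / 4"
  have h: "h > 0" "2 * h < d1" "2 * h < d2" "2 * h \<le> d3"
    using d d3 by (auto simp: h_def)
  have sub: "cball x (2 * h) \<subseteq> S" using d3 h by auto
  obtain p where p: "p \<in> cball x (2 * h)"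
    "f (x + h *\<^sub>R axis i 1 + h *\<^sub>R axis j 1) - f (x + h *\<^sub>R axis i 1) - f (x + h *\<^sub>R axis j 1) + f x
      = h\<^sup>2 * ?B p"
    using second_difference_mvt[OF assms(2) h(1) sub] by blast
  obtain q where q: "q \<in> cball x (2 * h)"
    "f (x + h *\<^sub>R axis j 1 + h *\<^sub>R axis i 1) - f (x + h *\<^sub>R axis j 1) - f (x + h *\<^sub>R axis i 1) + f x
      = h\<^sup>2 * ?A q"
    using second_difference_mvt[OF assms(2) h(1) sub] by blast
  have "x + h *\<^sub>R axis j 1 + h *\<^sub>R axis i 1 = x + h *\<^sub>R axis i 1 + h *\<^sub>R axis j 1"
    by (simp add: add_ac)
  from q(2)[unfolded this] have "h\<^sup>2 * ?A q = h\<^sup>2 * ?B p" using p(2) by linarith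
  then have "?A q = ?B p" using h(1) by simp
  moreover have "dist (?A q) (?A x) < e" "dist (?B p) (?B x) < e"
    using d(2)[of q] d(4)[of p] p(1) q(1) h by (auto simp: dist_commute)
  ultimately show False unfolding e_def dist_real_def by argo
qed

section \<open>Positive definite matrices and determinants\<close>

definition psd :: "real^'n^'n::finite \<Rightarrow> bool" where
  "psd A \<longleftrightarrow> transpose A = A \<and> (\<forall>x. 0 \<le> x \<bullet> (A *v x))"

definition posdef :: "real^'n^'n::finite \<Rightarrow> bool" where
  "posdef A \<longleftrightarrow> transpose A = A \<and> (\<forall>x. x \<noteq> 0 \<longrightarrow> 0 < x \<bullet> (A *v x))"

lemma sym_nth: "transpose A = A \<Longrightarrow> A $ i $ j = A $ j $ i"
  by (drule arg_cong[where f = "\<lambda>M. M $ j $ i"]) (simp add: transpose_def)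

lemma inner_matrix_vector_mult:
  "x \<bullet> (A *v y) = (\<Sum>i\<in>UNIV. \<Sum>j\<in>UNIV. A $ i $ j * x $ i * (y $ j :: real))"
  by (simp add: inner_vec_def matrix_vector_mult_def sum_distrib_left mult_ac)

lemma inner_sym_matrix: "transpose A = A \<Longrightarrow> x \<bullet> (A *v y) = (A *v x) \<bullet> (y::real^'n)"
  by (metis dot_lmul_matrix transpose_matrix_vector)

lemma trace_mult: "trace (A ** B) = (\<Sum>i\<in>UNIV. \<Sum>j\<in>UNIV. A $ i $ j * B $ j $ i)"
  by (simp add: trace_def matrix_matrix_mult_def)

lemma trace_transpose: "trace (transpose A) = trace A"
  by (simp add: trace_def transpose_def)

text \<open>Along \<open>axis i 1 + t *\<^sub>R axis j 1\<close> the quadratic form is affine in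
  \<open>t\<close> with slope twice \<open>A $ i $ j\<close>, so a nonzero slope would make it
  negative; the \<open>t\<close> below gives the value -1.\<close>

lemma psd_zero_diagonal:
  assumes "psd A" "A $ j $ j = 0"
  shows "A $ i $ j = 0"
proof (rule ccontr)
  assume ne: "A $ i $ j \<noteq> 0"
  define t where "t = - (A $ i $ i + 1) / (2 * A $ i $ j)"
  have e: "axis a 1 \<bullet> (A *v axis b 1) = A $ a $ b" for a b
    by (simp add: inner_axis' matrix_vector_mult_basis column_def)
  have "0 \<le> (axis i 1 + t *\<^sub>R axis j 1) \<bullet> (A *v (axis i 1 + t *\<^sub>R axis j 1))"
    using assms(1) by (simp add: psd_def)
  also have "\<dots> = A $ i $ i + t * A $ i $ j + t * A $ j $ i + t * t * A $ j $ j"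
    by (simp add: algebra_simps inner_add_left inner_add_right e matrix_vector_mult_scaleR)
  also have "A $ j $ i = A $ i $ j" using assms(1) sym_nth psd_def by metis
  also have "A $ i $ i + t * A $ i $ j + t * A $ i $ j + t * t * A $ j $ j = -1"
    using ne assms(2) by (simp add: t_def field_simps)
  finally show False by simp
qed

text \<open>Peeling rank-one matrices off \<open>A\<close> replaces the spectral theorem.\<close>

lemma trace_psd_mult_nonneg:
  fixes A B :: "real^'n^'n::finite"
  assumes "psd A" "psd B"
  shows "0 \<le> trace (A ** B)"
  using assms(1)
proof (induction "card {i. A $ i $ i \<noteq> 0}" arbitrary: A rule: less_induct)
  case less
  show ?case
  proof (cases "\<forall>i. A $ i $ i = 0")
    case True
    then have "A $ i $ j = 0" for i j using psd_zero_diagonal[OF less.prems] by blast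
    then show ?thesis by (simp add: trace_mult)
  next
    case False
    then obtain i where i: "A $ i $ i \<noteq> 0" by blast
    define c where "c = A $ i $ i"
    define a where "a = A *v axis i 1"
    \<comment> \<open>A Schur complement: the rank-one matrix built from column \<open>i\<close>
      cancels the whole row and column \<open>i\<close> of \<open>A\<close>.\<close>
    define A' :: "real^'n^'n" where "A' = (\<chi> j k. A $ j $ k - a $ j * a $ k / c)"
    have sA: "transpose A = A" using less.prems by (simp add: psd_def)
    have a: "a $ j = A $ j $ i" for j by (simp add: a_def matrix_vector_mult_basis column_def)
    have c: "c = axis i 1 \<bullet> a" "axis i 1 \<bullet> a = a $ i" by (auto simp: c_def inner_axis' a)
    have c0: "c > 0"
      using less.prems i c by (metis a a_def c_def order_le_less psd_def)
    have A'v: "A' *v x = A *v x - ((a \<bullet> x) / c) *\<^sub>R a" for x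
      by (simp add: A'_def vec_eq_iff matrix_vector_mult_def left_diff_distrib
          right_diff_distrib sum_subtractf inner_vec_def sum_divide_distrib sum_distrib_left mult_ac)
    have "psd A'"
      unfolding psd_def
    proof (intro conjI allI)
      show "transpose A' = A'"
        using sym_nth[OF sA] by (simp add: A'_def transpose_def vec_eq_iff mult.commute)
      fix x
      \<comment> \<open>This shift along \<open>axis i 1\<close> minimises the quadratic form of
        \<open>A\<close>; the minimum is the form of \<open>A'\<close> at \<open>x\<close>, which is
        thus nonnegative.\<close>
      define t where "t = (a \<bullet> x) / c"
      have "axis i 1 \<bullet> (A *v x) = a \<bullet> x"
        unfolding a_def by (rule inner_sym_matrix[OF sA])
      then have "(x - t *\<^sub>R axis i 1) \<bullet> (A *v (x - t *\<^sub>R axis i 1)) =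
          x \<bullet> (A *v x) - t * (x \<bullet> a) - t * (a \<bullet> x) + t * t * c"
        by (simp add: matrix_vector_mult_diff_distrib matrix_vector_mult_scaleR inner_diff_left
            inner_diff_right algebra_simps c(1) flip: a_def)
      also have "\<dots> = x \<bullet> (A' *v x)"
        using c0 by (simp add: A'v inner_diff_right inner_commute t_def)
      finally show "0 \<le> x \<bullet> (A' *v x)"
        using less.prems psd_def by metis
    qed
    \<comment> \<open>Zero diagonal entries stay zero because their column vanishes by
      \<open>psd_zero_diagonal\<close>, and entry \<open>i\<close> becomes zero, so the induction
      measure drops.\<close>
    moreover have "{j. A' $ j $ j \<noteq> 0} \<subset> {j. A $ j $ j \<noteq> 0}"
    proof
      have "A' $ j $ j = 0" if "A $ j $ j = 0" for j
        using psd_zero_diagonal[OF less.prems that, of i] sym_nth[OF sA, of i j] that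
        by (simp add: A'_def a)
      then show "{j. A' $ j $ j \<noteq> 0} \<subseteq> {j. A $ j $ j \<noteq> 0}" by blast
      have "A' $ i $ i = 0" using c0 by (simp add: A'_def a c_def)
      then show "{j. A' $ j $ j \<noteq> 0} \<noteq> {j. A $ j $ j \<noteq> 0}" using i by blast
    qed
    then have "card {j. A' $ j $ j \<noteq> 0} < card {j. A $ j $ j \<noteq> 0}"
      by (intro psubset_card_mono) auto
    ultimately have "0 \<le> trace (A' ** B)" using less.hyps by blast
    \<comment> \<open>The removed rank-one part contributes the quadratic form of \<open>B\<close>
      at \<open>a\<close>.\<close>
    moreover have "trace (A ** B) = trace (A' ** B) + (a \<bullet> (B *v a)) / c"
    proof -
      have sB: "B $ j $ k = B $ k $ j" for j k using assms(2) sym_nth psd_def by metis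
      show ?thesis
        by (simp add: trace_mult inner_matrix_vector_mult A'_def left_diff_distrib right_diff_distrib
          sum_subtractf sum_divide_distrib mult_ac sB)
    qed
    ultimately show ?thesis using assms(2) c0 by (simp add: psd_def)
  qed
qed

lemma posdef_invertible: "posdef A \<Longrightarrow> invertible A"
  unfolding invertible_left_inverse matrix_left_invertible_ker posdef_def
  by (metis inner_zero_right less_irrefl)

lemma matrix_inv_mult:
  assumes "invertible A"
  shows "A ** matrix_inv A = mat 1" "matrix_inv A ** A = mat 1"
  using someI_ex[OF assms[unfolded invertible_def]] by (auto simp: matrix_inv_def)

lemma matrix_inv_unique:
  fixes A B :: "real^'n^'n::finite"
  assumes "A ** B = mat 1"
  shows "matrix_inv A = B"
proof -
  have "invertible A" using assms invertible_right_inverse by blast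
  then have "matrix_inv A ** (A ** B) = B"
    by (simp add: matrix_mul_assoc matrix_inv_mult)
  then show ?thesis using assms by simp
qed

lemma matrix_inv_sym:
  fixes A :: "real^'n^'n::finite"
  assumes "invertible A" "transpose A = A"
  shows "transpose (matrix_inv A) = matrix_inv A"
proof -
  have "A ** transpose (matrix_inv A) = mat 1"
    using arg_cong[OF matrix_inv_mult(2)[OF assms(1)], of transpose] assms(2)
    by (simp add: matrix_transpose_mul)
  then show ?thesis using matrix_inv_unique by metis
qed

lemma psd_congruence: "psd A \<Longrightarrow> psd (B ** A ** transpose B)"
  unfolding psd_def
proof (intro conjI allI)
  assume A: "transpose A = A \<and> (\<forall>x. 0 \<le> x \<bullet> (A *v x))"
  then show "transpose (B ** A ** transpose B) = B ** A ** transpose B"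
    by (simp add: matrix_transpose_mul matrix_mul_assoc)
  fix x
  have "x \<bullet> (B ** A ** transpose B *v x) = x \<bullet> (B *v (A *v (transpose B *v x)))"
    by (simp only: matrix_vector_mul_assoc matrix_mul_assoc)
  also have "\<dots> = (transpose B *v x) \<bullet> (A *v (transpose B *v x))"
    by (metis dot_lmul_matrix transpose_matrix_vector)
  finally show "0 \<le> x \<bullet> (B ** A ** transpose B *v x)" using A by simp
qed

text \<open>The inverse is congruent to \<open>A\<close> itself: by symmetry it equals
  \<open>matrix_inv A ** A ** transpose (matrix_inv A)\<close>.\<close>

lemma psd_matrix_inv:
  assumes "posdef A"
  shows "psd (matrix_inv A)"
proof -
  have inv: "invertible A" and s: "transpose A = A"
    using assms posdef_invertible posdef_def by auto
  have "psd A" unfolding psd_def using assms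
    by (metis inner_zero_left less_imp_le order_refl posdef_def)
  then have "psd (matrix_inv A ** A ** transpose (matrix_inv A))" by (rule psd_congruence)
  then show ?thesis by (simp add: matrix_inv_mult[OF inv] matrix_inv_sym[OF inv s])
qed

text \<open>In the application \<open>A\<close> is the metric and \<open>B\<close> the covariant
  derivative of \<open>V\<close>. The product \<open>A ** B\<close> splits into the symmetric
  \<open>S\<close> and an antisymmetric \<open>F\<close>; the mixed traces vanish, and the square of
  the antisymmetric part has trace at most 0.\<close>

lemma trace_square_le:
  fixes A B S :: "real^'n^'n::finite"
  assumes "posdef A" "transpose S = S" "A ** B + transpose (A ** B) = 2 *\<^sub>R S"
  shows "trace (B ** B) \<le> trace ((matrix_inv A ** S) ** (matrix_inv A ** S))"
proof -
  let ?I = "matrix_inv A"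
  define F where "F = A ** B - S"
  have inv: "invertible A" and s: "transpose A = A"
    using assms posdef_invertible posdef_def by auto
  have F: "transpose F = - F"
  proof -
    have "transpose F = transpose (A ** B) - S"
      using sym_nth[OF assms(2)] by (simp add: F_def transpose_def vec_eq_iff)
    moreover have "transpose (A ** B) = 2 *\<^sub>R S - A ** B"
      using assms(3) by (simp add: algebra_simps)
    ultimately show ?thesis by (simp add: F_def scaleR_2)
  qed
  have B: "B = ?I ** S + ?I ** F"
    by (simp add: F_def matrix_add_ldistrib[symmetric] matrix_mul_assoc matrix_inv_mult[OF inv])
  have neg: "X ** (- Y) = - (X ** Y)" "(- Y) ** X = - (Y ** X)" for X Y :: "real^'n^'n"
    by (simp_all add: matrix_matrix_mult_def vec_eq_iff sum_negf)
  have trneg: "trace (- X) = - trace X" for X :: "real^'n^'n"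
    by (simp add: trace_def sum_negf)
  have rd: "(X + Y) ** Z = X ** Z + Y ** Z" for X Y Z :: "real^'n^'n"
    by (simp add: matrix_matrix_mult_def vec_eq_iff sum.distrib distrib_right)
  let ?P = "?I ** S" and ?Q = "?I ** F"
  \<comment> \<open>Transposition followed by a cyclic permutation turns the mixed trace into its
    own negative.\<close>
  have "trace (?P ** ?Q) = trace (transpose (?P ** ?Q))"
    by (simp add: trace_transpose)
  also have "transpose (?P ** ?Q) = - (F ** (?I ** (S ** ?I)))"
    by (simp add: matrix_transpose_mul F assms(2) matrix_inv_sym[OF inv s] matrix_mul_assoc neg)
  also have "trace \<dots> = - trace (F ** ((?I ** S) ** ?I))"
    by (simp add: trneg matrix_mul_assoc)
  also have "\<dots> = - trace (?P ** ?Q)"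
    using trace_mul_sym[of F "(?I ** S) ** ?I"] by (simp add: matrix_mul_assoc)
  finally have PQ: "trace (?P ** ?Q) = 0" by simp
  \<comment> \<open>Antisymmetry of \<open>F\<close> exhibits minus this trace as the trace of a
    product of two positive semidefinite matrices.\<close>
  have "trace (?Q ** ?Q) = - trace (?I ** (F ** ?I ** transpose F))"
    by (simp add: F neg trneg matrix_mul_assoc)
  also have "\<dots> \<le> 0"
    using trace_psd_mult_nonneg psd_matrix_inv[OF assms(1)] psd_congruence by (metis neg_le_0_iff_le)
  finally have QQ: "trace (?Q ** ?Q) \<le> 0" .
  have "trace (B ** B) = trace (?P ** ?P) + trace (?P ** ?Q) + trace (?Q ** ?P) + trace (?Q ** ?Q)"
    unfolding B by (simp add: matrix_add_ldistrib rd trace_add algebra_simps)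
  then show ?thesis using PQ QQ trace_mul_sym[of ?P ?Q] by simp
qed

text \<open>\<open>J\<close> is invertible because the nonzero \<open>det A\<close> is a multiple of
  \<open>det J\<close>, so the congruence can be solved for \<open>B\<close>.\<close>

lemma matrix_inv_congruence:
  fixes A B J :: "real^'n^'n::finite"
  assumes "A = transpose J ** B ** J" "invertible A"
  shows "matrix_inv B = J ** matrix_inv A ** transpose J"
proof -
  have "invertible J"
    using assms unfolding invertible_det_nz by (auto simp: det_mul)
  then obtain K where K: "J ** K = mat 1" "K ** J = mat 1" unfolding invertible_def by blast
  have K': "transpose K ** transpose J = mat 1"
    using arg_cong[OF K(1), of transpose] by (simp add: matrix_transpose_mul)
  have "transpose K ** A ** K = (transpose K ** transpose J) ** B ** (J ** K)"
    unfolding assms(1) by (simp add: matrix_mul_assoc)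
  then have B: "B = transpose K ** A ** K" using K K' by simp
  show ?thesis
  proof (rule matrix_inv_unique)
    have "B ** (J ** matrix_inv A ** transpose J) = transpose K ** (A ** (K ** J) ** matrix_inv A) ** transpose J"
      unfolding B by (simp add: matrix_mul_assoc)
    also have "\<dots> = mat 1" using K K' matrix_inv_mult[OF assms(2)] by simp
    finally show "B ** (J ** matrix_inv A ** transpose J) = mat 1" .
  qed
qed

section \<open>Derivative of the determinant and regularity of the inverse matrix\<close>

lemma pd_prod:
  assumes "finite I" "\<And>a. a \<in> I \<Longrightarrow> f a differentiable (at x)"
  shows "pd k (\<lambda>y. \<Prod>a\<in>I. f a y) x = (\<Sum>a\<in>I. pd k (f a) x * (\<Prod>b\<in>I - {a}. f b x))"
    and "(\<lambda>y. \<Prod>a\<in>I. f a y) differentiable (at x)"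
proof -
  have "((\<lambda>y. \<Prod>a\<in>I. f a y) has_derivative
      (\<lambda>h. \<Sum>a\<in>I. (\<Sum>i\<in>UNIV. pd i (f a) x * h $ i) * (\<Prod>b\<in>I - {a}. f b x))) (at x)"
    by (rule has_derivative_prod) (rule has_derivative_pd[OF assms(2)])
  from pd_eq[OF this, of k] this
  show "pd k (\<lambda>y. \<Prod>a\<in>I. f a y) x = (\<Sum>a\<in>I. pd k (f a) x * (\<Prod>b\<in>I - {a}. f b x))"
    and "(\<lambda>y. \<Prod>a\<in>I. f a y) differentiable (at x)"
    by (auto simp: axis_def if_distrib sum.delta differentiable_def cong: if_cong)
qed

text \<open>A permutation other than the identity moves at least two points, so its product has two
  factors vanishing at \<open>x\<close> and derivative 0 there; the identity permutation contributes
  the trace.\<close>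

lemma pd_det_at_identity:
  fixes M :: "real^'m::finite \<Rightarrow> real^'n^'n::finite"
  assumes d: "\<And>i j. (\<lambda>y. M y $ i $ j) differentiable (at x)" and one: "M x = mat 1"
  shows "pd k (\<lambda>y. det (M y)) x = (\<Sum>i\<in>UNIV. pd k (\<lambda>y. M y $ i $ i) x)"
proof -
  let ?P = "{p. p permutes (UNIV::'n set)}"
  have fin: "finite ?P" by (simp add: finite_permutations)
  have dp: "(\<lambda>y. \<Prod>i\<in>UNIV. M y $ i $ p i) differentiable (at x)" for p
    by (rule pd_prod(2)) (auto intro: d)
  have "pd k (\<lambda>y. det (M y)) x =
      (\<Sum>p\<in>?P. of_int (sign p) * pd k (\<lambda>y. \<Prod>i\<in>UNIV. M y $ i $ p i) x)"
    unfolding det_def by (subst pd_sum) (auto simp: pd_cmult dp)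
  also have "\<dots> = (\<Sum>p\<in>?P. if p = id then \<Sum>i\<in>UNIV. pd k (\<lambda>y. M y $ i $ i) x else 0)"
  proof (rule sum.cong[OF refl])
    fix p assume "p \<in> ?P"
    then have inj: "inj p" using permutes_inj by blast
    have z: "(\<Prod>b\<in>UNIV - {a}. M x $ b $ p b) = (if p = id then 1 else 0)" for a
    proof (cases "p = id")
      case False
      then obtain b where b: "p b \<noteq> b" by (metis eq_id_iff)
      \<comment> \<open>If the moved point is the omitted \<open>a\<close>, its image under
        \<open>p\<close> differs from \<open>a\<close> and is moved too, by injectivity.\<close>
      have "\<exists>b\<in>UNIV - {a}. p b \<noteq> b"
      proof (cases "b = a")
        case True
        then show ?thesis using b injD[OF inj, of "p b" b] by (intro bexI[of _ "p b"]) auto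
      next
        case False
        then show ?thesis using b by blast
      qed
      moreover have "M x $ b $ p b = 0" if "p b \<noteq> b" for b
        using that by (simp add: one mat_def)
      ultimately have "\<exists>b\<in>UNIV - {a}. M x $ b $ p b = 0" by blast
      then show ?thesis using False by (simp add: prod_zero)
    qed (simp add: one mat_def)
    show "of_int (sign p) * pd k (\<lambda>y. \<Prod>i\<in>UNIV. M y $ i $ p i) x =
        (if p = id then \<Sum>i\<in>UNIV. pd k (\<lambda>y. M y $ i $ i) x else 0)"
      by (subst pd_prod(1)) (auto simp: d z sign_id)
  qed
  also have "\<dots> = (\<Sum>i\<in>UNIV. pd k (\<lambda>y. M y $ i $ i) x)"
    using fin permutes_id[of UNIV] by (simp add: sum.delta')
  finally show ?thesis .
qed

lemma differentiable_det:
  fixes M :: "real^'m::finite \<Rightarrow> real^'n^'n::finite"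
  assumes "\<And>i j. (\<lambda>y. M y $ i $ j) differentiable (at x)"
  shows "(\<lambda>y. det (M y)) differentiable (at x)"
proof -
  have "(\<lambda>y. \<Prod>i\<in>UNIV. M y $ i $ p i) differentiable (at x)" for p
    by (rule pd_prod(2)) (auto intro: assms)
  then show ?thesis
    unfolding det_def by (intro differentiable_sum differentiable_mult) (auto simp: finite_permutations)
qed

text \<open>Multiplication by the fixed inverse of \<open>M x\<close> normalises the matrix to the
  identity at \<open>x\<close>, where \<open>pd_det_at_identity\<close> applies.\<close>

lemma jacobi_formula:
  fixes M :: "real^'m::finite \<Rightarrow> real^'n^'n::finite"
  assumes d: "\<And>i j. (\<lambda>y. M y $ i $ j) differentiable (at x)" and inv: "invertible (M x)"
  shows "pd k (\<lambda>y. det (M y)) x = det (M x) *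
    (\<Sum>i\<in>UNIV. \<Sum>j\<in>UNIV. matrix_inv (M x) $ i $ j * pd k (\<lambda>y. M y $ j $ i) x)"
proof -
  let ?C = "matrix_inv (M x)"
  have "det (M y) = det (M x) * det (?C ** M y)" for y
    using arg_cong[OF matrix_inv_mult(1)[OF inv], of det] by (simp add: det_mul mult.assoc[symmetric])
  then have eq: "(\<lambda>y. det (M y)) = (\<lambda>y. det (M x) * det (?C ** M y))" by blast
  have comp: "(\<lambda>y. (?C ** M y) $ i $ j) = (\<lambda>y. \<Sum>l\<in>UNIV. ?C $ i $ l * M y $ l $ j)" for i j
    by (simp add: matrix_matrix_mult_def)
  have dC: "(\<lambda>y. (?C ** M y) $ i $ j) differentiable (at x)" for i j
    unfolding comp by (intro differentiable_sum ballI differentiable_mult) (auto simp: d)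
  have pC: "pd k (\<lambda>y. (?C ** M y) $ i $ i) x = (\<Sum>l\<in>UNIV. ?C $ i $ l * pd k (\<lambda>y. M y $ l $ i) x)" for i
    unfolding comp by (subst pd_sum) (auto simp: d pd_cmult)
  have "pd k (\<lambda>y. det (M y)) x = det (M x) * pd k (\<lambda>y. det (?C ** M y)) x"
    by (subst eq, rule pd_cmult, rule differentiable_det[OF dC])
  also have "pd k (\<lambda>y. det (?C ** M y)) x = (\<Sum>i\<in>UNIV. pd k (\<lambda>y. (?C ** M y) $ i $ i) x)"
    by (rule pd_det_at_identity[OF dC]) (rule matrix_inv_mult(2)[OF inv])
  finally show ?thesis by (simp add: pC)
qed

lemma Ck_det:
  fixes M :: "real^'m::finite \<Rightarrow> real^'n^'n::finite"
  assumes "open U" "\<And>i j. Ck k U (\<lambda>y. M y $ i $ j)"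
  shows "Ck k U (\<lambda>y. det (M y))"
  unfolding det_def by (intro Ck_sum Ck_mult Ck_prod Ck_const assms)

lemma matrix_inv_cramer:
  fixes A :: "real^'n^'n::finite"
  assumes "invertible A"
  shows "matrix_inv A $ i $ j = det (\<chi> a b. if b = i then axis j 1 $ a else A $ a $ b) / det A"
proof -
  have "A *v (matrix_inv A *v axis j 1) = axis j 1"
    by (simp add: matrix_vector_mul_assoc matrix_inv_mult[OF assms])
  then have "matrix_inv A *v axis j 1 = (\<chi> k. det (\<chi> a b. if b = k then axis j 1 $ a else A $ a $ b) / det A)"
    using cramer assms invertible_det_nz by blast
  then show ?thesis
    by (metis (no_types, lifting) column_def matrix_vector_mult_basis vec_lambda_beta)
qed

text \<open>Cramer's rule writes each entry as a quotient of determinants, that is, of polynomials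
  in the entries of \<open>M\<close>.\<close>

lemma Ck_matrix_inv:
  fixes M :: "real^'m::finite \<Rightarrow> real^'n^'n::finite"
  assumes "open U" "\<And>i j. Ck k U (\<lambda>y. M y $ i $ j)" "\<And>y. y \<in> U \<Longrightarrow> invertible (M y)"
  shows "Ck k U (\<lambda>y. matrix_inv (M y) $ i $ j)"
proof (subst Ck_cong[OF assms(1) matrix_inv_cramer[OF assms(3)]])
  show "Ck k U (\<lambda>y. det (\<chi> a b. if b = i then axis j 1 $ a else M y $ a $ b) / det (M y))"
  proof (intro Ck_divide Ck_det assms)
    fix a b
    show "Ck k U (\<lambda>y. (\<chi> a b. if b = i then axis j 1 $ a else M y $ a $ b) $ a $ b)"
      by (cases "b = i") (simp_all add: assms(2))
    show "det (M y) \<noteq> 0" if "y \<in> U" for y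
      using assms(3)[OF that] by (simp add: invertible_det_nz)
  qed
qed

section \<open>Lie derivative and divergence in coordinates\<close>

text \<open>Here and in the next definitions the chart notions are copied for a bare matrix-valued
  function \<open>G\<close> on Euclidean space, so that local computations involve neither points
  nor charts of the manifold.\<close>

definition chris :: "(real^'n::finite \<Rightarrow> real^'n^'n) \<Rightarrow> 'n \<Rightarrow> 'n \<Rightarrow> 'n \<Rightarrow> real^'n \<Rightarrow> real" where
  "chris G k i j x = (1/2) * (\<Sum>l\<in>UNIV. matrix_inv (G x) $ k $ l *
     (pd i (\<lambda>y. G y $ j $ l) x + pd j (\<lambda>y. G y $ i $ l) x - pd l (\<lambda>y. G y $ i $ j) x))"

definition riem ::
  "(real^'n::finite \<Rightarrow> real^'n^'n) \<Rightarrow> 'n \<Rightarrow> 'n \<Rightarrow> 'n \<Rightarrow> 'n \<Rightarrow> real^'n \<Rightarrow> real" where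
  "riem G l i j k x = pd i (chris G l j k) x - pd j (chris G l i k) x
     + (\<Sum>s\<in>UNIV. chris G l i s x * chris G s j k x - chris G l j s x * chris G s i k x)"

definition ric :: "(real^'n::finite \<Rightarrow> real^'n^'n) \<Rightarrow> real^'n \<Rightarrow> real^'n \<Rightarrow> real" where
  "ric G x v = (\<Sum>j\<in>UNIV. \<Sum>k\<in>UNIV. (\<Sum>i\<in>UNIV. riem G i i j k x) * v $ j * v $ k)"

definition lie ::
  "(real^'n::finite \<Rightarrow> real^'n^'n) \<Rightarrow> (real^'n \<Rightarrow> real^'n) \<Rightarrow> real^'n \<Rightarrow> 'n \<Rightarrow> 'n \<Rightarrow> real" where
  "lie G V x i j = (\<Sum>k\<in>UNIV. V x $ k * pd k (\<lambda>y. G y $ i $ j) x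
     + G x $ k $ j * pd i (\<lambda>y. V y $ k) x + G x $ i $ k * pd j (\<lambda>y. V y $ k) x)"

definition ldiv :: "(real^'n::finite \<Rightarrow> real^'n^'n) \<Rightarrow> (real^'n \<Rightarrow> real^'n) \<Rightarrow> real^'n \<Rightarrow> real" where
  "ldiv G W x = (1/2) * (\<Sum>i\<in>UNIV. \<Sum>j\<in>UNIV. matrix_inv (G x) $ i $ j * lie G W x i j)"

text \<open>Upper index \<open>l\<close>, direction of differentiation \<open>j\<close>: the
  component \<open>\<nabla>_j V^l\<close> of the covariant derivative.\<close>

definition cov :: "(real^'n::finite \<Rightarrow> real^'n^'n) \<Rightarrow> (real^'n \<Rightarrow> real^'n) \<Rightarrow> 'n \<Rightarrow> 'n \<Rightarrow> real^'n \<Rightarrow> real" where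
  "cov G V l j x = pd j (\<lambda>y. V y $ l) x + (\<Sum>s\<in>UNIV. chris G l j s x * V x $ s)"

lemma christoffel_chris: "christoffel A g c = chris (components A g c)"
  by (intro ext) (simp add: christoffel_def chris_def)

lemma curvature_riem: "curvature A g c = riem (components A g c)"
  by (intro ext) (simp add: curvature_def riem_def christoffel_chris)

lemma lie_components_lie:
  "lie_components A V g c x i j = lie (components A g c) (\<lambda>y. V (point c y) c) x i j"
  by (simp add: lie_components_def lie_def)

lemma ricci_ric:
  "ricci A g p \<xi> \<xi> = ric (components A g (chart_at A p)) (coords (chart_at A p) p) (\<xi> (chart_at A p))"
  by (simp add: ricci_def ric_def curvature_riem Let_def)

text \<open>All derivatives are treated as independent symbols: \<open>J\<close> is the Jacobian of
  the coordinate change, \<open>dJ\<close> its derivative, and \<open>dWc i k\<close>,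
  \<open>dWd e a\<close> are derivatives of the old and new field components, direction first.
  Assumption \<open>sym\<close> is Schwarz's theorem, \<open>B\<close> the differentiated
  transformation law. The point is that the second derivatives \<open>dJ\<close> cancel.\<close>

lemma lie_transform_algebra:
  fixes J dWc dWd :: "'n::finite \<Rightarrow> 'n \<Rightarrow> real" and dJ dG :: "'n \<Rightarrow> 'n \<Rightarrow> 'n \<Rightarrow> real"
    and G :: "'n \<Rightarrow> 'n \<Rightarrow> real" and w :: "'n \<Rightarrow> real"
  assumes sym: "\<And>k a i. dJ k a i = dJ i a k"
    and B: "\<And>a i. (\<Sum>e\<in>UNIV. dWd e a * J e i) = (\<Sum>k\<in>UNIV. dJ i a k * w k + J a k * dWc i k)"
  shows "(\<Sum>k\<in>UNIV. w k * (\<Sum>a\<in>UNIV. \<Sum>b\<in>UNIV. dJ k a i * J b j * G a b + J a i * dJ k b j * G a b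
            + J a i * J b j * (\<Sum>e\<in>UNIV. dG e a b * J e k))
          + (\<Sum>a\<in>UNIV. \<Sum>b\<in>UNIV. J a k * J b j * G a b) * dWc i k
          + (\<Sum>a\<in>UNIV. \<Sum>b\<in>UNIV. J a i * J b k * G a b) * dWc j k)
    = (\<Sum>a\<in>UNIV. \<Sum>b\<in>UNIV. J a i * J b j *
        (\<Sum>e\<in>UNIV. (\<Sum>k\<in>UNIV. J e k * w k) * dG e a b + G e b * dWd a e + G a e * dWd b e))"
    (is "?L = ?R")
proof -
  \<comment> \<open>The law \<open>B\<close> solved for the derivative of the old components; the
    remainder in \<open>dJ\<close> cancels the terms that \<open>t1\<close> collects from
    differentiating the metric.\<close>
  have J1: "(\<Sum>k\<in>UNIV. J a k * dWc i k) = (\<Sum>e\<in>UNIV. dWd e a * J e i) - (\<Sum>k\<in>UNIV. w k * dJ k a i)" for a i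
    unfolding B by (simp add: sum.distrib sym[of i a] mult.commute)
  have S1: "(\<Sum>k\<in>UNIV. w k * (\<Sum>a\<in>UNIV. \<Sum>b\<in>UNIV. f k a b)) = (\<Sum>a\<in>UNIV. \<Sum>b\<in>UNIV. \<Sum>k\<in>UNIV. w k * f k a b)"
    for f :: "'n \<Rightarrow> 'n \<Rightarrow> 'n \<Rightarrow> real" and w :: "'n \<Rightarrow> real"
    unfolding sum_distrib_left by (subst sum.swap, rule sum.cong[OF refl], rule sum.swap)
  have t1: "(\<Sum>k\<in>UNIV. w k * (dJ k a i * J b j * G a b + J a i * dJ k b j * G a b
            + J a i * J b j * (\<Sum>e\<in>UNIV. dG e a b * J e k))) =
      (\<Sum>k\<in>UNIV. w k * dJ k a i) * J b j * G a b + (\<Sum>k\<in>UNIV. w k * dJ k b j) * J a i * G a b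
      + J a i * J b j * (\<Sum>e\<in>UNIV. (\<Sum>k\<in>UNIV. J e k * w k) * dG e a b)" for a b
  proof -
    have "(\<Sum>k\<in>UNIV. w k * (J a i * J b j * (\<Sum>e\<in>UNIV. dG e a b * J e k)))
        = J a i * J b j * (\<Sum>k\<in>UNIV. \<Sum>e\<in>UNIV. J e k * w k * dG e a b)"
      by (simp add: sum_distrib_left mult_ac)
    also have "(\<Sum>k\<in>UNIV. \<Sum>e\<in>UNIV. J e k * w k * dG e a b) = (\<Sum>e\<in>UNIV. (\<Sum>k\<in>UNIV. J e k * w k) * dG e a b)"
      by (subst sum.swap) (simp add: sum_distrib_right)
    finally show ?thesis by (simp add: distrib_left sum.distrib sum_distrib_right sum_distrib_left mult_ac)
  qed
  have t2: "(\<Sum>k\<in>UNIV. (\<Sum>a\<in>UNIV. \<Sum>b\<in>UNIV. J a k * J b j * G a b) * dWc i k)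
      = (\<Sum>a\<in>UNIV. \<Sum>b\<in>UNIV. J b j * G a b * (\<Sum>k\<in>UNIV. J a k * dWc i k))"
    using S1[of "dWc i" "\<lambda>k a b. J a k * J b j * G a b"] by (simp add: mult_ac sum_distrib_left)
  have t3: "(\<Sum>k\<in>UNIV. (\<Sum>a\<in>UNIV. \<Sum>b\<in>UNIV. J a i * J b k * G a b) * dWc j k)
      = (\<Sum>a\<in>UNIV. \<Sum>b\<in>UNIV. J a i * G a b * (\<Sum>k\<in>UNIV. J b k * dWc j k))"
    using S1[of "dWc j" "\<lambda>k a b. J a i * J b k * G a b"] by (simp add: mult_ac sum_distrib_left)
  have "?L = (\<Sum>a\<in>UNIV. \<Sum>b\<in>UNIV. J a i * J b j * (\<Sum>e\<in>UNIV. (\<Sum>k\<in>UNIV. J e k * w k) * dG e a b))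
      + (\<Sum>a\<in>UNIV. \<Sum>b\<in>UNIV. J b j * G a b * (\<Sum>e\<in>UNIV. dWd e a * J e i))
      + (\<Sum>a\<in>UNIV. \<Sum>b\<in>UNIV. J a i * G a b * (\<Sum>e\<in>UNIV. dWd e b * J e j))"
  proof -
    have "?L = (\<Sum>k\<in>UNIV. w k * (\<Sum>a\<in>UNIV. \<Sum>b\<in>UNIV. dJ k a i * J b j * G a b + J a i * dJ k b j * G a b
            + J a i * J b j * (\<Sum>e\<in>UNIV. dG e a b * J e k)))
          + (\<Sum>k\<in>UNIV. (\<Sum>a\<in>UNIV. \<Sum>b\<in>UNIV. J a k * J b j * G a b) * dWc i k)
          + (\<Sum>k\<in>UNIV. (\<Sum>a\<in>UNIV. \<Sum>b\<in>UNIV. J a i * J b k * G a b) * dWc j k)"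
      by (rule trans[OF sum.distrib arg_cong2[where f = "(+)", OF sum.distrib refl]])
    then show ?thesis
      unfolding S1 t1 t2 t3 J1 sum.distrib[symmetric]
      by (simp add: algebra_simps)
  qed
  also have "(\<Sum>a\<in>UNIV. \<Sum>b\<in>UNIV. J b j * G a b * (\<Sum>e\<in>UNIV. dWd e a * J e i))
      = (\<Sum>a\<in>UNIV. \<Sum>b\<in>UNIV. \<Sum>e\<in>UNIV. J a i * J b j * (G e b * dWd a e))"
  proof -
    have "(\<Sum>a\<in>UNIV. \<Sum>b\<in>UNIV. J b j * G a b * (\<Sum>e\<in>UNIV. dWd e a * J e i))
        = (\<Sum>b\<in>UNIV. \<Sum>a\<in>UNIV. \<Sum>e\<in>UNIV. J e i * J b j * (G a b * dWd e a))"
      by (subst sum.swap) (simp add: sum_distrib_left mult_ac)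
    also have "\<dots> = (\<Sum>b\<in>UNIV. \<Sum>a\<in>UNIV. \<Sum>e\<in>UNIV. J a i * J b j * (G e b * dWd a e))"
      by (rule sum.cong[OF refl], rule sum.swap)
    finally show ?thesis by (subst sum.swap)
  qed
  also have "(\<Sum>a\<in>UNIV. \<Sum>b\<in>UNIV. J a i * G a b * (\<Sum>e\<in>UNIV. dWd e b * J e j))
      = (\<Sum>a\<in>UNIV. \<Sum>b\<in>UNIV. \<Sum>e\<in>UNIV. J a i * J b j * (G a e * dWd b e))"
  proof (rule sum.cong[OF refl])
    fix a
    have "(\<Sum>b\<in>UNIV. J a i * G a b * (\<Sum>e\<in>UNIV. dWd e b * J e j))
        = (\<Sum>b\<in>UNIV. \<Sum>e\<in>UNIV. J a i * J e j * (G a b * dWd e b))"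
      by (simp add: sum_distrib_left mult_ac)
    then show "(\<Sum>b\<in>UNIV. J a i * G a b * (\<Sum>e\<in>UNIV. dWd e b * J e j))
      = (\<Sum>b\<in>UNIV. \<Sum>e\<in>UNIV. J a i * J b j * (G a e * dWd b e))"
      by (subst sum.swap)
  qed
  finally show ?thesis
    by (simp add: sum.distrib distrib_left sum_distrib_left)
qed

text \<open>Differentiating the transformation laws of the metric and of the field yields the data
  of \<open>lie_transform_algebra\<close>. Order two of \<open>\<tau>\<close> pays for
  differentiating its Jacobian and for the symmetry of the result.\<close>

lemma lie_transform:
  fixes \<tau> Wc Wd :: "real^'n::finite \<Rightarrow> real^'n" and Gc Gd :: "real^'n \<Rightarrow> real^'n^'n"
  defines "J \<equiv> \<lambda>a i y. pd i (\<lambda>z. \<tau> z $ a) y"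
  assumes O: "open O'" "x \<in> O'" and \<tau>: "\<And>a. Ck 2 O' (\<lambda>z. \<tau> z $ a)"
    and Gc: "\<And>y i j. y \<in> O' \<Longrightarrow> Gc y $ i $ j = (\<Sum>a\<in>UNIV. \<Sum>b\<in>UNIV. J a i y * J b j y * Gd (\<tau> y) $ a $ b)"
    and Wd: "\<And>y a. y \<in> O' \<Longrightarrow> Wd (\<tau> y) $ a = (\<Sum>i\<in>UNIV. J a i y * Wc y $ i)"
    and dG: "\<And>i j. (\<lambda>z. Gd z $ i $ j) differentiable (at (\<tau> x))"
    and dWd: "\<And>i. (\<lambda>z. Wd z $ i) differentiable (at (\<tau> x))"
    and dWc: "\<And>i. (\<lambda>z. Wc z $ i) differentiable (at x)"
  shows "lie Gc Wc x i j = (\<Sum>a\<in>UNIV. \<Sum>b\<in>UNIV. J a i x * J b j x * lie Gd Wd (\<tau> x) a b)"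
proof -
  have d\<tau>: "(\<lambda>z. \<tau> z $ a) differentiable (at x)" for a
    using Ck_differentiable[OF \<tau>] O by simp
  have dJ: "(\<lambda>y. J a i y) differentiable (at x)" for a i
    using \<tau>[of a] O(2) unfolding J_def by (simp add: numeral_2_eq_2)
  have sym: "pd k (J a i) x = pd i (J a k) x" for k a i
    using pd_commute[OF O(1) \<tau> O(2)] unfolding J_def by simp
  have dGt: "(\<lambda>y. Gd (\<tau> y) $ a $ b) differentiable (at x)"
    and pGt: "pd k (\<lambda>y. Gd (\<tau> y) $ a $ b) x = (\<Sum>e\<in>UNIV. pd e (\<lambda>z. Gd z $ a $ b) (\<tau> x) * J e k x)" for a b k
    using pd_chain[OF d\<tau> dG] by (auto simp: J_def)
  have pG: "pd k (\<lambda>y. Gc y $ i $ j) x = (\<Sum>a\<in>UNIV. \<Sum>b\<in>UNIV. pd k (J a i) x * J b j x * Gd (\<tau> x) $ a $ b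
      + J a i x * pd k (J b j) x * Gd (\<tau> x) $ a $ b
      + J a i x * J b j x * (\<Sum>e\<in>UNIV. pd e (\<lambda>z. Gd z $ a $ b) (\<tau> x) * J e k x))" for k
  proof -
    have prod: "pd k (\<lambda>y. J a i y * J b j y * Gd (\<tau> y) $ a $ b) x = pd k (J a i) x * J b j x * Gd (\<tau> x) $ a $ b
      + J a i x * pd k (J b j) x * Gd (\<tau> x) $ a $ b
      + J a i x * J b j x * (\<Sum>e\<in>UNIV. pd e (\<lambda>z. Gd z $ a $ b) (\<tau> x) * J e k x)" for a b
      by (subst pd_mult, fastforce intro!: differentiable_mult dJ, rule dGt, subst pd_mult, rule dJ, rule dJ)
        (simp add: pGt algebra_simps)
    have "pd k (\<lambda>y. Gc y $ i $ j) x = pd k (\<lambda>y. \<Sum>a\<in>UNIV. \<Sum>b\<in>UNIV. J a i y * J b j y * Gd (\<tau> y) $ a $ b) x"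
      by (rule pd_cong_open[OF O Gc])
    also have "\<dots> = (\<Sum>a\<in>UNIV. \<Sum>b\<in>UNIV. pd k (\<lambda>y. J a i y * J b j y * Gd (\<tau> y) $ a $ b) x)"
      by (subst pd_sum, fastforce intro!: differentiable_sum differentiable_mult dJ dGt,
          subst pd_sum, fastforce intro!: differentiable_sum differentiable_mult dJ dGt, rule refl)
    finally show ?thesis unfolding prod .
  qed
  \<comment> \<open>The new components along \<open>\<tau>\<close> are differentiated in two ways,
    by the chain rule and through the transformation law.\<close>
  have B: "(\<Sum>e\<in>UNIV. pd e (\<lambda>z. Wd z $ a) (\<tau> x) * J e i x)
      = (\<Sum>k\<in>UNIV. pd i (J a k) x * Wc x $ k + J a k x * pd i (\<lambda>y. Wc y $ k) x)" for a i
  proof -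
    have "(\<Sum>e\<in>UNIV. pd e (\<lambda>z. Wd z $ a) (\<tau> x) * J e i x) = pd i (\<lambda>y. Wd (\<tau> y) $ a) x"
      using pd_chain(1)[OF d\<tau> dWd] by (simp add: J_def)
    also have "\<dots> = pd i (\<lambda>y. \<Sum>k\<in>UNIV. J a k y * Wc y $ k) x"
      by (rule pd_cong_open[OF O Wd])
    also have "\<dots> = (\<Sum>k\<in>UNIV. pd i (J a k) x * Wc x $ k + J a k x * pd i (\<lambda>y. Wc y $ k) x)"
      by (subst pd_sum, fastforce intro!: differentiable_mult dJ dWc, subst pd_mult, rule dJ, rule dWc)
        (simp add: add.commute)
    finally show ?thesis .
  qed
  show ?thesis
    unfolding lie_def pG Wd[OF O(2)] Gc[OF O(2)]
    by (rule lie_transform_algebra[where dWd = "\<lambda>a b. pd a (\<lambda>z. Wd z $ b) (\<tau> x)"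
        and dJ = "\<lambda>k a i. pd k (J a i) x" and dG = "\<lambda>e a b. pd e (\<lambda>z. Gd z $ a $ b) (\<tau> x)", OF sym B])
qed

text \<open>A congruence by the Jacobian, read entrywise. The first part makes the inverse metric
  contravariant; the squared determinant in the second becomes the absolute Jacobian in the law for
  \<open>dens\<close>.\<close>

lemma congruence_matrix_inv:
  fixes J :: "'n::finite \<Rightarrow> 'n \<Rightarrow> real" and A B :: "real^'n^'n"
  assumes "\<And>i j. A $ i $ j = (\<Sum>a\<in>UNIV. \<Sum>b\<in>UNIV. J a i * J b j * B $ a $ b)" "invertible A"
  shows "matrix_inv B $ a $ b = (\<Sum>i\<in>UNIV. \<Sum>j\<in>UNIV. J a i * J b j * matrix_inv A $ i $ j)"
    and "det A = (det (\<chi> a i. J a i))\<^sup>2 * det B"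
proof -
  let ?J = "\<chi> a i. J a i"
  have A: "A = transpose ?J ** B ** ?J"
    unfolding vec_eq_iff
  proof (intro allI)
    fix i j
    show "A $ i $ j = (transpose ?J ** B ** ?J) $ i $ j"
      by (simp add: assms(1) matrix_matrix_mult_def transpose_def sum_distrib_left mult_ac)
        (subst sum.swap, simp add: mult_ac)
  qed
  from matrix_inv_congruence[OF this assms(2)]
  show "matrix_inv B $ a $ b = (\<Sum>i\<in>UNIV. \<Sum>j\<in>UNIV. J a i * J b j * matrix_inv A $ i $ j)"
    by (simp add: matrix_matrix_mult_def transpose_def sum_distrib_left mult_ac)
      (subst sum.swap, simp add: mult_ac)
  show "det A = (det ?J)\<^sup>2 * det B"
    by (simp add: A det_mul power2_eq_square)
qed

text \<open>The Jacobians carried by the covariant Lie derivative are absorbed by those of the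
  contravariant inverse metric.\<close>

lemma ldiv_transform:
  fixes \<tau> Wc Wd :: "real^'n::finite \<Rightarrow> real^'n" and Gc Gd :: "real^'n \<Rightarrow> real^'n^'n"
  defines "J \<equiv> \<lambda>a i y. pd i (\<lambda>z. \<tau> z $ a) y"
  assumes O: "open O'" "x \<in> O'" and \<tau>: "\<And>a. Ck 2 O' (\<lambda>z. \<tau> z $ a)"
    and Gc: "\<And>y i j. y \<in> O' \<Longrightarrow> Gc y $ i $ j = (\<Sum>a\<in>UNIV. \<Sum>b\<in>UNIV. J a i y * J b j y * Gd (\<tau> y) $ a $ b)"
    and Wd: "\<And>y a. y \<in> O' \<Longrightarrow> Wd (\<tau> y) $ a = (\<Sum>i\<in>UNIV. J a i y * Wc y $ i)"
    and dG: "\<And>i j. (\<lambda>z. Gd z $ i $ j) differentiable (at (\<tau> x))"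
    and dWd: "\<And>i. (\<lambda>z. Wd z $ i) differentiable (at (\<tau> x))"
    and dWc: "\<And>i. (\<lambda>z. Wc z $ i) differentiable (at x)"
    and inv: "invertible (Gc x)"
  shows "ldiv Gc Wc x = ldiv Gd Wd (\<tau> x)"
proof -
  let ?L = "lie Gd Wd (\<tau> x)" and ?H = "matrix_inv (Gc x)"
  have H: "matrix_inv (Gd (\<tau> x)) $ a $ b = (\<Sum>i\<in>UNIV. \<Sum>j\<in>UNIV. J a i x * J b j x * ?H $ i $ j)" for a b
    by (rule congruence_matrix_inv(1)[OF Gc[OF O(2)] inv])
  have lie_eq: "lie Gc Wc x i j = (\<Sum>a\<in>UNIV. \<Sum>b\<in>UNIV. J a i x * J b j x * ?L a b)" for i j
    unfolding J_def
    by (rule lie_transform[OF O \<tau> Gc[unfolded J_def] Wd[unfolded J_def] dG dWd dWc])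
  have "(\<Sum>i\<in>UNIV. \<Sum>j\<in>UNIV. ?H $ i $ j * lie Gc Wc x i j)
      = (\<Sum>i\<in>UNIV. \<Sum>j\<in>UNIV. \<Sum>a\<in>UNIV. \<Sum>b\<in>UNIV. ?H $ i $ j * (J a i x * J b j x * ?L a b))"
    by (simp only: lie_eq sum_distrib_left)
  also have "\<dots> = (\<Sum>i\<in>UNIV. \<Sum>a\<in>UNIV. \<Sum>b\<in>UNIV. \<Sum>j\<in>UNIV. ?H $ i $ j * (J a i x * J b j x * ?L a b))"
    by (rule sum.cong[OF refl], subst sum.swap, rule sum.cong[OF refl], rule sum.swap)
  also have "\<dots> = (\<Sum>a\<in>UNIV. \<Sum>b\<in>UNIV. \<Sum>i\<in>UNIV. \<Sum>j\<in>UNIV. ?H $ i $ j * (J a i x * J b j x * ?L a b))"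
    by (subst sum.swap, rule sum.cong[OF refl], rule sum.swap)
  also have "\<dots> = (\<Sum>a\<in>UNIV. \<Sum>b\<in>UNIV. matrix_inv (Gd (\<tau> x)) $ a $ b * ?L a b)"
    by (simp add: H sum_distrib_left mult_ac)
  finally show ?thesis by (simp add: ldiv_def)
qed

section \<open>The Bochner formula in a chart\<close>

text \<open>Again an identity between independent symbols: \<open>dv m l\<close> stands for the
  derivative of component \<open>l\<close> in direction \<open>m\<close>, and \<open>ddv\<close> and
  \<open>d\<Gamma>\<close> also carry directions first. The left side is the coordinate form of the
  divergence of \<open>\<nabla>_V V - (div V) V\<close>. The identity holds for every torsion-free
  connection; the metric does not enter.\<close>

lemma bochner_algebra:
  fixes v :: "'n::finite \<Rightarrow> real" and dv \<Gamma>c :: "'n \<Rightarrow> 'n \<Rightarrow> real" and ddv \<Gamma> :: "'n \<Rightarrow> 'n \<Rightarrow> 'n \<Rightarrow> real"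
    and d\<Gamma> :: "'n \<Rightarrow> 'n \<Rightarrow> 'n \<Rightarrow> 'n \<Rightarrow> real"
  assumes sym: "\<And>k i j. \<Gamma> k i j = \<Gamma> k j i" and ddv: "\<And>i j l. ddv i j l = ddv j i l"
  defines "B \<equiv> \<lambda>l j. dv j l + (\<Sum>s\<in>UNIV. \<Gamma> l j s * v s)"
    and "dB \<equiv> \<lambda>m l j. ddv m j l + (\<Sum>s\<in>UNIV. d\<Gamma> m l j s * v s + \<Gamma> l j s * dv m s)"
  defines "D \<equiv> \<Sum>i\<in>UNIV. B i i"
  shows "(\<Sum>l\<in>UNIV. (\<Sum>j\<in>UNIV. v j * dB l l j + dv l j * B l j)
            - (D * dv l l + (\<Sum>i\<in>UNIV. dB l i i) * v l))
        + (\<Sum>k\<in>UNIV. (\<Sum>i\<in>UNIV. \<Gamma> i i k) * ((\<Sum>j\<in>UNIV. v j * B k j) - D * v k))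
     = (\<Sum>j\<in>UNIV. \<Sum>k\<in>UNIV. (\<Sum>i\<in>UNIV. d\<Gamma> i i j k - d\<Gamma> j i i k
            + (\<Sum>s\<in>UNIV. \<Gamma> i i s * \<Gamma> s j k - \<Gamma> i j s * \<Gamma> s i k)) * v j * v k)
        + (\<Sum>l\<in>UNIV. \<Sum>j\<in>UNIV. B l j * B j l) - D\<^sup>2"
    (is "?lhs = ?ric + _ - _")
proof -
  have D: "D = (\<Sum>l\<in>UNIV. dv l l) + (\<Sum>k\<in>UNIV. (\<Sum>i\<in>UNIV. \<Gamma> i i k) * v k)"
    unfolding D_def B_def sum.distrib sum_distrib_right
    by (subst (2) sum.swap) simp
  \<comment> \<open>One factor \<open>dv l j\<close> is rewritten as \<open>B j l\<close> minus its
    connection term, which produces the trace of the squared covariant derivative.\<close>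
  have T1: "(\<Sum>l\<in>UNIV. \<Sum>j\<in>UNIV. dv l j * B l j) = (\<Sum>l\<in>UNIV. \<Sum>j\<in>UNIV. B l j * B j l)
      - (\<Sum>l\<in>UNIV. \<Sum>j\<in>UNIV. \<Sum>s\<in>UNIV. \<Gamma> j l s * v s * dv j l)
      - (\<Sum>l\<in>UNIV. \<Sum>j\<in>UNIV. \<Sum>s\<in>UNIV. \<Sum>t\<in>UNIV. \<Gamma> j l s * v s * \<Gamma> l j t * v t)"
  proof -
    have "dv l j * B l j = B l j * B j l - (\<Sum>s\<in>UNIV. \<Gamma> j l s * v s * dv j l)
        - (\<Sum>s\<in>UNIV. \<Sum>t\<in>UNIV. \<Gamma> j l s * v s * \<Gamma> l j t * v t)" for l j
    proof -
      have "dv l j = B j l - (\<Sum>s\<in>UNIV. \<Gamma> j l s * v s)" by (simp add: B_def)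
      then have "dv l j * B l j = (B j l - (\<Sum>s\<in>UNIV. \<Gamma> j l s * v s)) * B l j"
        by (rule arg_cong)
      also have "\<dots> = B l j * B j l - (\<Sum>s\<in>UNIV. \<Gamma> j l s * v s) * B l j"
        by (simp only: left_diff_distrib mult.commute[of "B j l"])
      also have "(\<Sum>s\<in>UNIV. \<Gamma> j l s * v s) * B l j = (\<Sum>s\<in>UNIV. \<Gamma> j l s * v s * dv j l)
        + (\<Sum>s\<in>UNIV. \<Sum>t\<in>UNIV. \<Gamma> j l s * v s * \<Gamma> l j t * v t)"
        unfolding B_def distrib_left sum_product by (simp add: sum_distrib_left mult_ac)
      finally show ?thesis by simp
    qed
    then show ?thesis by (simp add: sum_subtractf)
  qed
  have T2: "(\<Sum>l\<in>UNIV. \<Sum>j\<in>UNIV. v j * dB l l j) =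
        (\<Sum>l\<in>UNIV. \<Sum>j\<in>UNIV. v j * ddv l j l)
      + (\<Sum>l\<in>UNIV. \<Sum>j\<in>UNIV. \<Sum>s\<in>UNIV. d\<Gamma> l l j s * v j * v s)
      + (\<Sum>l\<in>UNIV. \<Sum>j\<in>UNIV. \<Sum>s\<in>UNIV. \<Gamma> l j s * v j * dv l s)"
    by (simp add: dB_def sum.distrib distrib_left sum_distrib_left mult_ac)
  have T3: "(\<Sum>l\<in>UNIV. (\<Sum>i\<in>UNIV. dB l i i) * v l) =
        (\<Sum>l\<in>UNIV. \<Sum>i\<in>UNIV. v l * ddv l i i)
      + (\<Sum>l\<in>UNIV. \<Sum>i\<in>UNIV. \<Sum>s\<in>UNIV. d\<Gamma> l i i s * v l * v s)
      + (\<Sum>l\<in>UNIV. \<Sum>i\<in>UNIV. \<Sum>s\<in>UNIV. \<Gamma> i i s * v l * dv l s)"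
    by (simp add: dB_def sum.distrib distrib_left sum_distrib_left mult_ac)
  have T4: "(\<Sum>k\<in>UNIV. (\<Sum>i\<in>UNIV. \<Gamma> i i k) * (\<Sum>j\<in>UNIV. v j * B k j)) =
        (\<Sum>k\<in>UNIV. \<Sum>i\<in>UNIV. \<Sum>j\<in>UNIV. \<Gamma> i i k * v j * dv j k)
      + (\<Sum>k\<in>UNIV. \<Sum>i\<in>UNIV. \<Sum>j\<in>UNIV. \<Sum>t\<in>UNIV. \<Gamma> i i k * v j * \<Gamma> k j t * v t)"
    unfolding sum_product B_def by (simp add: sum.distrib distrib_left sum_distrib_left mult_ac)
  \<comment> \<open>The second derivatives of \<open>V\<close> coming from the two parts of the
    field cancel through this equation.\<close>
  have E1: "(\<Sum>l\<in>UNIV. \<Sum>j\<in>UNIV. v j * ddv l j l) = (\<Sum>l\<in>UNIV. \<Sum>i\<in>UNIV. v l * ddv l i i)"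
    by (subst sum.swap) (simp add: ddv)
  have E2: "(\<Sum>k\<in>UNIV. \<Sum>i\<in>UNIV. \<Sum>j\<in>UNIV. \<Gamma> i i k * v j * dv j k)
      = (\<Sum>l\<in>UNIV. \<Sum>i\<in>UNIV. \<Sum>s\<in>UNIV. \<Gamma> i i s * v l * dv l s)" (is "?l = _")
  proof -
    have "?l = (\<Sum>i\<in>UNIV. \<Sum>k\<in>UNIV. \<Sum>j\<in>UNIV. \<Gamma> i i k * v j * dv j k)"
      by (rule sum.swap)
    also have "\<dots> = (\<Sum>i\<in>UNIV. \<Sum>j\<in>UNIV. \<Sum>k\<in>UNIV. \<Gamma> i i k * v j * dv j k)"
      by (rule sum.cong[OF refl], rule sum.swap)
    also have "\<dots> = (\<Sum>j\<in>UNIV. \<Sum>i\<in>UNIV. \<Sum>k\<in>UNIV. \<Gamma> i i k * v j * dv j k)"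
      by (rule sum.swap)
    finally show ?thesis .
  qed
  have E3: "(\<Sum>l\<in>UNIV. \<Sum>j\<in>UNIV. \<Sum>s\<in>UNIV. \<Gamma> j l s * v s * dv j l)
      = (\<Sum>l\<in>UNIV. \<Sum>j\<in>UNIV. \<Sum>s\<in>UNIV. \<Gamma> l j s * v j * dv l s)" (is "?l = _")
  proof -
    have "?l = (\<Sum>j\<in>UNIV. \<Sum>l\<in>UNIV. \<Sum>s\<in>UNIV. \<Gamma> j l s * v s * dv j l)"
      by (rule sum.swap)
    also have "\<dots> = (\<Sum>j\<in>UNIV. \<Sum>s\<in>UNIV. \<Sum>l\<in>UNIV. \<Gamma> j l s * v s * dv j l)"
      by (rule sum.cong[OF refl], rule sum.swap)
    finally show ?thesis using sym by simp
  qed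
  \<comment> \<open>The products of two Christoffel symbols left over, here and in
    \<open>Q2\<close>, are the quadratic part of the Ricci contraction.\<close>
  have Q1: "(\<Sum>k\<in>UNIV. \<Sum>i\<in>UNIV. \<Sum>j\<in>UNIV. \<Sum>t\<in>UNIV. \<Gamma> i i k * v j * \<Gamma> k j t * v t)
      = (\<Sum>j\<in>UNIV. \<Sum>k\<in>UNIV. \<Sum>i\<in>UNIV. \<Sum>s\<in>UNIV. \<Gamma> i i s * \<Gamma> s j k * v j * v k)" (is "?l = _")
  proof -
    have "?l = (\<Sum>i\<in>UNIV. \<Sum>k\<in>UNIV. \<Sum>j\<in>UNIV. \<Sum>t\<in>UNIV. \<Gamma> i i k * \<Gamma> k j t * v j * v t)"
      by (subst sum.swap) (simp add: mult_ac)
    also have "\<dots> = (\<Sum>i\<in>UNIV. \<Sum>j\<in>UNIV. \<Sum>t\<in>UNIV. \<Sum>k\<in>UNIV. \<Gamma> i i k * \<Gamma> k j t * v j * v t)"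
      by (rule sum.cong[OF refl], subst sum.swap, rule sum.cong[OF refl], rule sum.swap)
    also have "\<dots> = (\<Sum>j\<in>UNIV. \<Sum>t\<in>UNIV. \<Sum>i\<in>UNIV. \<Sum>k\<in>UNIV. \<Gamma> i i k * \<Gamma> k j t * v j * v t)"
      by (subst sum.swap, rule sum.cong[OF refl], rule sum.swap)
    finally show ?thesis .
  qed
  have Q2: "(\<Sum>l\<in>UNIV. \<Sum>j\<in>UNIV. \<Sum>s\<in>UNIV. \<Sum>t\<in>UNIV. \<Gamma> j l s * v s * \<Gamma> l j t * v t)
      = (\<Sum>j\<in>UNIV. \<Sum>k\<in>UNIV. \<Sum>i\<in>UNIV. \<Sum>s\<in>UNIV. \<Gamma> i j s * \<Gamma> s i k * v j * v k)" (is "?l = _")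
  proof -
    have "?l = (\<Sum>j\<in>UNIV. \<Sum>l\<in>UNIV. \<Sum>s\<in>UNIV. \<Sum>t\<in>UNIV. \<Gamma> j s l * \<Gamma> l j t * v s * v t)"
      by (subst sum.swap) (simp add: mult_ac sym[of _ _ "_ :: 'n"])
    also have "\<dots> = (\<Sum>j\<in>UNIV. \<Sum>s\<in>UNIV. \<Sum>t\<in>UNIV. \<Sum>l\<in>UNIV. \<Gamma> j s l * \<Gamma> l j t * v s * v t)"
      by (rule sum.cong[OF refl], subst sum.swap, rule sum.cong[OF refl], rule sum.swap)
    also have "\<dots> = (\<Sum>s\<in>UNIV. \<Sum>t\<in>UNIV. \<Sum>j\<in>UNIV. \<Sum>l\<in>UNIV. \<Gamma> j s l * \<Gamma> l j t * v s * v t)"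
      by (subst sum.swap, rule sum.cong[OF refl], rule sum.swap)
    finally show ?thesis .
  qed
  have R1: "(\<Sum>l\<in>UNIV. \<Sum>j\<in>UNIV. \<Sum>s\<in>UNIV. d\<Gamma> l l j s * v j * v s)
      = (\<Sum>j\<in>UNIV. \<Sum>k\<in>UNIV. \<Sum>i\<in>UNIV. d\<Gamma> i i j k * v j * v k)"
    by (subst sum.swap, rule sum.cong[OF refl], rule sum.swap)
  have R2: "(\<Sum>l\<in>UNIV. \<Sum>i\<in>UNIV. \<Sum>s\<in>UNIV. d\<Gamma> l i i s * v l * v s)
      = (\<Sum>j\<in>UNIV. \<Sum>k\<in>UNIV. \<Sum>i\<in>UNIV. d\<Gamma> j i i k * v j * v k)"
    by (rule sum.cong[OF refl], rule sum.swap)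
  have R: "?ric
      = (\<Sum>j\<in>UNIV. \<Sum>k\<in>UNIV. \<Sum>i\<in>UNIV. d\<Gamma> i i j k * v j * v k)
      - (\<Sum>j\<in>UNIV. \<Sum>k\<in>UNIV. \<Sum>i\<in>UNIV. d\<Gamma> j i i k * v j * v k)
      + (\<Sum>j\<in>UNIV. \<Sum>k\<in>UNIV. \<Sum>i\<in>UNIV. \<Sum>s\<in>UNIV. \<Gamma> i i s * \<Gamma> s j k * v j * v k)
      - (\<Sum>j\<in>UNIV. \<Sum>k\<in>UNIV. \<Sum>i\<in>UNIV. \<Sum>s\<in>UNIV. \<Gamma> i j s * \<Gamma> s i k * v j * v k)"
    by (simp add: sum.distrib sum_subtractf distrib_right left_diff_distrib sum_distrib_right)
  \<comment> \<open>The coordinate divergence of \<open>V\<close> and its connection term add up to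
    \<open>D\<close> once more, which is the source of the final square.\<close>
  have DD: "D * (\<Sum>l\<in>UNIV. dv l l) + D * (\<Sum>k\<in>UNIV. (\<Sum>i\<in>UNIV. \<Gamma> i i k) * v k) = D\<^sup>2"
    using arg_cong[OF D, of "(*) D"] by (simp add: power2_eq_square distrib_left)
  have L: "?lhs
     = (\<Sum>l\<in>UNIV. \<Sum>j\<in>UNIV. v j * dB l l j) + (\<Sum>l\<in>UNIV. \<Sum>j\<in>UNIV. dv l j * B l j)
        - (\<Sum>l\<in>UNIV. (\<Sum>i\<in>UNIV. dB l i i) * v l)
        + (\<Sum>k\<in>UNIV. (\<Sum>i\<in>UNIV. \<Gamma> i i k) * (\<Sum>j\<in>UNIV. v j * B k j))
        - (D * (\<Sum>l\<in>UNIV. dv l l) + D * (\<Sum>k\<in>UNIV. (\<Sum>i\<in>UNIV. \<Gamma> i i k) * v k))"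
    by (simp only: sum.distrib sum_subtractf right_diff_distrib sum_distrib_left[of D] mult.left_commute[of D] mult.commute[of _ "D * _"])
  show ?thesis
    unfolding L DD T1 T2 T3 T4 E1 E2 E3 Q1 Q2 R1 R2 R by simp
qed

text \<open>The field \<open>W\<close> of the overview in coordinates. The coefficient of
  \<open>V\<close> is what remains of \<open>2 * (|V|^2 / m + \<sigma>)\<close>, contributed by
  \<open>\<nabla>_V V\<close>, after subtracting the divergence
  \<open>|V|^2 / m + n * \<sigma>\<close>.\<close>

definition drift ::
  "(real^'n::finite \<Rightarrow> real^'n^'n) \<Rightarrow> (real^'n \<Rightarrow> real^'n) \<Rightarrow> (real^'n \<Rightarrow> real) \<Rightarrow> real \<Rightarrow> real^'n \<Rightarrow> real^'n" where
  "drift G V \<sigma> m y = (\<chi> l. (V y \<bullet> (G y *v V y) / m + (2 - real CARD('n)) * \<sigma> y) * V y $ l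
     - (\<Sum>i\<in>UNIV. matrix_inv (G y) $ l $ i * pd i (\<lambda>z. V z \<bullet> (G z *v V z)) y) / 2)"

text \<open>Order two of the metric leaves Christoffel symbols of class C^1, as the curvature and
  the divergence of \<open>W\<close> require.\<close>

locale metric_chart =
  fixes U :: "(real^'n::finite) set" and G :: "real^'n \<Rightarrow> real^'n^'n"
  assumes open_U: "open U" and Ck_G: "\<And>i j. Ck 2 U (\<lambda>x. G x $ i $ j)"
    and posdef_G: "\<And>x. x \<in> U \<Longrightarrow> posdef (G x)"
begin

abbreviation "H x \<equiv> matrix_inv (G x)"

lemma invertible_G: "x \<in> U \<Longrightarrow> invertible (G x)"
  using posdef_G posdef_invertible by blast

lemma G_transpose: "x \<in> U \<Longrightarrow> transpose (G x) = G x"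
  using posdef_G posdef_def by blast

lemma G_sym: "x \<in> U \<Longrightarrow> G x $ i $ j = G x $ j $ i"
  using G_transpose sym_nth by blast

lemma H_sym: "x \<in> U \<Longrightarrow> H x $ i $ j = H x $ j $ i"
  using matrix_inv_sym[OF invertible_G G_transpose] sym_nth by blast

lemma G_H: "x \<in> U \<Longrightarrow> (\<Sum>k\<in>UNIV. G x $ i $ k * H x $ k $ j) = (if i = j then 1 else 0)"
  using arg_cong[OF matrix_inv_mult(1)[OF invertible_G], of x "\<lambda>M. M $ i $ j"]
  by (simp add: matrix_matrix_mult_def mat_def)

lemma H_G: "x \<in> U \<Longrightarrow> (\<Sum>k\<in>UNIV. H x $ i $ k * G x $ k $ j) = (if i = j then 1 else 0)"
  using arg_cong[OF matrix_inv_mult(2)[OF invertible_G], of x "\<lambda>M. M $ i $ j"]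
  by (simp add: matrix_matrix_mult_def mat_def)

lemma differentiable_G: "x \<in> U \<Longrightarrow> (\<lambda>y. G y $ i $ j) differentiable (at x)"
  using Ck_differentiable[OF Ck_G] by simp

lemma pd_G_sym: "x \<in> U \<Longrightarrow> pd k (\<lambda>y. G y $ i $ j) x = pd k (\<lambda>y. G y $ j $ i) x"
  by (rule pd_cong_open[OF open_U]) (auto intro: G_sym)

lemma Ck_H: "Ck 2 U (\<lambda>x. H x $ i $ j)"
  by (rule Ck_matrix_inv[OF open_U Ck_G invertible_G])

lemma Ck_pd_G: "Ck 1 U (pd k (\<lambda>x. G x $ i $ j))"
  using Ck_G[of i j] by (simp add: numeral_2_eq_2)

lemma Ck_chris: "Ck 1 U (chris G k i j)"
proof -
  have "Ck 1 U (\<lambda>x. (1/2) * (\<Sum>l\<in>UNIV. H x $ k $ l *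
     (pd i (\<lambda>y. G y $ j $ l) x + pd j (\<lambda>y. G y $ i $ l) x - pd l (\<lambda>y. G y $ i $ j) x)))"
    by (intro Ck_mult Ck_sum Ck_add Ck_diff Ck_const Ck_pd_G open_U Ck_mono[OF Ck_H]) simp
  then show ?thesis unfolding chris_def[abs_def] .
qed

lemma chris_sym: "x \<in> U \<Longrightarrow> chris G k i j x = chris G k j i x"
  using pd_G_sym[of x _ i j] by (simp add: chris_def add.commute)

lemma chris_lower:
  assumes "x \<in> U"
  shows "(\<Sum>l\<in>UNIV. G x $ a $ l * chris G l i j x) =
    (pd i (\<lambda>y. G y $ j $ a) x + pd j (\<lambda>y. G y $ i $ a) x - pd a (\<lambda>y. G y $ i $ j) x) / 2"
proof -
  let ?T = "\<lambda>l. pd i (\<lambda>y. G y $ j $ l) x + pd j (\<lambda>y. G y $ i $ l) x - pd l (\<lambda>y. G y $ i $ j) x"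
  have "(\<Sum>l\<in>UNIV. G x $ a $ l * chris G l i j x)
      = (\<Sum>l\<in>UNIV. \<Sum>b\<in>UNIV. G x $ a $ l * H x $ l $ b * ?T b) / 2"
    by (simp add: chris_def sum_distrib_left sum_divide_distrib mult_ac)
  also have "(\<Sum>l\<in>UNIV. \<Sum>b\<in>UNIV. G x $ a $ l * H x $ l $ b * ?T b)
      = (\<Sum>b\<in>UNIV. (\<Sum>l\<in>UNIV. G x $ a $ l * H x $ l $ b) * ?T b)"
    by (subst sum.swap) (simp add: sum_distrib_right)
  also have "\<dots> = ?T a"
    by (simp add: G_H[OF assms] if_distrib[of "\<lambda>t. t * _"] cong: if_cong)
  finally show ?thesis .
qed

text \<open>After contraction two of the three derivative terms cancel by symmetry of the inverse
  metric. The surviving half trace is the logarithmic derivative of the Riemannian density.\<close>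

lemma chris_contract:
  assumes "x \<in> U"
  shows "(\<Sum>i\<in>UNIV. chris G i i k x) =
    (1/2) * (\<Sum>i\<in>UNIV. \<Sum>j\<in>UNIV. H x $ i $ j * pd k (\<lambda>y. G y $ i $ j) x)"
proof -
  have "(\<Sum>i\<in>UNIV. \<Sum>l\<in>UNIV. H x $ i $ l * pd i (\<lambda>y. G y $ k $ l) x)
      = (\<Sum>i\<in>UNIV. \<Sum>l\<in>UNIV. H x $ i $ l * pd l (\<lambda>y. G y $ i $ k) x)"
    by (subst sum.swap) (simp add: H_sym[OF assms] pd_G_sym[OF assms, of _ k])
  moreover have "(\<Sum>i\<in>UNIV. chris G i i k x) =
      (1/2) * ((\<Sum>i\<in>UNIV. \<Sum>l\<in>UNIV. H x $ i $ l * pd i (\<lambda>y. G y $ k $ l) x)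
        + (\<Sum>i\<in>UNIV. \<Sum>l\<in>UNIV. H x $ i $ l * pd k (\<lambda>y. G y $ i $ l) x)
        - (\<Sum>i\<in>UNIV. \<Sum>l\<in>UNIV. H x $ i $ l * pd l (\<lambda>y. G y $ i $ k) x))"
    unfolding chris_def sum_distrib_left[symmetric]
    by (simp add: distrib_left right_diff_distrib sum.distrib sum_subtractf)
  ultimately show ?thesis by simp
qed

text \<open>Links the two faces of the divergence: the trace of the Lie derivative is the form that
  is easily seen to be chart independent, the coordinate formula the one that can be integrated by
  parts.\<close>

lemma ldiv_eq:
  assumes x: "x \<in> U"
  shows "ldiv G W x = (\<Sum>l\<in>UNIV. pd l (\<lambda>y. W y $ l) x) + (\<Sum>k\<in>UNIV. (\<Sum>i\<in>UNIV. chris G i i k x) * W x $ k)"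
proof -
  let ?dW = "\<lambda>i k. pd i (\<lambda>y. W y $ k) x"
  have 1: "(\<Sum>i\<in>UNIV. \<Sum>j\<in>UNIV. \<Sum>k\<in>UNIV. H x $ i $ j * (W x $ k * pd k (\<lambda>y. G y $ i $ j) x))
      = (\<Sum>k\<in>UNIV. W x $ k * (\<Sum>i\<in>UNIV. \<Sum>j\<in>UNIV. H x $ i $ j * pd k (\<lambda>y. G y $ i $ j) x))"
  proof -
    have "(\<Sum>i\<in>UNIV. \<Sum>j\<in>UNIV. \<Sum>k\<in>UNIV. H x $ i $ j * (W x $ k * pd k (\<lambda>y. G y $ i $ j) x))
        = (\<Sum>i\<in>UNIV. \<Sum>k\<in>UNIV. \<Sum>j\<in>UNIV. H x $ i $ j * (W x $ k * pd k (\<lambda>y. G y $ i $ j) x))"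
      by (rule sum.cong[OF refl], rule sum.swap)
    also have "\<dots> = (\<Sum>k\<in>UNIV. \<Sum>i\<in>UNIV. \<Sum>j\<in>UNIV. H x $ i $ j * (W x $ k * pd k (\<lambda>y. G y $ i $ j) x))"
      by (rule sum.swap)
    finally show ?thesis by (simp add: sum_distrib_left mult_ac)
  qed
  have 2: "(\<Sum>i\<in>UNIV. \<Sum>j\<in>UNIV. \<Sum>k\<in>UNIV. H x $ i $ j * (G x $ k $ j * ?dW i k)) = (\<Sum>l\<in>UNIV. ?dW l l)"
  proof -
    have "(\<Sum>i\<in>UNIV. \<Sum>j\<in>UNIV. \<Sum>k\<in>UNIV. H x $ i $ j * (G x $ k $ j * ?dW i k))
        = (\<Sum>i\<in>UNIV. \<Sum>k\<in>UNIV. \<Sum>j\<in>UNIV. H x $ i $ j * G x $ j $ k * ?dW i k)"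
      by (rule sum.cong[OF refl], subst sum.swap) (simp add: mult_ac G_sym[OF x])
    also have "\<dots> = (\<Sum>i\<in>UNIV. \<Sum>k\<in>UNIV. (if i = k then 1 else 0) * ?dW i k)"
      by (simp add: H_G[OF x] flip: sum_distrib_right)
    finally show ?thesis by (simp add: if_distrib[of "\<lambda>t. t * _"] cong: if_cong)
  qed
  have 3: "(\<Sum>i\<in>UNIV. \<Sum>j\<in>UNIV. \<Sum>k\<in>UNIV. H x $ i $ j * (G x $ i $ k * ?dW j k)) = (\<Sum>l\<in>UNIV. ?dW l l)"
    unfolding 2[symmetric]
    by (subst sum.swap) (simp add: H_sym[OF x] G_sym[OF x])
  have "ldiv G W x = (1/2) * ((\<Sum>i\<in>UNIV. \<Sum>j\<in>UNIV. \<Sum>k\<in>UNIV. H x $ i $ j * (W x $ k * pd k (\<lambda>y. G y $ i $ j) x))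
      + (\<Sum>i\<in>UNIV. \<Sum>j\<in>UNIV. \<Sum>k\<in>UNIV. H x $ i $ j * (G x $ k $ j * ?dW i k))
      + (\<Sum>i\<in>UNIV. \<Sum>j\<in>UNIV. \<Sum>k\<in>UNIV. H x $ i $ j * (G x $ i $ k * ?dW j k)))"
    unfolding ldiv_def lie_def by (simp only: sum.distrib distrib_left sum_distrib_left)
  moreover have "(\<Sum>k\<in>UNIV. (\<Sum>i\<in>UNIV. chris G i i k x) * W x $ k) =
      (1/2) * (\<Sum>k\<in>UNIV. W x $ k * (\<Sum>i\<in>UNIV. \<Sum>j\<in>UNIV. H x $ i $ j * pd k (\<lambda>y. G y $ i $ j) x))"
    unfolding chris_contract[OF x] by (subst sum_distrib_left) (simp add: mult_ac)
  ultimately show ?thesis unfolding 1 2 3 by simp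
qed

lemma ldiv_eq_cov:
  assumes x: "x \<in> U"
  shows "ldiv G V x = (\<Sum>i\<in>UNIV. cov G V i i x)"
  unfolding ldiv_eq[OF x] cov_def sum.distrib sum_distrib_right
  by (subst (2) sum.swap) simp

lemma Ck_cov:
  assumes "\<And>l. Ck 2 U (\<lambda>y. V y $ l)"
  shows "Ck 1 U (cov G V l j)"
proof -
  have "Ck 1 U (pd j (\<lambda>y. V y $ l))" using assms[of l] by (simp add: numeral_2_eq_2)
  then show ?thesis
    unfolding cov_def[abs_def]
    by (intro Ck_add Ck_sum Ck_mult open_U Ck_chris Ck_mono[OF assms]) simp_all
qed

text \<open>Order two of \<open>V\<close> makes every entry of \<open>cov\<close> differentiable, so
  \<open>W\<close> can be differentiated termwise; the rest is \<open>bochner_algebra\<close>, with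
  \<open>chris_sym\<close> as vanishing torsion.\<close>

lemma bochner:
  assumes V: "\<And>l. Ck 2 U (\<lambda>y. V y $ l)" and x: "x \<in> U"
    and W: "\<And>y l. y \<in> U \<Longrightarrow> W y $ l = (\<Sum>j\<in>UNIV. V y $ j * cov G V l j y) - ldiv G V y * V y $ l"
  shows "ldiv G W x = ric G x (V x)
    + (\<Sum>l\<in>UNIV. \<Sum>j\<in>UNIV. cov G V l j x * cov G V j l x) - (ldiv G V x)\<^sup>2"
proof -
  have dV: "(\<lambda>y. V y $ l) differentiable (at x)" for l
    using Ck_differentiable[OF V _ x] by simp
  have ddV: "pd j (\<lambda>y. V y $ l) differentiable (at x)" for j l
    using V[of l] x by (simp add: numeral_2_eq_2)
  have dch: "chris G l j s differentiable (at x)" for l j s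
    using Ck_differentiable[OF Ck_chris _ x] by simp
  have dcov: "cov G V l j differentiable (at x)" for l j
    using Ck_differentiable[OF Ck_cov[OF V] _ x] by simp
  let ?dB = "\<lambda>m l j. pd m (pd j (\<lambda>y. V y $ l)) x
      + (\<Sum>s\<in>UNIV. pd m (chris G l j s) x * V x $ s + chris G l j s x * pd m (\<lambda>y. V y $ s) x)"
  have pcov: "pd m (cov G V l j) x = ?dB m l j" for m l j
  proof -
    have "pd m (cov G V l j) x = pd m (\<lambda>y. pd j (\<lambda>y. V y $ l) y) x
        + pd m (\<lambda>y. \<Sum>s\<in>UNIV. chris G l j s y * V y $ s) x"
      unfolding cov_def[abs_def]
      by (rule pd_add[OF ddV]) (intro differentiable_sum ballI differentiable_mult dch dV, simp)
    also have "pd m (\<lambda>y. \<Sum>s\<in>UNIV. chris G l j s y * V y $ s) x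
        = (\<Sum>s\<in>UNIV. pd m (\<lambda>y. chris G l j s y * V y $ s) x)"
      by (rule pd_sum) (intro differentiable_mult dch dV)
    finally show ?thesis by (simp add: pd_mult[OF dch dV] add.commute)
  qed
  define D where "D = (\<Sum>i\<in>UNIV. cov G V i i x)"
  have pW: "pd m (\<lambda>y. W y $ l) x = (\<Sum>j\<in>UNIV. V x $ j * ?dB m l j + pd m (\<lambda>y. V y $ j) x * cov G V l j x)
      - (D * pd m (\<lambda>y. V y $ l) x + (\<Sum>i\<in>UNIV. ?dB m i i) * V x $ l)" for m l
  proof -
    have "pd m (\<lambda>y. W y $ l) x = pd m (\<lambda>y. (\<Sum>j\<in>UNIV. V y $ j * cov G V l j y)
        - (\<Sum>i\<in>UNIV. cov G V i i y) * V y $ l) x"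
      by (rule pd_cong_open[OF open_U x]) (simp add: W ldiv_eq_cov)
    also have "\<dots> = pd m (\<lambda>y. \<Sum>j\<in>UNIV. V y $ j * cov G V l j y) x
        - pd m (\<lambda>y. (\<Sum>i\<in>UNIV. cov G V i i y) * V y $ l) x"
      by (rule pd_diff) (intro differentiable_sum ballI differentiable_mult dcov dV finite)+
    also have "pd m (\<lambda>y. \<Sum>j\<in>UNIV. V y $ j * cov G V l j y) x
        = (\<Sum>j\<in>UNIV. pd m (\<lambda>y. V y $ j * cov G V l j y) x)"
      by (rule pd_sum) (intro differentiable_mult dcov dV)
    also have "pd m (\<lambda>y. (\<Sum>i\<in>UNIV. cov G V i i y) * V y $ l) x
        = D * pd m (\<lambda>y. V y $ l) x + pd m (\<lambda>y. \<Sum>i\<in>UNIV. cov G V i i y) x * V x $ l"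
      unfolding D_def by (rule pd_mult[OF _ dV]) (intro differentiable_sum ballI dcov finite)
    also have "pd m (\<lambda>y. \<Sum>i\<in>UNIV. cov G V i i y) x = (\<Sum>i\<in>UNIV. pd m (cov G V i i) x)"
      by (rule pd_sum[OF dcov])
    finally show ?thesis by (simp only: pd_mult[OF dV dcov] pcov)
  qed
  have sym2: "pd i (pd j (\<lambda>y. V y $ l)) x = pd j (pd i (\<lambda>y. V y $ l)) x" for i j l
    by (rule pd_commute[OF open_U V x])
  have Wx: "W x $ k = (\<Sum>j\<in>UNIV. V x $ j * cov G V k j x) - D * V x $ k" for k
    by (simp add: W[OF x] ldiv_eq_cov[OF x] D_def)
  show ?thesis
    unfolding ldiv_eq[OF x, of W] pW Wx ldiv_eq_cov[OF x, of V] D_def ric_def riem_def cov_def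
    by (rule bochner_algebra[where v = "\<lambda>j. V x $ j" and dv = "\<lambda>m l. pd m (\<lambda>y. V y $ l) x"
        and ddv = "\<lambda>i j l. pd i (pd j (\<lambda>y. V y $ l)) x" and \<Gamma> = "\<lambda>k i j. chris G k i j x"
        and d\<Gamma> = "\<lambda>m k i j. pd m (chris G k i j) x", OF chris_sym[OF x] sym2])
qed

text \<open>Lowering the index of \<open>cov\<close> turns Christoffel symbols into derivatives of
  the metric; in the symmetric sum these collapse to the derivative of the metric along
  \<open>V\<close>.\<close>

lemma lie_cov:
  assumes x: "x \<in> U"
  shows "lie G V x i j = (\<Sum>l\<in>UNIV. G x $ i $ l * cov G V l j x) + (\<Sum>l\<in>UNIV. G x $ j $ l * cov G V l i x)"
proof -
  let ?t = "\<lambda>i j s. V x $ s * ((pd j (\<lambda>y. G y $ s $ i) x + pd s (\<lambda>y. G y $ j $ i) x - pd i (\<lambda>y. G y $ j $ s) x) / 2)"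
  have low: "(\<Sum>l\<in>UNIV. G x $ i $ l * cov G V l j x) = (\<Sum>l\<in>UNIV. G x $ i $ l * pd j (\<lambda>y. V y $ l) x)
      + (\<Sum>s\<in>UNIV. ?t i j s)"
    for i j
  proof -
    have "(\<Sum>l\<in>UNIV. G x $ i $ l * (\<Sum>s\<in>UNIV. chris G l j s x * V x $ s))
        = (\<Sum>s\<in>UNIV. V x $ s * (\<Sum>l\<in>UNIV. G x $ i $ l * chris G l j s x))"
      unfolding sum_distrib_left by (subst sum.swap) (simp add: mult_ac)
    then show ?thesis by (simp add: cov_def distrib_left sum.distrib chris_lower[OF x])
  qed
  have "(\<Sum>s\<in>UNIV. ?t i j s)
      + (\<Sum>s\<in>UNIV. ?t j i s)
      = (\<Sum>s\<in>UNIV. V x $ s * pd s (\<lambda>y. G y $ i $ j) x)"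
    unfolding sum.distrib[symmetric]
  proof (rule sum.cong[OF refl])
    fix s
    show "?t i j s
      + ?t j i s
      = V x $ s * pd s (\<lambda>y. G y $ i $ j) x"
      unfolding pd_G_sym[OF x, of j s i] pd_G_sym[OF x, of s j i] pd_G_sym[OF x, of i s j]
      by (simp add: field_simps)
  qed
  moreover have "(\<Sum>k\<in>UNIV. G x $ k $ j * pd i (\<lambda>y. V y $ k) x) = (\<Sum>l\<in>UNIV. G x $ j $ l * pd i (\<lambda>y. V y $ l) x)"
    using G_sym[OF x] by simp
  ultimately show ?thesis
    unfolding low lie_def sum.distrib by simp
qed

text \<open>Compatibility of the connection with the metric. Contracted twice with \<open>V\<close>,
  two of the three terms of the lowered Christoffel symbol cancel.\<close>

lemma cov_lower_gradient:
  assumes x: "x \<in> U" and dV: "\<And>l. (\<lambda>y. V y $ l) differentiable (at x)"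
  shows "pd i (\<lambda>y. V y \<bullet> (G y *v V y)) x
    = 2 * (\<Sum>j\<in>UNIV. V x $ j * (\<Sum>l\<in>UNIV. G x $ j $ l * cov G V l i x))"
proof -
  note dG = differentiable_G[OF x]
  let ?Q = "(\<Sum>j\<in>UNIV. V x $ j * (\<Sum>s\<in>UNIV. V x $ s * ((pd i (\<lambda>y. G y $ s $ j) x + pd s (\<lambda>y. G y $ i $ j) x - pd j (\<lambda>y. G y $ i $ s) x) / 2)))"
  have "pd i (\<lambda>y. V y \<bullet> (G y *v V y)) x
      = pd i (\<lambda>y. \<Sum>a\<in>UNIV. \<Sum>b\<in>UNIV. G y $ a $ b * V y $ a * V y $ b) x"
    by (simp add: inner_matrix_vector_mult)
  also have "\<dots> = (\<Sum>a\<in>UNIV. pd i (\<lambda>y. \<Sum>b\<in>UNIV. G y $ a $ b * V y $ a * V y $ b) x)"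
    by (rule pd_sum) (intro differentiable_sum ballI differentiable_mult dG dV finite)
  also have "\<dots> = (\<Sum>a\<in>UNIV. \<Sum>b\<in>UNIV. pd i (\<lambda>y. G y $ a $ b * V y $ a * V y $ b) x)"
    by (rule sum.cong[OF refl], rule pd_sum) (intro differentiable_mult dG dV)
  also have "\<dots> = (\<Sum>a\<in>UNIV. \<Sum>b\<in>UNIV. pd i (\<lambda>y. G y $ a $ b) x * V x $ a * V x $ b)
      + (\<Sum>a\<in>UNIV. \<Sum>b\<in>UNIV. G x $ a $ b * pd i (\<lambda>y. V y $ a) x * V x $ b)
      + (\<Sum>a\<in>UNIV. \<Sum>b\<in>UNIV. G x $ a $ b * V x $ a * pd i (\<lambda>y. V y $ b) x)"
  proof -
    have "pd i (\<lambda>y. G y $ a $ b * V y $ a * V y $ b) x = pd i (\<lambda>y. G y $ a $ b) x * V x $ a * V x $ b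
        + G x $ a $ b * pd i (\<lambda>y. V y $ a) x * V x $ b + G x $ a $ b * V x $ a * pd i (\<lambda>y. V y $ b) x" for a b
      by (subst pd_mult[OF differentiable_mult[OF dG dV] dV], subst pd_mult[OF dG dV])
        (simp add: algebra_simps)
    then show ?thesis by (simp only: sum.distrib)
  qed
  also have "(\<Sum>a\<in>UNIV. \<Sum>b\<in>UNIV. G x $ a $ b * pd i (\<lambda>y. V y $ a) x * V x $ b)
      = (\<Sum>a\<in>UNIV. \<Sum>b\<in>UNIV. G x $ a $ b * V x $ a * pd i (\<lambda>y. V y $ b) x)"
    by (subst sum.swap) (simp add: G_sym[OF x] mult_ac)
  finally have 1: "pd i (\<lambda>y. V y \<bullet> (G y *v V y)) x
      = (\<Sum>a\<in>UNIV. \<Sum>b\<in>UNIV. pd i (\<lambda>y. G y $ a $ b) x * V x $ a * V x $ b)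
      + 2 * (\<Sum>a\<in>UNIV. \<Sum>b\<in>UNIV. G x $ a $ b * V x $ a * pd i (\<lambda>y. V y $ b) x)" by simp
  have low: "(\<Sum>l\<in>UNIV. G x $ j $ l * (\<Sum>s\<in>UNIV. chris G l i s x * V x $ s))
      = (\<Sum>s\<in>UNIV. V x $ s * ((pd i (\<lambda>y. G y $ s $ j) x + pd s (\<lambda>y. G y $ i $ j) x - pd j (\<lambda>y. G y $ i $ s) x) / 2))"
    for j
    unfolding sum_distrib_left chris_lower[OF x, symmetric] by (subst sum.swap) (simp add: mult_ac)
  have "(\<Sum>j\<in>UNIV. V x $ j * (\<Sum>l\<in>UNIV. G x $ j $ l * cov G V l i x))
      = (\<Sum>j\<in>UNIV. \<Sum>l\<in>UNIV. G x $ j $ l * V x $ j * pd i (\<lambda>y. V y $ l) x)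
      + ?Q"
    unfolding cov_def distrib_left sum.distrib low by (simp add: sum_distrib_left mult_ac)
  moreover have "?Q
      = (1/2) * (\<Sum>a\<in>UNIV. \<Sum>b\<in>UNIV. pd i (\<lambda>y. G y $ a $ b) x * V x $ a * V x $ b)"
  proof -
    have sw: "(\<Sum>j\<in>UNIV. \<Sum>s\<in>UNIV. V x $ j * V x $ s * pd s (\<lambda>y. G y $ i $ j) x)
        = (\<Sum>j\<in>UNIV. \<Sum>s\<in>UNIV. V x $ j * V x $ s * pd j (\<lambda>y. G y $ i $ s) x)"
      by (subst sum.swap) (simp add: mult_ac)
    have "?Q
        = (1/2) * ((\<Sum>j\<in>UNIV. \<Sum>s\<in>UNIV. V x $ j * V x $ s * pd i (\<lambda>y. G y $ s $ j) x)
          + (\<Sum>j\<in>UNIV. \<Sum>s\<in>UNIV. V x $ j * V x $ s * pd s (\<lambda>y. G y $ i $ j) x)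
          - (\<Sum>j\<in>UNIV. \<Sum>s\<in>UNIV. V x $ j * V x $ s * pd j (\<lambda>y. G y $ i $ s) x))"
      unfolding sum_distrib_left sum.distrib[symmetric] sum_subtractf[symmetric]
      by (intro sum.cong refl) (simp add: field_simps)
    also have "(\<Sum>j\<in>UNIV. \<Sum>s\<in>UNIV. V x $ j * V x $ s * pd i (\<lambda>y. G y $ s $ j) x)
        = (\<Sum>a\<in>UNIV. \<Sum>b\<in>UNIV. pd i (\<lambda>y. G y $ a $ b) x * V x $ a * V x $ b)"
      by (subst sum.swap) (simp add: mult_ac)
    finally show ?thesis unfolding sw by simp
  qed
  ultimately show ?thesis unfolding 1 by simp
qed

section \<open>Consequences of the conformal equation in one chart\<close>

lemma H_mult_G_mult: "x \<in> U \<Longrightarrow> H x *v (G x *v v) = v"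
  by (simp add: matrix_vector_mul_assoc matrix_inv_mult[OF invertible_G])

context
  fixes V :: "real^'n \<Rightarrow> real^'n" and \<sigma> :: "real^'n \<Rightarrow> real" and m :: real
  assumes V: "\<And>l. Ck 2 U (\<lambda>y. V y $ l)" and \<sigma>: "Ck 1 U \<sigma>" and m: "m > 0"
    and conformal: "\<And>x i j. x \<in> U \<Longrightarrow>
      lie G V x i j = 2 / m * (G x *v V x) $ i * (G x *v V x) $ j + 2 * \<sigma> x * G x $ i $ j"
begin

lemma ldiv_conformal:
  assumes x: "x \<in> U"
  shows "ldiv G V x = V x \<bullet> (G x *v V x) / m + real CARD('n) * \<sigma> x"
proof -
  let ?v = "G x *v V x"
  have "ldiv G V x = (1/2) * (\<Sum>i\<in>UNIV. \<Sum>j\<in>UNIV. 2 / m * (H x $ i $ j * ?v $ i * ?v $ j)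
      + 2 * \<sigma> x * (H x $ i $ j * G x $ j $ i))"
    by (simp add: ldiv_def conformal[OF x] G_sym[OF x] algebra_simps)
  also have "\<dots> = (1/m) * (?v \<bullet> (H x *v ?v)) + \<sigma> x * (\<Sum>i\<in>UNIV. \<Sum>j\<in>UNIV. H x $ i $ j * G x $ j $ i)"
    by (simp only: sum.distrib distrib_left inner_matrix_vector_mult sum_distrib_left) simp
  finally show ?thesis
    by (simp add: H_mult_G_mult[OF x] H_G[OF x] inner_commute)
qed

text \<open>The conformal equation controls only the symmetric part of \<open>\<nabla>V\<close>.
  Exchanging the two indices therefore leaves \<open>V\<close> paired with the other slot, and that
  pairing is half the gradient of the squared norm.\<close>

lemma drift_eq:
  assumes x: "x \<in> U"
  shows "drift G V \<sigma> m x $ l = (\<Sum>j\<in>UNIV. V x $ j * cov G V l j x) - ldiv G V x * V x $ l"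
proof -
  let ?v = "G x *v V x" and ?s = "V x \<bullet> (G x *v V x)"
  let ?M = "\<lambda>i j. \<Sum>l\<in>UNIV. G x $ i $ l * cov G V l j x"
  have dV: "(\<lambda>y. V y $ l) differentiable (at x)" for l
    using Ck_differentiable[OF V _ x] by simp
  have M: "(\<Sum>j\<in>UNIV. V x $ j * ?M i j) = (2 * ?s / m + 2 * \<sigma> x) * ?v $ i - pd i (\<lambda>z. V z \<bullet> (G z *v V z)) x / 2" for i
  proof -
    \<comment> \<open>\<open>?M i j\<close> is the lowered covariant derivative
      \<open>\<nabla>_j V_i\<close>, and the Lie derivative of the metric is its
      symmetrisation.\<close>
    have "?M i j = 2 / m * ?v $ i * ?v $ j + 2 * \<sigma> x * G x $ i $ j - ?M j i" for j
      using lie_cov[OF x, of V i j] conformal[OF x, of i j] by simp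
    then have "(\<Sum>j\<in>UNIV. V x $ j * ?M i j) = (\<Sum>j\<in>UNIV. V x $ j * (2 / m * ?v $ i * ?v $ j + 2 * \<sigma> x * G x $ i $ j - ?M j i))"
      by (intro sum.cong refl) (rule arg_cong)
    also have "\<dots> = (\<Sum>j\<in>UNIV. (2 / m * ?v $ i) * (V x $ j * ?v $ j)) + (\<Sum>j\<in>UNIV. 2 * \<sigma> x * (G x $ i $ j * V x $ j))
        - (\<Sum>j\<in>UNIV. V x $ j * ?M j i)"
      unfolding sum.distrib[symmetric] sum_subtractf[symmetric]
      by (intro sum.cong refl) (simp only: right_diff_distrib distrib_left mult_ac)
    also have "\<dots> = (2 / m * ?v $ i) * ?s + 2 * \<sigma> x * ?v $ i - (\<Sum>j\<in>UNIV. V x $ j * ?M j i)"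
    proof -
      have "(\<Sum>j\<in>UNIV. (2 / m * ?v $ i) * (V x $ j * ?v $ j)) = (2 / m * ?v $ i) * ?s"
        by (simp only: inner_vec_def inner_real_def sum_distrib_left)
      moreover have "(\<Sum>j\<in>UNIV. 2 * \<sigma> x * (G x $ i $ j * V x $ j)) = 2 * \<sigma> x * ?v $ i"
        by (simp only: matrix_vector_mult_def vec_lambda_beta sum_distrib_left)
      ultimately show ?thesis by simp
    qed
    finally show ?thesis using cov_lower_gradient[OF x dV, of i] by (simp add: algebra_simps)
  qed
  \<comment> \<open>The inverse metric undoes the lowering in \<open>?M\<close>.\<close>
  have up: "(\<Sum>i\<in>UNIV. H x $ l $ i * ?M i j) = cov G V l j x" for j
  proof -
    have "(\<Sum>i\<in>UNIV. H x $ l $ i * ?M i j) = (\<Sum>k\<in>UNIV. (\<Sum>i\<in>UNIV. H x $ l $ i * G x $ i $ k) * cov G V k j x)"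
      unfolding sum_distrib_left sum_distrib_right by (subst sum.swap) (simp add: mult_ac)
    then show ?thesis by (simp add: H_G[OF x] if_distrib[of "\<lambda>t. t * _"] cong: if_cong)
  qed
  have "(\<Sum>j\<in>UNIV. V x $ j * cov G V l j x) = (\<Sum>i\<in>UNIV. H x $ l $ i * (\<Sum>j\<in>UNIV. V x $ j * ?M i j))"
    unfolding up[symmetric] sum_distrib_left by (subst sum.swap) (simp add: mult_ac)
  also have "\<dots> = (2 * ?s / m + 2 * \<sigma> x) * (H x *v ?v) $ l
      - (\<Sum>i\<in>UNIV. H x $ l $ i * pd i (\<lambda>z. V z \<bullet> (G z *v V z)) x) / 2"
  proof -
    have "(\<Sum>i\<in>UNIV. H x $ l $ i * (c * ?v $ i)) = c * (H x *v ?v) $ l" for c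
      by (simp add: matrix_vector_mult_def[of "H x"] sum_distrib_left mult_ac)
    then show ?thesis
      unfolding M right_diff_distrib sum_subtractf by (simp add: sum_divide_distrib)
  qed
  finally show ?thesis
    by (simp add: drift_def H_mult_G_mult[OF x] ldiv_conformal[OF x] algebra_simps)
qed

lemma Ck_drift: "Ck 1 U (\<lambda>y. drift G V \<sigma> m y $ l)"
proof -
  have s: "Ck 2 U (\<lambda>y. V y \<bullet> (G y *v V y))"
    unfolding inner_matrix_vector_mult by (intro Ck_sum Ck_mult open_U Ck_G V)
  then have "Ck 1 U (pd i (\<lambda>y. V y \<bullet> (G y *v V y)))" for i by (simp add: numeral_2_eq_2)
  moreover have "Ck 1 U (\<lambda>y. V y \<bullet> (G y *v V y))" "Ck 1 U (\<lambda>y. H y $ i $ j)" "Ck 1 U (\<lambda>y. V y $ i)" for i j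
    using Ck_mono[OF s, of 1] Ck_mono[OF Ck_H, of 1] Ck_mono[OF V, of 1]
    by (simp_all del: Ck.simps One_nat_def)
  ultimately show ?thesis
    unfolding drift_def vec_lambda_beta
    using m by (intro Ck_diff Ck_mult Ck_add Ck_divide Ck_sum open_U \<sigma> Ck_const) auto
qed

lemma ldiv_drift_le:
  assumes x: "x \<in> U"
  shows "ldiv G (drift G V \<sigma> m) x \<le> ric G x (V x)
    + (real CARD('n) - 1) / (real CARD('n) * m\<^sup>2) * (V x \<bullet> (G x *v V x))\<^sup>2"
proof -
  let ?n = "real CARD('n)" and ?v = "G x *v V x"
  define s where "s = V x \<bullet> (G x *v V x)"
  define B :: "real^'n^'n" where "B = (\<chi> l j. cov G V l j x)"
  define S :: "real^'n^'n" where "S = (\<chi> i j. ?v $ i * ?v $ j / m + \<sigma> x * G x $ i $ j)"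
  have sum_sq: "G x ** B + transpose (G x ** B) = 2 *\<^sub>R S"
    using lie_cov[OF x, of V] conformal[OF x]
    by (simp add: vec_eq_iff B_def S_def matrix_matrix_mult_def transpose_def algebra_simps)
  have symS: "transpose S = S"
    using G_sym[OF x] by (simp add: vec_eq_iff S_def transpose_def)
  \<comment> \<open>With one index raised, \<open>S\<close> is a rank-one matrix plus a multiple of
    the identity, so the trace of its square is explicit.\<close>
  have HS: "(H x ** S) $ a $ j = V x $ a * ?v $ j / m + \<sigma> x * (if a = j then 1 else 0)" for a j
  proof -
    have "(H x ** S) $ a $ j = (H x *v ?v) $ a * ?v $ j / m + \<sigma> x * (\<Sum>k\<in>UNIV. H x $ a $ k * G x $ k $ j)"
      by (simp add: matrix_matrix_mult_def S_def matrix_vector_mult_def[of "H x"] distrib_left sum.distrib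
          sum_distrib_left sum_divide_distrib mult_ac)
    then show ?thesis by (simp add: H_mult_G_mult[OF x] H_G[OF x])
  qed
  have "trace ((H x ** S) ** (H x ** S)) = s\<^sup>2 / m\<^sup>2 + 2 * \<sigma> x * s / m + ?n * (\<sigma> x)\<^sup>2"
  proof -
    have "(H x ** S) $ a $ j * (H x ** S) $ j $ a = (V x $ a * ?v $ a) * (V x $ j * ?v $ j) / m\<^sup>2
        + (if a = j then 2 * \<sigma> x * (V x $ a * ?v $ a) / m + (\<sigma> x)\<^sup>2 else 0)" for a j
      by (simp add: HS power2_eq_square algebra_simps)
    then have "trace ((H x ** S) ** (H x ** S)) = (\<Sum>a\<in>UNIV. \<Sum>j\<in>UNIV. (V x $ a * ?v $ a) * (V x $ j * ?v $ j) / m\<^sup>2)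
        + (\<Sum>a\<in>UNIV. 2 * \<sigma> x * (V x $ a * ?v $ a) / m + (\<sigma> x)\<^sup>2)"
      by (simp add: trace_mult sum.distrib)
    also have "(\<Sum>a\<in>UNIV. \<Sum>j\<in>UNIV. (V x $ a * ?v $ a) * (V x $ j * ?v $ j) / m\<^sup>2) = s\<^sup>2 / m\<^sup>2"
      by (simp add: s_def inner_vec_def power2_eq_square sum_product sum_divide_distrib)
    also have "(\<Sum>a\<in>UNIV. 2 * \<sigma> x * (V x $ a * ?v $ a) / m + (\<sigma> x)\<^sup>2) = 2 * \<sigma> x * s / m + ?n * (\<sigma> x)\<^sup>2"
      by (simp add: s_def inner_vec_def sum.distrib sum_distrib_left sum_divide_distrib)
    finally show ?thesis by simp
  qed
  moreover have "trace (B ** B) \<le> trace ((H x ** S) ** (H x ** S))"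
    by (rule trace_square_le[OF posdef_G[OF x] symS sum_sq])
  moreover have "trace (B ** B) = (\<Sum>l\<in>UNIV. \<Sum>j\<in>UNIV. cov G V l j x * cov G V j l x)"
    by (simp add: trace_mult B_def)
  moreover have "ldiv G (drift G V \<sigma> m) x = ric G x (V x)
      + (\<Sum>l\<in>UNIV. \<Sum>j\<in>UNIV. cov G V l j x * cov G V j l x) - (s / m + ?n * \<sigma> x)\<^sup>2"
    using bochner[OF V x drift_eq] ldiv_conformal[OF x] by (simp add: s_def)
  \<comment> \<open>The square is completed with the divergence \<open>s / m + n * \<sigma>\<close>
    of \<open>V\<close>: everything beyond the term in \<open>s\<^sup>2\<close> is a nonpositive
    multiple of the square of that divergence.\<close>
  moreover have "s\<^sup>2 / m\<^sup>2 + 2 * \<sigma> x * s / m + ?n * (\<sigma> x)\<^sup>2 - (s / m + ?n * \<sigma> x)\<^sup>2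
      = (?n - 1) / (?n * m\<^sup>2) * s\<^sup>2 - (?n - 1) / ?n * (s / m + ?n * \<sigma> x)\<^sup>2"
    using m by (simp add: field_simps power2_eq_square)
  moreover have "0 \<le> (?n - 1) / ?n * (s / m + ?n * \<sigma> x)\<^sup>2"
    by simp
  ultimately show ?thesis
    unfolding s_def by linarith
qed

end

end

section \<open>Integration on Euclidean space\<close>

lemma has_integral_UNIV_cbox:
  fixes f :: "'a::euclidean_space \<Rightarrow> 'b::banach"
  assumes "\<And>x. x \<notin> cbox a b \<Longrightarrow> f x = 0"
  shows "(f has_integral I) UNIV \<longleftrightarrow> (f has_integral I) (cbox a b)"
proof -
  have "f = (\<lambda>x. if x \<in> cbox a b then f x else 0)" using assms by auto
  then show ?thesis using has_integral_restrict_UNIV[of "cbox a b" f I] by metis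
qed

lemma support_cbox:
  fixes f :: "'a::euclidean_space \<Rightarrow> 'b::zero"
  assumes "compact K" "\<And>x. x \<notin> K \<Longrightarrow> f x = 0"
  obtains R where "R > 0" "\<And>x. norm x \<ge> R \<Longrightarrow> f x = 0"
proof -
  obtain R where R: "R > 0" "\<And>x. x \<in> K \<Longrightarrow> norm x < R"
    using bounded_normE_less compact_imp_bounded[OF assms(1)] by metis
  show thesis by (rule that[OF R(1)]) (use R(2) assms(2) in force)
qed

lemma absolutely_integrable_compact_support:
  fixes f :: "'a::euclidean_space \<Rightarrow> 'b::euclidean_space"
  assumes "continuous_on UNIV f" "compact K" "\<And>x. x \<notin> K \<Longrightarrow> f x = 0"
  shows "f absolutely_integrable_on UNIV"
proof -
  obtain a where a: "K \<subseteq> cbox (-a) a"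
    using bounded_subset_cbox_symmetric compact_imp_bounded assms(2) by metis
  have "f absolutely_integrable_on cbox (-a) a"
    using absolutely_integrable_continuous continuous_on_subset[OF assms(1)] by blast
  moreover have "(\<lambda>x. if x \<in> cbox (-a) a then f x else 0) = f"
    using a assms(3) by (intro ext) auto
  ultimately show ?thesis
    using absolutely_integrable_restrict_UNIV[of "cbox (-a) a" f] by simp
qed

text \<open>The integral of a difference quotient vanishes by translation invariance; pass to the limit
  with dominated convergence.\<close>

lemma has_integral_pd_zero:
  fixes f :: "real^'n::finite \<Rightarrow> real"
  assumes f: "Ck 1 UNIV f" and K: "compact K" "\<And>x. x \<notin> K \<Longrightarrow> f x = 0"
  shows "(pd i f has_integral 0) UNIV"
proof -
  obtain R where R: "R > 0" "\<And>x. norm x \<ge> R \<Longrightarrow> f x = 0"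
    using support_cbox[of K f] K by metis
  have d: "f differentiable (at x)" for x using f by simp
  have cf: "continuous_on UNIV f" and cp: "continuous_on UNIV (pd i f)"
    using f Ck_continuous[OF f] by simp_all
  have p0: "pd i f x = 0" if "norm x > R" for x
  proof -
    have "pd i f x = pd i (\<lambda>_. 0) x"
      by (rule pd_cong_open[of "- cball 0 R"]) (use that R in auto)
    then show ?thesis by simp
  qed
  have "bounded (pd i f ` cball 0 R)"
    by (intro compact_imp_bounded compact_continuous_image continuous_on_subset[OF cp]) auto
  then obtain B0 where B0: "\<And>x. x \<in> cball 0 R \<Longrightarrow> norm (pd i f x) \<le> B0"
    unfolding bounded_iff by blast
  have B: "norm (pd i f x) \<le> \<bar>B0\<bar>" for x
    using B0[of x] p0[of x] by (cases "norm x \<le> R") auto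
  \<comment> \<open>The margin keeps the support of \<open>f\<close> inside the box even after the
    box is shifted by a step of length at most 1.\<close>
  obtain a where a: "cball 0 (R + 2) \<subseteq> cbox (-a) (a :: real^'n)"
    using bounded_subset_cbox_symmetric[OF bounded_cball] by metis
  define h where "h k = 1 / (real k + 1)" for k
  have h: "h k > 0" "h k \<le> 1" for k by (auto simp: h_def field_simps)
  define g where "g k x = (f (x + h k *\<^sub>R axis i 1) - f x) / h k" for k x
  have fint: "(f has_integral integral UNIV f) UNIV"
    using absolutely_integrable_compact_support[OF cf K] set_lebesgue_integral_eq_integral(1) integrable_integral by blast
  have supp: "x \<in> cbox (-a) a" if "norm x \<le> R + 2" for x using a that by auto
  have g: "(g k has_integral 0) (cbox (-a) a)" for k
  proof -
    let ?c = "h k *\<^sub>R axis i 1 :: real^'n"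
    have c: "norm ?c \<le> 1" using h[of k] by simp
    have f1: "(f has_integral integral UNIV f) (cbox (-a) a)"
      using fint by (subst has_integral_UNIV_cbox[symmetric]) (use R supp in force)+
    have "x \<in> cbox (-a + ?c) (a + ?c)" if "f x \<noteq> 0" for x
    proof -
      have "norm x < R" using R(2) that by (metis not_le)
      then have "norm (x - ?c) \<le> R + 2" using c norm_triangle_ineq4[of x ?c] by simp
      from supp[OF this] show ?thesis by (simp add: mem_box_cart algebra_simps)
    qed
    then have "(f has_integral integral UNIV f) (cbox (-a + ?c) (a + ?c))"
      using fint by (subst has_integral_UNIV_cbox[symmetric]) blast+
    then have "((f \<circ> (+) ?c) has_integral integral UNIV f) (cbox (-a) a)"
      by (simp add: has_integral_shift_cbox_iff)
    then have "((\<lambda>x. f (x + ?c)) has_integral integral UNIV f) (cbox (-a) a)"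
      by (simp add: o_def add.commute)
    from has_integral_diff[OF this f1] have "((\<lambda>x. f (x + ?c) - f x) has_integral 0) (cbox (-a) a)"
      by simp
    from has_integral_mult_right[OF this, of "1 / h k"] show ?thesis
      by (simp add: g_def[abs_def])
  qed
  have "(pd i f has_integral 0) (cbox (-a) a)"
  proof (rule has_integral_dominated_convergence[OF g])
    show "(\<lambda>_. \<bar>B0\<bar>) integrable_on cbox (-a) a" by (rule integrable_const)
    \<comment> \<open>By the mean value theorem each quotient is a value of \<open>pd i f\<close>,
      so the global bound on \<open>pd i f\<close> dominates.\<close>
    show "\<forall>x\<in>cbox (-a) a. norm (g k x) \<le> \<bar>B0\<bar>" for k
    proof
      fix x
      have "\<exists>z. 0 < z \<and> z < h k \<and> f (x + h k *\<^sub>R axis i 1) - f (x + 0 *\<^sub>R axis i 1)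
          = (h k - 0) * pd i f (x + z *\<^sub>R axis i 1)"
        by (rule MVT2[OF h(1)]) (rule DERIV_along_axis[OF d])
      then obtain z where "f (x + h k *\<^sub>R axis i 1) - f x = h k * pd i f (x + z *\<^sub>R axis i 1)" by auto
      then have "g k x = pd i f (x + z *\<^sub>R axis i 1)" using h(1)[of k] by (simp add: g_def)
      then show "norm (g k x) \<le> \<bar>B0\<bar>" using B by metis
    qed
    show "\<forall>x\<in>cbox (-a) a. (\<lambda>k. g k x) \<longlonglongrightarrow> pd i f x"
    proof
      fix x
      have "((\<lambda>s. f (x + s *\<^sub>R axis i 1)) has_real_derivative pd i f (x + 0 *\<^sub>R axis i 1)) (at 0)"
        by (rule DERIV_along_axis[OF d])
      then have lim: "((\<lambda>s. (f (x + s *\<^sub>R axis i 1) - f x) / s) \<longlongrightarrow> pd i f x) (at 0)"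
        by (simp add: DERIV_def)
      have "h \<longlonglongrightarrow> 0" unfolding h_def[abs_def]
        using LIMSEQ_inverse_real_of_nat by (simp add: inverse_eq_divide add.commute)
      then have "filterlim h (at 0) sequentially"
        using h(1) by (simp add: filterlim_at less_imp_neq[symmetric] order.strict_implies_not_eq)
      from filterlim_compose[OF lim this] show "(\<lambda>k. g k x) \<longlonglongrightarrow> pd i f x"
        by (simp add: g_def)
    qed
  qed simp
  moreover have "x \<in> cbox (-a) a" if "pd i f x \<noteq> 0" for x
    using p0[of x] supp[of x] that R(1) by force
  ultimately show ?thesis
    using has_integral_UNIV_cbox by metis
qed

lemma integral_zero_nonneg_compact_support:
  fixes f :: "'a::euclidean_space \<Rightarrow> real"
  assumes f: "continuous_on UNIV f" and K: "compact K" "\<And>x. x \<notin> K \<Longrightarrow> f x = 0"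
    and nn: "\<And>x. 0 \<le> f x" and int: "integral UNIV f = 0"
  shows "f x = 0"
proof (rule ccontr)
  assume ne: "f x \<noteq> 0"
  then have x: "x \<in> K" using K by blast
  obtain a where a: "K \<subseteq> cbox (-a) a"
    using bounded_subset_cbox_symmetric compact_imp_bounded K(1) by metis
  \<comment> \<open>The enlargement keeps the open box nonempty even when \<open>cbox (-a) a\<close>
    is degenerate.\<close>
  let ?a = "a + One" 
  have sub: "cbox (-a) a \<subseteq> box (-?a) ?a"
    by (auto simp: mem_box inner_diff_left inner_add_left) (smt (verit))+
  have "(f has_integral 0) UNIV"
    using absolutely_integrable_compact_support[OF f K] set_lebesgue_integral_eq_integral(1) integrable_integral int
    by metis
  then have "(f has_integral 0) (cbox (-?a) ?a)"
    by (subst has_integral_UNIV_cbox[symmetric]) (use a sub K box_subset_cbox in blast)+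
  then have "f x = 0"
  proof (rule has_integral_0_cbox_imp_0[of "-?a" ?a f, rotated 2])
    show "box (-?a) ?a \<noteq> {}" "x \<in> cbox (-?a) ?a"
      using x a sub box_subset_cbox[of "-?a" ?a] by auto
    show "continuous_on (cbox (-?a) ?a) f"
      using continuous_on_subset[OF f] by blast
  qed (rule nn)
  then show False using ne by simp
qed

text \<open>The library's change of variables needs a well-ordered index type.\<close>

typedef 'n ordered = "UNIV :: 'n set" by simp

instance ordered :: (finite) finite
proof
  have "(UNIV :: 'a ordered set) = Abs_ordered ` UNIV"
    by (rule type_definition.Abs_image[OF type_definition_ordered, symmetric])
  then show "finite (UNIV :: 'a ordered set)"
    using finite_imageI[OF finite, of Abs_ordered "UNIV :: 'a set"] by simp
qed

instantiation ordered :: (finite) wellorder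
begin

definition less_eq_ordered :: "'a ordered \<Rightarrow> 'a ordered \<Rightarrow> bool" where
  "a \<le> b \<longleftrightarrow> to_nat_on UNIV (Rep_ordered a) \<le> to_nat_on UNIV (Rep_ordered b)"

definition less_ordered :: "'a ordered \<Rightarrow> 'a ordered \<Rightarrow> bool" where
  "a < b \<longleftrightarrow> to_nat_on UNIV (Rep_ordered a) < to_nat_on UNIV (Rep_ordered b)"

instance
proof
  have inj: "a = b" if "to_nat_on UNIV (Rep_ordered a) = to_nat_on UNIV (Rep_ordered b)" for a b :: "'a ordered"
    using that inj_on_to_nat_on[of "UNIV :: 'a set"] Rep_ordered_inject
    by (metis UNIV_I countable_finite finite inj_onD)
  fix a b c :: "'a ordered" and P :: "'a ordered \<Rightarrow> bool"
  show "a < b \<longleftrightarrow> a \<le> b \<and> \<not> b \<le> a" "a \<le> a" "a \<le> b \<Longrightarrow> b \<le> c \<Longrightarrow> a \<le> c"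
    "a \<le> b \<Longrightarrow> b \<le> a \<Longrightarrow> a = b" "a \<le> b \<or> b \<le> a"
    by (auto simp: less_eq_ordered_def less_ordered_def inj)
  assume P: "\<And>x. (\<And>y. y < x \<Longrightarrow> P y) \<Longrightarrow> P x"
  show "P a"
    by (induction "to_nat_on UNIV (Rep_ordered a)" arbitrary: a rule: less_induct)
      (rule P, simp add: less_ordered_def)
qed

end

lemma bij_Rep_ordered: "bij (Rep_ordered :: 'n ordered \<Rightarrow> 'n)"
  by (metis Abs_ordered_inverse Rep_ordered_inverse UNIV_I bij_iff)

lemma Abs_Rep_simps [simp]: "Abs_ordered (Rep_ordered a) = a" "Rep_ordered (Abs_ordered b) = b"
  by (simp_all add: Rep_ordered_inverse Abs_ordered_inverse)

section \<open>Relabelling of coordinates\<close>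

definition reindex :: "real^'n \<Rightarrow> real^'n ordered" where
  "reindex x = (\<chi> i. x $ Rep_ordered i)"

definition unindex :: "real^'n ordered \<Rightarrow> real^'n" where
  "unindex x = (\<chi> i. x $ Abs_ordered i)"

lemma reindex_unindex [simp]: "reindex (unindex x) = x" "unindex (reindex y) = y"
  by (simp_all add: reindex_def unindex_def vec_eq_iff)

lemma bounded_linear_reindex: "bounded_linear (reindex :: real^'n::finite \<Rightarrow> _)"
  by (rule linear_conv_bounded_linear[THEN iffD1], rule linearI) (simp_all add: reindex_def vec_eq_iff)

lemma bounded_linear_unindex: "bounded_linear (unindex :: _ \<Rightarrow> real^'n::finite)"
  by (rule linear_conv_bounded_linear[THEN iffD1], rule linearI) (simp_all add: unindex_def vec_eq_iff)

lemma reindex_cbox: "reindex ` cbox u v = cbox (reindex u) (reindex (v :: real^'n::finite))"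
proof
  show "cbox (reindex u) (reindex v) \<subseteq> reindex ` cbox u v"
  proof
    fix x assume "x \<in> cbox (reindex u) (reindex v)"
    then have "unindex x \<in> cbox u v"
      by (simp add: mem_box_cart reindex_def unindex_def) (metis Abs_Rep_simps(2))
    then show "x \<in> reindex ` cbox u v" by (metis image_eqI reindex_unindex(1))
  qed
qed (auto simp: mem_box_cart reindex_def)

lemma unindex_cbox: "unindex ` cbox u v = cbox (unindex u) (unindex (v :: real^'n::finite ordered))"
proof -
  have "unindex ` cbox u v = unindex ` reindex ` cbox (unindex u) (unindex v)"
    by (simp add: reindex_cbox)
  then show ?thesis by (simp add: image_comp o_def)
qed

lemma content_reindex:
  "measure lborel (reindex ` cbox u v) = measure lborel (cbox u (v :: real^'n::finite))"
proof -
  have ne: "cbox (reindex u) (reindex v) = {} \<longleftrightarrow> cbox u v = {}"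
    by (metis image_is_empty reindex_cbox)
  have "(\<Prod>i\<in>UNIV. v $ Rep_ordered i - u $ Rep_ordered i) = (\<Prod>i\<in>UNIV. v $ i - u $ i)"
    by (rule prod.reindex_bij_betw[OF bij_Rep_ordered])
  then show ?thesis
    by (simp add: reindex_cbox content_cbox_if_cart ne) (simp add: reindex_def)
qed

text \<open>Compact support reduces the claim to boxes, which the relabelling maps to boxes of the
  same volume.\<close>

lemma has_integral_unindex:
  fixes f :: "real^'n::finite ordered \<Rightarrow> real"
  assumes f: "(f has_integral I) UNIV" and K: "compact K" "\<And>x. x \<notin> K \<Longrightarrow> f x = 0"
  shows "((\<lambda>x. f (reindex x)) has_integral I) UNIV"
proof -
  obtain a where a: "K \<subseteq> cbox (-a) a"
    using bounded_subset_cbox_symmetric compact_imp_bounded K(1) by metis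
  have "(f has_integral I) (cbox (-a) a)"
    using f by (subst has_integral_UNIV_cbox[symmetric]) (use a K in blast)+
  then have "((\<lambda>x. f (reindex x)) has_integral (1 / 1) *\<^sub>R I) (unindex ` cbox (-a) a)"
    by (intro has_integral_twiddle[where g = reindex and h = unindex and r = 1])
      (auto simp: unindex_cbox reindex_cbox content_reindex[unfolded reindex_cbox]
        intro: linear_continuous_at bounded_linear_reindex)
  then have "((\<lambda>x. f (reindex x)) has_integral I) (cbox (unindex (-a)) (unindex a))"
    by (simp add: unindex_cbox)
  moreover have "f (reindex x) = 0" if "x \<notin> cbox (unindex (-a)) (unindex a)" for x
  proof -
    have "reindex x \<notin> cbox (-a) a"
      using that by (metis image_eqI reindex_unindex(2) unindex_cbox)
    then show ?thesis using a K by blast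
  qed
  ultimately show ?thesis
    using has_integral_UNIV_cbox[of "unindex (-a)" "unindex a" "\<lambda>x. f (reindex x)" I] by simp
qed

text \<open>Conjugation by the relabelling carries transpositions to transpositions; hence it
  preserves the sign of a permutation, which \<open>det_reindex\<close> relies on.\<close>

lemma swapidseq_reindex:
  "swapidseq n p \<Longrightarrow> swapidseq n (Rep_ordered \<circ> p \<circ> Abs_ordered)"
proof (induction rule: swapidseq.induct)
  case id
  have "Rep_ordered \<circ> id \<circ> Abs_ordered = (id :: 'a \<Rightarrow> 'a)" by (simp add: fun_eq_iff)
  then show ?case using swapidseq.id by metis
next
  case (comp_Suc n p a b)
  have "Rep_ordered \<circ> (Transposition.transpose a b \<circ> p) \<circ> Abs_ordered
      = Transposition.transpose (Rep_ordered a) (Rep_ordered b) \<circ> (Rep_ordered \<circ> p \<circ> Abs_ordered)"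
    by (auto simp: fun_eq_iff Transposition.transpose_def Rep_ordered_inject)
  then show ?case
    using swapidseq.comp_Suc[OF comp_Suc.IH] comp_Suc.hyps(2) Rep_ordered_inject by metis
qed

lemma det_reindex: "det (\<chi> i j. M $ Rep_ordered i $ Rep_ordered j) = det (M :: real^'n^'n::finite)"
proof -
  let ?c = "\<lambda>p. Rep_ordered \<circ> p \<circ> (Abs_ordered :: 'n \<Rightarrow> _)" and ?d = "\<lambda>q. Abs_ordered \<circ> q \<circ> (Rep_ordered :: _ \<Rightarrow> 'n)"
  have sgn: "sign (?c p) = sign p" if p: "p permutes UNIV" for p :: "'n ordered \<Rightarrow> 'n ordered"
  proof -
    obtain n where n: "swapidseq n p"
      using permutes_imp_permutation[OF finite p] permutation_def by auto
    show ?thesis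
      using evenperm_unique[OF n refl] evenperm_unique[OF swapidseq_reindex[OF n] refl]
      by (simp add: sign_def)
  qed
  have bij: "bij_betw ?c {p. p permutes UNIV} {p. p permutes UNIV}"
  proof (rule bij_betw_byWitness[where f' = ?d])
    have "bij (?c p)" if "bij p" for p
      using that bij_Rep_ordered by (metis Abs_Rep_simps bij_comp bij_iff)
    then show "?c ` {p. p permutes UNIV} \<subseteq> {p. p permutes UNIV}"
      by (auto intro!: bij_imp_permutes dest: permutes_bij)
    have "bij (?d p)" if "bij p" for p
      using that bij_Rep_ordered by (metis Abs_Rep_simps bij_comp bij_iff)
    then show "?d ` {p. p permutes UNIV} \<subseteq> {p. p permutes UNIV}"
      by (auto intro!: bij_imp_permutes dest: permutes_bij)
  qed (auto simp: fun_eq_iff)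
  have "det (\<chi> i j. M $ Rep_ordered i $ Rep_ordered j)
      = (\<Sum>p | p permutes UNIV. of_int (sign (?c p)) * (\<Prod>i\<in>UNIV. M $ i $ ?c p i))"
    unfolding det_def
  proof (rule sum.cong[OF refl])
    fix p :: "'n ordered \<Rightarrow> 'n ordered" assume "p \<in> {p. p permutes UNIV}"
    then have "sign (?c p) = sign p" using sgn by simp
    moreover have "(\<Prod>i\<in>UNIV. M $ i $ ?c p i) = (\<Prod>i\<in>UNIV. M $ Rep_ordered i $ ?c p (Rep_ordered i))"
      by (rule prod.reindex_bij_betw[OF bij_Rep_ordered, symmetric])
    ultimately show "of_int (sign p) * (\<Prod>i\<in>UNIV. (\<chi> i j. M $ Rep_ordered i $ Rep_ordered j) $ i $ p i)
        = of_int (sign (?c p)) * (\<Prod>i\<in>UNIV. M $ i $ ?c p i)"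
      by simp
  qed
  also have "\<dots> = det M"
    unfolding det_def by (rule sum.reindex_bij_betw[OF bij])
  finally show ?thesis .
qed

text \<open>The two compact sets serve different ends: \<open>K\<close> keeps the support of
  \<open>f\<close> within the image of \<open>\<tau>\<close>, so that the integral over the whole
  space sees only the image; \<open>L\<close> bounds the support of the pullback, so that its
  integral can be relabelled back.\<close>

lemma change_of_variables:
  fixes \<tau> :: "real^'n::finite \<Rightarrow> real^'n" and f :: "real^'n \<Rightarrow> real"
  assumes S: "open S" and der: "\<And>x. x \<in> S \<Longrightarrow> (\<tau> has_derivative (*v) (J x)) (at x)" and inj: "inj_on \<tau> S"
    and f: "continuous_on UNIV f" and K: "compact K" "K \<subseteq> \<tau> ` S" "\<And>y. y \<notin> K \<Longrightarrow> f y = 0"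
    and L: "compact L" "\<And>x. x \<in> S \<Longrightarrow> x \<notin> L \<Longrightarrow> f (\<tau> x) = 0"
  shows "integral UNIV f = integral UNIV (\<lambda>x. if x \<in> S then \<bar>det (J x)\<bar> * f (\<tau> x) else 0)"
proof -
  \<comment> \<open>The map is conjugated to the well-ordered index type, and the integrand is
    packed into \<open>real^1\<close> to match a theorem on vector-valued functions.\<close>
  let ?g = "\<lambda>z. reindex (\<tau> (unindex z))" and ?F = "\<lambda>z. vec (f (unindex z)) :: real^1"
  let ?S = "reindex ` S"
  have S_eq: "?S = unindex -` S" by (auto simp: image_iff) (metis reindex_unindex(1))
  have oS: "open ?S" unfolding S_eq
    by (rule open_vimage[OF S linear_continuous_on[OF bounded_linear_unindex]])
  have gS: "?g ` ?S = reindex ` \<tau> ` S" by (simp add: image_image)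
  let ?h = "\<lambda>z. f (unindex z)"
  have ch: "continuous_on UNIV ?h"
    by (rule continuous_on_compose2[OF f linear_continuous_on[OF bounded_linear_unindex]]) simp
  have rK: "compact (reindex ` K)" "compact (reindex ` L)"
    using K(1) L(1) by (simp_all add: compact_continuous_image linear_continuous_on bounded_linear_reindex)
  have h0: "?h z = 0" if "z \<notin> reindex ` K" for z
    using that K(3) by (metis image_eqI reindex_unindex(1))
  have ai: "?F absolutely_integrable_on UNIV"
  proof (rule absolutely_integrable_compact_support[OF _ rK(1)])
    show "continuous_on UNIV ?F"
      using continuous_on_vec_lambda[of UNIV "\<lambda>i::1. ?h"] ch by (simp add: vec_def)
    show "?F z = 0" if "z \<notin> reindex ` K" for z using h0[OF that] by (simp add: vec_eq_iff)
  qed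
  have F0: "?F z = 0" if "z \<notin> ?g ` ?S" for z
  proof -
    have "z \<notin> reindex ` K" using that K(2) unfolding gS by blast
    then show ?thesis using h0 by (simp add: vec_eq_iff)
  qed
  have Feq: "(\<lambda>z. if z \<in> ?g ` ?S then ?F z else 0) = ?F"
    using F0 by (intro ext) auto
  have "?F absolutely_integrable_on ?g ` ?S"
    using ai absolutely_integrable_restrict_UNIV[of "?g ` ?S" ?F] unfolding Feq by simp
  let ?D = "\<lambda>z w. reindex (J (unindex z) *v unindex w)"
  have dg: "(?g has_derivative ?D z) (at z within ?S)" if "z \<in> ?S" for z
  proof -
    have "unindex z \<in> S" using that by auto
    have "((\<lambda>z. \<tau> (unindex z)) has_derivative (\<lambda>w. J (unindex z) *v unindex w)) (at z)"
      by (rule has_derivative_compose[OF bounded_linear_imp_has_derivative[OF bounded_linear_unindex] der[OF \<open>unindex z \<in> S\<close>]])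
    from bounded_linear.has_derivative[OF bounded_linear_reindex this]
    show ?thesis by (rule has_derivative_at_withinI)
  qed
  have inj': "inj_on ?g ?S"
  proof (rule inj_onI)
    fix z w assume *: "z \<in> ?S" "w \<in> ?S" "?g z = ?g w"
    then have "\<tau> (unindex z) = \<tau> (unindex w)" by (metis reindex_unindex(2))
    then show "z = w" using * inj S_eq by (metis inj_onD reindex_unindex(1) vimage_eq)
  qed
  have detD: "det (matrix (?D z)) = det (J (unindex z))" for z
  proof -
    have "matrix (?D z) = (\<chi> i j. J (unindex z) $ Rep_ordered i $ Rep_ordered j)"
    proof -
      have ax: "unindex (axis j 1) = axis (Rep_ordered j) (1::real)" for j :: "'n ordered"
        by (auto simp: unindex_def axis_def vec_eq_iff) 
      show ?thesis
        unfolding matrix_def reindex_def ax by (simp add: matrix_vector_mult_basis column_def)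
    qed
    then show ?thesis by (simp add: det_reindex)
  qed
  have mS: "?S \<in> sets lebesgue" using oS by (simp add: sets_completionI_sets)
  let ?X = "\<lambda>z. \<bar>det (J (unindex z))\<bar> * f (\<tau> (unindex z))"
  have "(\<lambda>z. \<bar>det (matrix (?D z))\<bar> *\<^sub>R ?F (?g z)) absolutely_integrable_on ?S \<and>
      integral ?S (\<lambda>z. \<bar>det (matrix (?D z))\<bar> *\<^sub>R ?F (?g z)) = integral (?g ` ?S) ?F"
    using \<open>?F absolutely_integrable_on ?g ` ?S\<close>
    by (subst has_absolute_integral_change_of_variables[OF mS dg inj']) auto
  then have X1: "(\<lambda>z. \<bar>det (J (unindex z))\<bar> *\<^sub>R vec (f (\<tau> (unindex z))) :: real^1) integrable_on ?S"
    and X2: "integral ?S (\<lambda>z. \<bar>det (J (unindex z))\<bar> *\<^sub>R vec (f (\<tau> (unindex z))) :: real^1) = integral (?g ` ?S) ?F"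
    unfolding detD by (auto simp: set_lebesgue_integral_eq_integral(1))
  have X_int: "(?X has_integral integral ?S ?X) ?S"
    using integrable_component[OF X1, of "axis 1 1"] by (simp add: inner_axis integrable_integral)
  have "integral ?S ?X = integral ?S (\<lambda>z. \<bar>det (J (unindex z))\<bar> *\<^sub>R vec (f (\<tau> (unindex z))) :: real^1) $ 1"
    using integral_component_eq_cart[OF X1, of 1] by simp
  also have "\<dots> = integral (?g ` ?S) ?F $ 1" by (simp only: X2)
  also have "\<dots> = integral (?g ` ?S) ?h"
    using integral_component_eq_cart[OF set_lebesgue_integral_eq_integral(1)[OF \<open>?F absolutely_integrable_on ?g ` ?S\<close>], of 1]
    by simp
  also have "\<dots> = integral UNIV ?h"
  proof -
    have "(\<lambda>z. if z \<in> ?g ` ?S then ?h z else 0) = ?h"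
      using F0 by (intro ext) (auto simp: vec_eq_iff)
    then show ?thesis using integral_restrict_UNIV[of "?g ` ?S" ?h] by simp
  qed
  also have "\<dots> = integral UNIV f"
  proof -
    have "(?h has_integral integral UNIV ?h) UNIV"
      using absolutely_integrable_compact_support[OF ch rK(1) h0] set_lebesgue_integral_eq_integral(1) integrable_integral
      by blast
    from has_integral_unindex[OF this rK(1) h0] show ?thesis by (simp add: integral_unique)
  qed
  finally have eq: "integral ?S ?X = integral UNIV f" .
  let ?Y = "\<lambda>z. if z \<in> ?S then ?X z else 0"
  have "(?Y has_integral integral UNIV f) UNIV"
    using X_int unfolding eq by (simp only: has_integral_restrict_UNIV)
  moreover have "?Y z = 0" if "z \<notin> reindex ` L" for z
  proof -
    have "unindex z \<notin> L" using that by (metis image_eqI reindex_unindex(1))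
    then show ?thesis using L(2) by auto
  qed
  ultimately have "((\<lambda>x. ?Y (reindex x)) has_integral integral UNIV f) UNIV"
    by (rule has_integral_unindex[OF _ rK(2)])
  moreover have "(\<lambda>x. ?Y (reindex x)) = (\<lambda>x. if x \<in> S then \<bar>det (J x)\<bar> * f (\<tau> x) else 0)"
    by (intro ext) (auto simp: S_eq)
  ultimately show ?thesis by (simp add: integral_unique)
qed

section \<open>Charts, tangent vectors and the metric\<close>

locale riemannian_atlas =
  fixes X :: "'a topology" and A :: "('a, 'n::finite) chart set" and g :: "('a, 'n) tensor2"
  assumes manifold: "smooth_manifold X A" and metric: "riemannian_metric X A g"
begin

abbreviation overlap :: "('a, 'n) chart \<Rightarrow> ('a, 'n) chart \<Rightarrow> (real^'n) set" where
  "overlap c d \<equiv> coords c ` (cdom c \<inter> cdom d)"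

abbreviation jac :: "('a, 'n) chart \<Rightarrow> ('a, 'n) chart \<Rightarrow> 'n \<Rightarrow> 'n \<Rightarrow> real^'n \<Rightarrow> real" where
  "jac c d a i \<equiv> pd i (\<lambda>z. transition c d z $ a)"

abbreviation comp :: "('a, 'n) chart \<Rightarrow> real^'n \<Rightarrow> real^'n^'n" where
  "comp c \<equiv> components A g c"

lemma is_chart: "c \<in> A \<Longrightarrow> is_chart X c"
  using manifold by (simp add: smooth_manifold_def smooth_atlas_def)

lemma Hausdorff: "Hausdorff_space X"
  using manifold by (simp add: smooth_manifold_def)

lemma chart_exists:
  assumes "p \<in> topspace X" obtains c where "c \<in> A" "p \<in> cdom c"
proof -
  have "p \<in> (\<Union>c\<in>A. cdom c)"
    using assms manifold unfolding smooth_manifold_def smooth_atlas_def by simp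
  then show thesis using that by blast
qed

lemma cdom_open: "c \<in> A \<Longrightarrow> openin X (cdom c)"
  and cimg_open: "c \<in> A \<Longrightarrow> open (cimg c)"
  and chart_homeo: "c \<in> A \<Longrightarrow> homeomorphic_map (subtopology X (cdom c)) (top_of_set (cimg c)) (coords c)"
  using is_chart by (auto simp: is_chart_def)

lemma cdom_subset: "c \<in> A \<Longrightarrow> cdom c \<subseteq> topspace X"
  using cdom_open openin_subset by blast

lemma coords_inj: "c \<in> A \<Longrightarrow> inj_on (coords c) (cdom c)"
  using homeomorphic_imp_injective_map[OF chart_homeo] cdom_subset
  by (simp add: topspace_subtopology inf_absorb2)

lemma point_coords: "c \<in> A \<Longrightarrow> p \<in> cdom c \<Longrightarrow> point c (coords c p) = p"
  by (simp add: point_def coords_inj)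

lemma coords_point: "x \<in> cimg c \<Longrightarrow> coords c (point c x) = x"
  by (simp add: point_def f_inv_into_f)

lemma point_in: "x \<in> cimg c \<Longrightarrow> point c x \<in> cdom c"
  by (simp add: point_def inv_into_into)

lemma point_in_topspace: "c \<in> A \<Longrightarrow> x \<in> cimg c \<Longrightarrow> point c x \<in> topspace X"
  by (rule subsetD[OF cdom_subset point_in])

lemma open_coords_image:
  assumes "c \<in> A" "openin X S"
  shows "open (coords c ` (cdom c \<inter> S))"
proof -
  have "openin (subtopology X (cdom c)) (cdom c \<inter> S)"
    using assms by (simp add: openin_subtopology_Int2)
  then have "openin (top_of_set (cimg c)) (coords c ` (cdom c \<inter> S))"
    using homeomorphic_imp_open_map[OF chart_homeo[OF assms(1)]] by (simp add: open_map_def)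
  then show ?thesis using cimg_open[OF assms(1)] by (simp add: openin_open_eq)
qed

lemma openin_coords_vimage:
  assumes "c \<in> A" "open S"
  shows "openin X {p \<in> cdom c. coords c p \<in> S}"
proof -
  have "openin (top_of_set (cimg c)) (cimg c \<inter> S)" using assms(2) by (rule openin_open_Int)
  then have "openin (subtopology X (cdom c)) {p \<in> topspace (subtopology X (cdom c)). coords c p \<in> cimg c \<inter> S}"
    using homeomorphic_imp_continuous_map[OF chart_homeo[OF assms(1)]] openin_continuous_map_preimage by blast
  moreover have "{p \<in> topspace (subtopology X (cdom c)). coords c p \<in> cimg c \<inter> S} = {p \<in> cdom c. coords c p \<in> S}"
    using cdom_subset[OF assms(1)] by (auto simp: topspace_subtopology)
  ultimately show ?thesis using openin_trans_full cdom_open[OF assms(1)] by metis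
qed

lemma compactin_coords_vimage:
  assumes "c \<in> A" "compact K" "K \<subseteq> cimg c"
  shows "compactin X {p \<in> cdom c. coords c p \<in> K}"
proof -
  obtain h where h: "homeomorphic_maps (subtopology X (cdom c)) (top_of_set (cimg c)) (coords c) h"
    using chart_homeo[OF assms(1)] homeomorphic_map_maps by blast
  then have inv: "h (coords c p) = p" if "p \<in> cdom c" for p
    using that cdom_subset[OF assms(1)] by (auto simp: homeomorphic_maps_def topspace_subtopology)
  have "compactin (top_of_set (cimg c)) K" using assms by (simp add: compactin_subtopology)
  then have "compactin (subtopology X (cdom c)) (h ` K)"
    using h image_compactin homeomorphic_maps_def by metis
  moreover have "h ` K = {p \<in> cdom c. coords c p \<in> K}"
  proof -
    have "K = coords c ` {p \<in> cdom c. coords c p \<in> K}" using assms(3) by auto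
    then have "h ` K = h ` coords c ` {p \<in> cdom c. coords c p \<in> K}" by (rule arg_cong)
    also have "\<dots> = (\<lambda>p. h (coords c p)) ` {p \<in> cdom c. coords c p \<in> K}" by (rule image_image)
    also have "\<dots> = (\<lambda>p. p) ` {p \<in> cdom c. coords c p \<in> K}" by (rule image_cong) (auto simp: inv)
    finally show ?thesis by simp
  qed
  ultimately show ?thesis by (simp add: compactin_subtopology)
qed

lemma compact_coords_image:
  assumes "c \<in> A" "compactin X K" "K \<subseteq> cdom c"
  shows "compact (coords c ` K)"
proof -
  have "compactin (subtopology X (cdom c)) K" using assms by (simp add: compactin_subtopology)
  then have "compactin (top_of_set (cimg c)) (coords c ` K)"
    using homeomorphic_imp_continuous_map[OF chart_homeo[OF assms(1)]] image_compactin by blast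
  then show ?thesis by (simp add: compactin_subtopology)
qed

section \<open>Transition maps and their Jacobians\<close>

lemma overlap_open: "c \<in> A \<Longrightarrow> d \<in> A \<Longrightarrow> open (overlap c d)"
  using open_coords_image cdom_open by blast

lemma transition_coords: "c \<in> A \<Longrightarrow> p \<in> cdom c \<Longrightarrow> transition c d (coords c p) = coords d p"
  by (simp add: transition_def point_coords)

lemma transition_image: "c \<in> A \<Longrightarrow> transition c d ` overlap c d = overlap d c"
  by (simp add: image_image transition_coords Int_commute cong: image_cong_simp)

lemma point_transition: "c \<in> A \<Longrightarrow> d \<in> A \<Longrightarrow> x \<in> overlap c d \<Longrightarrow> point d (transition c d x) = point c x"
  by (auto simp: transition_coords point_coords)

lemma transition_inj: "c \<in> A \<Longrightarrow> d \<in> A \<Longrightarrow> inj_on (transition c d) (overlap c d)"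
  by (rule inj_on_inverseI[where g = "transition d c"]) (auto simp: transition_coords)

lemma Ck_transition: "c \<in> A \<Longrightarrow> d \<in> A \<Longrightarrow> Ck k (overlap c d) (\<lambda>x. transition c d x $ a)"
  using manifold by (intro smooth_on_Ck) (auto simp: smooth_manifold_def smooth_atlas_def)

lemma differentiable_transition:
  "c \<in> A \<Longrightarrow> d \<in> A \<Longrightarrow> x \<in> overlap c d \<Longrightarrow> (\<lambda>x. transition c d x $ a) differentiable (at x)"
  using Ck_differentiable[OF Ck_transition[of c d 1]] by simp

lemma transition_derivative:
  assumes "c \<in> A" "d \<in> A" "x \<in> overlap c d"
  shows "(transition c d has_derivative (*v) (\<chi> a i. jac c d a i x)) (at x)"
  using has_derivative_vec_pd[OF differentiable_transition[OF assms]]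
  by (simp add: matrix_vector_mult_def[abs_def])

lemma frechet_transition:
  assumes "c \<in> A" "d \<in> A" "x \<in> overlap c d"
  shows "frechet_derivative (transition c d) (at x) = (*v) (\<chi> a i. jac c d a i x)"
  using frechet_derivative_at[OF transition_derivative[OF assms]] by simp

text \<open>The chain rule on the common part of three charts. This cocycle condition is what makes
  \<open>coord_vec\<close> a tangent vector.\<close>

lemma jac_compose:
  assumes "c \<in> A" "d \<in> A" "e \<in> A" "p \<in> cdom c" "p \<in> cdom d" "p \<in> cdom e"
  shows "(\<chi> a i. jac c e a i (coords c p)) =
    (\<chi> a i. jac d e a i (coords d p)) ** (\<chi> a i. jac c d a i (coords c p))"
proof -
  let ?O = "coords c ` (cdom c \<inter> (cdom d \<inter> cdom e))"
  have O: "open ?O" using open_coords_image assms cdom_open by blast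
  have "jac c e a i (coords c p) = (\<Sum>k\<in>UNIV. jac d e a k (coords d p) * jac c d k i (coords c p))" for a i
  proof -
    have "jac c e a i (coords c p) = pd i (\<lambda>z. transition d e (transition c d z) $ a) (coords c p)"
      by (rule pd_cong_open[OF O]) (use assms in \<open>auto simp: transition_coords\<close>)
    also have "\<dots> = (\<Sum>k\<in>UNIV. jac d e a k (transition c d (coords c p)) * jac c d k i (coords c p))"
      by (rule pd_chain(1)) (auto intro!: differentiable_transition simp: assms transition_coords)
    finally show ?thesis using assms by (simp add: transition_coords)
  qed
  then show ?thesis by (simp add: vec_eq_iff matrix_matrix_mult_def)
qed

lemma jac_self:
  assumes "c \<in> A" "x \<in> cimg c"
  shows "jac c c a i x = (if a = i then 1 else 0)"
proof -
  have "jac c c a i x = pd i (\<lambda>z. z $ a) x"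
    by (rule pd_cong_open[OF cimg_open[OF assms(1)] assms(2)]) (use assms in \<open>auto simp: transition_coords\<close>)
  also have "\<dots> = axis i 1 $ a"
    by (rule pd_eq) (rule bounded_linear_imp_has_derivative[OF bounded_linear_vec_nth])
  finally show ?thesis by (auto simp: axis_def)
qed

section \<open>Tangent vectors and components of the metric\<close>

lemma tangent_transform:
  assumes "\<xi> \<in> tangent_space A p" "c \<in> A" "d \<in> A" "p \<in> cdom c" "p \<in> cdom d"
  shows "\<xi> d = (\<chi> a i. jac c d a i (coords c p)) *v \<xi> c"
proof -
  have "\<xi> d = frechet_derivative (transition c d) (at (coords c p)) (\<xi> c)"
    using assms unfolding tangent_space_def by blast
  then show ?thesis using frechet_transition[of c d "coords c p"] assms(2-5) by simp
qed

lemma tangent_zero: "\<xi> \<in> tangent_space A p \<Longrightarrow> \<not> (d \<in> A \<and> p \<in> cdom d) \<Longrightarrow> \<xi> d = 0"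
  unfolding tangent_space_def by blast

lemma coord_vec_apply:
  assumes "c \<in> A" "d \<in> A" "p \<in> cdom c" "p \<in> cdom d"
  shows "coord_vec A c i p d = (\<chi> a. jac c d a i (coords c p))"
  using assms frechet_transition[of c d "coords c p"]
  by (auto simp: coord_vec_def matrix_vector_mult_basis column_def)

lemma coord_vec_self:
  assumes "c \<in> A" "p \<in> cdom c"
  shows "coord_vec A c i p c = axis i 1"
  using assms jac_self[OF assms(1) imageI[OF assms(2)]] by (simp add: coord_vec_apply vec_eq_iff axis_def)

lemma coord_vec_tangent:
  assumes "c \<in> A" "p \<in> cdom c"
  shows "coord_vec A c i p \<in> tangent_space A p"
  unfolding tangent_space_def
proof (intro CollectI conjI ballI impI allI)
  fix d e assume *: "d \<in> A" "e \<in> A" "p \<in> cdom d \<and> p \<in> cdom e"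
  have "coord_vec A c i p e = (\<chi> a i. jac c e a i (coords c p)) *v axis i 1"
    using * assms by (simp add: coord_vec_apply matrix_vector_mult_basis column_def)
  also have "\<dots> = (\<chi> a i. jac d e a i (coords d p)) *v ((\<chi> a i. jac c d a i (coords c p)) *v axis i 1)"
    using * assms jac_compose[of c d e p] by (simp add: matrix_vector_mul_assoc)
  also have "(\<chi> a i. jac c d a i (coords c p)) *v axis i 1 = coord_vec A c i p d"
    using * assms by (simp add: coord_vec_apply matrix_vector_mult_basis column_def)
  finally show "coord_vec A c i p e = frechet_derivative (transition d e) (at (coords d p)) (coord_vec A c i p d)"
    using * frechet_transition[of d e "coords d p"] by auto
next
  fix d assume "\<not> (d \<in> A \<and> p \<in> cdom d)"
  then show "coord_vec A c i p d = 0" by (auto simp: coord_vec_def)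
qed

text \<open>An equality of functions on all charts: where the chart contains \<open>p\<close> it is
  the transformation law, elsewhere both sides are 0 by convention.\<close>

lemma tangent_expand:
  assumes "\<xi> \<in> tangent_space A p" "c \<in> A" "p \<in> cdom c"
  shows "\<xi> = (\<lambda>d. \<Sum>i\<in>UNIV. \<xi> c $ i *\<^sub>R coord_vec A c i p d)"
proof
  fix d
  show "\<xi> d = (\<Sum>i\<in>UNIV. \<xi> c $ i *\<^sub>R coord_vec A c i p d)"
  proof (cases "d \<in> A \<and> p \<in> cdom d")
    case True
    then show ?thesis
      using assms by (simp add: tangent_transform[of \<xi> p c d] coord_vec_apply vec_eq_iff matrix_vector_mult_def mult.commute)
  next
    case False
    then have "\<xi> d = 0" "coord_vec A c i p d = 0" for i
      using tangent_zero[OF assms(1)] tangent_zero[OF coord_vec_tangent[OF assms(2,3)]] by blast+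
    then show ?thesis by simp
  qed
qed

lemma inner_product: "p \<in> topspace X \<Longrightarrow> is_inner_product (tangent_space A p) (g p)"
  using metric by (simp add: riemannian_metric_def)

text \<open>\<open>is_inner_product\<close> grants linearity only for combinations of two tangent
  vectors, so the induction has to carry along that partial sums are tangent.\<close>

lemma metric_sum_left:
  assumes p: "p \<in> topspace X" and e: "\<And>i. i \<in> I \<Longrightarrow> e i \<in> tangent_space A p" and \<zeta>: "\<zeta> \<in> tangent_space A p"
    and fin: "finite I"
  shows "(\<lambda>d. \<Sum>i\<in>I. r i *\<^sub>R e i d) \<in> tangent_space A p \<and>
    g p (\<lambda>d. \<Sum>i\<in>I. r i *\<^sub>R e i d) \<zeta> = (\<Sum>i\<in>I. r i * g p (e i) \<zeta>)"
  using fin e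
proof (induction I rule: finite_induct)
  have lin: "g p (\<lambda>c. r *\<^sub>R \<xi> c + s *\<^sub>R \<eta> c) \<zeta> = r * g p \<xi> \<zeta> + s * g p \<eta> \<zeta>"
    if "\<xi> \<in> tangent_space A p" "\<eta> \<in> tangent_space A p" for \<xi> \<eta> r s
    using inner_product[OF p] that \<zeta> unfolding is_inner_product_def by blast
  {
    case empty
    \<comment> \<open>Linearity with both coefficients 0 gives the value at the zero vector.\<close>
    have "g p (\<lambda>c. 0) \<zeta> = 0" using lin[OF \<zeta> \<zeta>, of 0 0] by simp
    moreover have "(\<lambda>c. 0) \<in> tangent_space A p"
      by (auto simp: tangent_space_def frechet_transition)
    ultimately show ?case by simp
  next
    case (insert i I)
    let ?s = "\<lambda>d. \<Sum>i\<in>I. r i *\<^sub>R e i d"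
    have ei: "e i \<in> tangent_space A p" and s: "?s \<in> tangent_space A p"
      "g p ?s \<zeta> = (\<Sum>i\<in>I. r i * g p (e i) \<zeta>)"
      using insert by auto
    have "(\<lambda>d. r i *\<^sub>R e i d + ?s d) \<in> tangent_space A p"
      unfolding tangent_space_def
    proof (intro CollectI conjI ballI impI allI)
      fix c d assume *: "c \<in> A" "d \<in> A" "p \<in> cdom c \<and> p \<in> cdom d"
      have 1: "e i d = (\<chi> a i. jac c d a i (coords c p)) *v e i c"
        by (rule tangent_transform[OF ei]) (use * in simp_all)
      have 2: "?s d = (\<chi> a i. jac c d a i (coords c p)) *v ?s c"
        by (rule tangent_transform[OF s(1)]) (use * in simp_all)
      have F: "frechet_derivative (transition c d) (at (coords c p)) = (*v) (\<chi> a i. jac c d a i (coords c p))"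
        by (rule frechet_transition) (use * in auto)
      show "r i *\<^sub>R e i d + ?s d = frechet_derivative (transition c d) (at (coords c p)) (r i *\<^sub>R e i c + ?s c)"
        unfolding F 1 2 by (simp only: matrix_vector_right_distrib matrix_vector_mult_scaleR)
    next
      fix c assume "\<not> (c \<in> A \<and> p \<in> cdom c)"
      then have "e i c = 0" "?s c = 0" using tangent_zero[OF ei] tangent_zero[OF s(1)] by blast+
      then show "r i *\<^sub>R e i c + ?s c = 0" by simp
    qed
    moreover have "g p (\<lambda>d. r i *\<^sub>R e i d + ?s d) \<zeta> = r i * g p (e i) \<zeta> + g p ?s \<zeta>"
      using lin[OF ei s(1), of "r i" 1] by simp
    ultimately show ?case using insert(1,2) s(2) by simp
  }
qed

lemma metric_sym: "p \<in> topspace X \<Longrightarrow> \<xi> \<in> tangent_space A p \<Longrightarrow> \<eta> \<in> tangent_space A p \<Longrightarrow> g p \<xi> \<eta> = g p \<eta> \<xi>"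
  using inner_product unfolding is_inner_product_def by blast

text \<open>Linearity is available in the first slot only; symmetry of \<open>g p\<close> transfers
  it to the second.\<close>

lemma metric_components:
  assumes c: "c \<in> A" "p \<in> cdom c" and \<xi>: "\<xi> \<in> tangent_space A p" and \<eta>: "\<eta> \<in> tangent_space A p"
  shows "g p \<xi> \<eta> = \<xi> c \<bullet> (comp c (coords c p) *v \<eta> c)"
proof -
  let ?e = "\<lambda>i. coord_vec A c i p"
  have p: "p \<in> topspace X" using c cdom_subset by blast
  have e: "?e i \<in> tangent_space A p" for i using coord_vec_tangent[OF c] .
  have left: "g p \<zeta> \<omega> = (\<Sum>i\<in>UNIV. \<zeta> c $ i * g p (?e i) \<omega>)"
    if "\<zeta> \<in> tangent_space A p" "\<omega> \<in> tangent_space A p" for \<zeta> \<omega>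
    using metric_sum_left[OF p, where e = ?e, OF e that(2) finite, where I = UNIV and r = "\<lambda>i. \<zeta> c $ i"]
      tangent_expand[OF that(1) c] by simp
  have "g p \<xi> \<eta> = (\<Sum>i\<in>UNIV. \<xi> c $ i * (\<Sum>j\<in>UNIV. \<eta> c $ j * g p (?e i) (?e j)))"
    using left[OF \<xi> \<eta>] left[OF \<eta> e] metric_sym[OF p e \<eta>] metric_sym[OF p e e] by simp
  then show ?thesis
    using c by (simp add: inner_matrix_vector_mult components_def point_coords sum_distrib_left mult_ac)
qed

text \<open>Read in chart \<open>d\<close>, the coordinate vectors of \<open>c\<close> are the
  columns of the Jacobian, so the law is \<open>metric_components\<close> in
  \<open>d\<close>.\<close>

lemma comp_transform:
  assumes "c \<in> A" "d \<in> A" "x \<in> overlap c d"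
  shows "comp c x $ i $ j = (\<Sum>a\<in>UNIV. \<Sum>b\<in>UNIV. jac c d a i x * jac c d b j x * comp d (transition c d x) $ a $ b)"
proof -
  obtain p where p: "x = coords c p" "p \<in> cdom c" "p \<in> cdom d" using assms(3) by blast
  have "comp c x $ i $ j = g p (coord_vec A c i p) (coord_vec A c j p)"
    using assms p by (simp add: components_def point_coords)
  also have "\<dots> = coord_vec A c i p d \<bullet> (comp d (coords d p) *v coord_vec A c j p d)"
    using assms p by (intro metric_components coord_vec_tangent) auto
  finally show ?thesis
    using assms p by (simp add: coord_vec_apply inner_matrix_vector_mult transition_coords mult_ac)
qed

lemma comp_posdef:
  assumes "c \<in> A" "x \<in> cimg c"
  shows "posdef (comp c x)"
  unfolding posdef_def
proof (intro conjI allI impI)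
  let ?p = "point c x"
  have p: "?p \<in> cdom c" "?p \<in> topspace X" "coords c ?p = x"
    by (rule point_in[OF assms(2)] point_in_topspace[OF assms] coords_point[OF assms(2)])+
  let ?e = "\<lambda>i. coord_vec A c i ?p"
  have e: "?e i \<in> tangent_space A ?p" for i using coord_vec_tangent[OF assms(1) p(1)] .
  show "transpose (comp c x) = comp c x"
    using metric_sym[OF p(2) e e] by (simp add: transpose_def vec_eq_iff components_def)
  fix v :: "real^'n" assume v: "v \<noteq> 0"
  \<comment> \<open>The tangent vector whose coordinates in \<open>c\<close> are \<open>v\<close>;
    it turns positivity on the tangent space into positivity of the matrix.\<close>
  let ?\<xi> = "\<lambda>d. \<Sum>i\<in>UNIV. v $ i *\<^sub>R ?e i d"
  have \<xi>: "?\<xi> \<in> tangent_space A ?p"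
    using metric_sum_left[OF p(2), where e = ?e, OF e e finite, where I = UNIV and r = "\<lambda>i. v $ i"] by blast
  have \<xi>c: "?\<xi> c = v"
    using assms p(1) by (simp add: coord_vec_self basis_expansion flip: scalar_mult_eq_scaleR)
  then have "?\<xi> \<noteq> (\<lambda>_. 0)" using v by metis
  then have "g ?p ?\<xi> ?\<xi> > 0"
    using inner_product[OF p(2)] \<xi> unfolding is_inner_product_def by blast
  then show "0 < v \<bullet> (comp c x *v v)"
    using metric_components[OF assms(1) p(1) \<xi> \<xi>] \<xi>c p(3) by simp
qed

lemma Ck_comp: "c \<in> A \<Longrightarrow> Ck k (cimg c) (\<lambda>x. comp c x $ i $ j)"
  using metric by (intro smooth_on_Ck) (simp add: riemannian_metric_def)

lemma metric_chart: "c \<in> A \<Longrightarrow> metric_chart (cimg c) (comp c)"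
  by unfold_locales (auto simp: cimg_open Ck_comp comp_posdef)

lemma comp_invertible: "c \<in> A \<Longrightarrow> x \<in> cimg c \<Longrightarrow> invertible (comp c x)"
  using comp_posdef posdef_invertible by blast

end

section \<open>Bump functions and the Riemannian density\<close>

lemma Ck_Un:
  assumes "open S" "open T" "Ck k S f" "Ck k T f"
  shows "Ck k (S \<union> T) f"
  using assms(3,4)
  by (induction k arbitrary: f) (auto simp: continuous_on_open_Un assms(1,2))

text \<open>\<open>U\<close> and the complement of \<open>K\<close> are open and cover the space,
  and on the latter the extension is 0.\<close>

lemma Ck_extend_zero:
  assumes "open U" "compact K" "K \<subseteq> U" "Ck k U f" "\<And>x. x \<in> U \<Longrightarrow> x \<notin> K \<Longrightarrow> f x = 0"
  shows "Ck k UNIV (\<lambda>x. if x \<in> U then f x else 0)"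
proof -
  have oK: "open (- K)" using assms(2) by (simp add: compact_imp_closed open_Compl)
  have "Ck k U (\<lambda>x. if x \<in> U then f x else 0)"
    using assms(4) by (subst Ck_cong[OF assms(1), where g = f]) auto
  moreover have "Ck k (- K) (\<lambda>x. if x \<in> U then f x else 0)"
    by (subst Ck_cong[OF oK, where g = "\<lambda>_. 0"]) (use assms(5) in auto)
  moreover have "U \<union> - K = UNIV" using assms(3) by auto
  ultimately show ?thesis using Ck_Un[OF assms(1) oK] by metis
qed

lemma Ck_vec_nth: "Ck k S (\<lambda>x. x $ i)"
proof (cases k)
  case 0
  then show ?thesis by (simp add: continuous_on_component)
next
  case (Suc l)
  have d: "((\<lambda>x::real^'a. x $ i) has_derivative (\<lambda>h. h $ i)) (at x)" for x
    by (rule bounded_linear_imp_has_derivative[OF bounded_linear_vec_nth])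
  have "pd j (\<lambda>x. x $ i) = (\<lambda>x. axis j 1 $ i)" for j
    by (rule ext) (rule pd_eq[OF d])
  then show ?thesis using d Suc by (auto simp: differentiable_def)
qed

lemma pd_divide:
  assumes "f differentiable (at x)" "g differentiable (at x)" "g x \<noteq> 0"
  shows "pd i (\<lambda>y. f y / g y) x = (g x * pd i f x - f x * pd i g x) / (g x)\<^sup>2"
proof -
  have D: "(inverse has_real_derivative - (inverse (g x))\<^sup>2) (at (g x))"
    using DERIV_inverse[OF assms(3)] by (simp add: numeral_2_eq_2)
  note inv = pd_real_comp[OF assms(2) D]
  have "pd i (\<lambda>y. f y / g y) x = f x * (- (inverse (g x))\<^sup>2 * pd i g x) + pd i f x * inverse (g x)"
    unfolding divide_inverse using pd_mult[OF assms(1) inv(2)] by (simp add: inv(1))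
  then show ?thesis using assms(3) by (simp add: field_simps power2_eq_square)
qed

lemma DERIV_max_square: "((\<lambda>t::real. (max 0 t)\<^sup>2) has_real_derivative 2 * max 0 t) (at t)"
proof (cases t "0::real" rule: linorder_cases)
  case less
  have "((\<lambda>_. 0::real) has_real_derivative 2 * max 0 t) (at t)" using less by simp
  then show ?thesis
    by (rule has_field_derivative_transform_within_open[where S = "{..<0}"]) (use less in auto)
next
  case greater
  have "((\<lambda>t. t\<^sup>2) has_real_derivative 2 * max 0 t) (at t)"
    using greater by (auto intro!: derivative_eq_intros)
  then show ?thesis
    by (rule has_field_derivative_transform_within_open[where S = "{0<..}"]) (use greater in auto)
next
  case equal
  have "((\<lambda>h. (max 0 h)\<^sup>2 / h) \<longlongrightarrow> 0) (at (0::real))"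
  proof (rule Lim_null_comparison)
    show "\<forall>\<^sub>F h::real in at 0. norm ((max 0 h)\<^sup>2 / h) \<le> \<bar>h\<bar>"
      by (rule always_eventually) (auto simp: max_def power2_eq_square)
    show "((\<lambda>h::real. \<bar>h\<bar>) \<longlongrightarrow> 0) (at 0)"
      using tendsto_rabs[OF tendsto_ident_at[of "0::real"]] by simp
  qed
  then show ?thesis by (simp add: equal DERIV_def)
qed

text \<open>The form \<open>sqrt \<bar>t\<bar> / (2 * t)\<close> covers both signs at once, so for
  the density it is enough that the determinant of the metric is nonzero.\<close>

lemma DERIV_sqrt_abs:
  assumes "t \<noteq> (0::real)"
  shows "((\<lambda>t. sqrt \<bar>t\<bar>) has_real_derivative sqrt \<bar>t\<bar> / (2 * t)) (at t)"
proof (cases "t > 0")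
  case True
  have "(sqrt has_real_derivative sqrt \<bar>t\<bar> / (2 * t)) (at t)"
  proof -
    have "inverse (sqrt t) / 2 = sqrt \<bar>t\<bar> / (2 * t)" using True by (simp add: field_simps)
    then show ?thesis using DERIV_real_sqrt[OF True] by (simp only:)
  qed
  then show ?thesis
    by (rule has_field_derivative_transform_within_open[where S = "{0<..}"]) (use True in auto)
next
  case False
  then have t: "- t > 0" using assms by simp
  have "((\<lambda>t. sqrt (- t)) has_real_derivative inverse (sqrt (- t)) / 2 * (- 1)) (at t)"
    by (rule DERIV_chain2[where f = sqrt and g = uminus, OF DERIV_real_sqrt[OF t]]) (auto intro!: derivative_eq_intros)
  moreover have "inverse (sqrt (- t)) / 2 * (- 1) = sqrt \<bar>t\<bar> / (2 * t)"
    using t by (simp add: field_simps)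
  ultimately have "((\<lambda>t. sqrt (- t)) has_real_derivative sqrt \<bar>t\<bar> / (2 * t)) (at t)"
    by simp
  then show ?thesis
    by (rule has_field_derivative_transform_within_open[where S = "{..<0}"]) (use t in auto)
qed

text \<open>Squaring the positive part makes it C^1, all that integration by parts demands. The
  squared distance is spelled out in coordinates so that the rules for \<open>Ck\<close>
  apply.\<close>

definition bump :: "real^'n::finite \<Rightarrow> real \<Rightarrow> real^'n \<Rightarrow> real" where
  "bump x0 r y = (max 0 (r\<^sup>2 - (\<Sum>i\<in>UNIV. (y $ i - x0 $ i) * (y $ i - x0 $ i))))\<^sup>2"

lemma bump_eq: "bump x0 r y = (max 0 (r\<^sup>2 - (dist y x0)\<^sup>2))\<^sup>2"
  by (simp add: bump_def dist_norm norm_vec_def L2_set_def sum_nonneg power2_eq_square)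

lemma Ck_bump: "Ck 1 UNIV (bump x0 r)"
  unfolding bump_def[abs_def]
  by (rule Ck_real_comp[where \<phi> = "\<lambda>t. (max 0 t)\<^sup>2" and \<phi>' = "\<lambda>t. 2 * max 0 t", OF _ _ DERIV_max_square])
    (intro Ck_diff Ck_sum Ck_mult Ck_const Ck_vec_nth open_UNIV continuous_intros)+

lemma bump_pos:
  assumes "dist y x0 < r"
  shows "bump x0 r y > 0"
proof -
  have "(dist y x0)\<^sup>2 < r\<^sup>2" using assms by (intro power_strict_mono) auto
  then show ?thesis by (simp add: bump_eq)
qed

lemma bump_nonneg: "bump x0 r y \<ge> 0"
  by (simp add: bump_def)

lemma bump_zero: "r \<ge> 0 \<Longrightarrow> dist y x0 \<ge> r \<Longrightarrow> bump x0 r y = 0"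
  by (simp add: bump_eq power_mono)

section \<open>The Riemannian density and the divergence theorem in one chart\<close>

context metric_chart
begin

definition dens :: "real^'n \<Rightarrow> real" where
  "dens x = sqrt \<bar>det (G x)\<bar>"

lemma det_nz: "x \<in> U \<Longrightarrow> det (G x) \<noteq> 0"
  using invertible_G invertible_det_nz by blast

lemma dens_pos: "x \<in> U \<Longrightarrow> dens x > 0"
  using det_nz by (simp add: dens_def)

lemma Ck_dens: "Ck 1 U dens"
proof -
  have D: "Ck 1 U (\<lambda>x. det (G x))" by (intro Ck_det open_U Ck_mono[OF Ck_G]) simp
  show ?thesis
    unfolding dens_def[abs_def]
    by (rule Ck_real_comp[OF open_U D DERIV_sqrt_abs])
      (use det_nz in \<open>auto intro!: continuous_intros\<close>)
qed

text \<open>Jacobi's formula meets \<open>chris_contract\<close>: both involve the trace of the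
  inverse metric against the derivative of the metric.\<close>

lemma pd_dens:
  assumes x: "x \<in> U"
  shows "pd k dens x = dens x * (\<Sum>i\<in>UNIV. chris G i i k x)"
proof -
  have d: "(\<lambda>x. det (G x)) differentiable (at x)"
    by (rule differentiable_det[OF differentiable_G[OF x]])
  have "pd k dens x = dens x / (2 * det (G x)) * pd k (\<lambda>x. det (G x)) x"
    unfolding dens_def[abs_def] by (rule pd_real_comp(1)[OF d DERIV_sqrt_abs[OF det_nz[OF x]]])
  moreover have "pd k (\<lambda>x. det (G x)) x = det (G x) * (2 * (\<Sum>i\<in>UNIV. chris G i i k x))"
    using jacobi_formula[OF differentiable_G[OF x] invertible_G[OF x], of k] pd_G_sym[OF x, of k]
    by (simp add: chris_contract[OF x])
  ultimately show ?thesis using det_nz[OF x] by simp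
qed

text \<open>\<open>pd_dens\<close> supplies precisely the Christoffel term of
  \<open>ldiv_eq\<close>, so the weighted divergence of \<open>h W\<close> is a plain coordinate
  divergence.\<close>

lemma divergence_density:
  assumes x: "x \<in> U" and h: "h differentiable (at x)" and W: "\<And>i. (\<lambda>y. W y $ i) differentiable (at x)"
  shows "(\<Sum>i\<in>UNIV. pd i (\<lambda>y. dens y * h y * W y $ i) x)
    = dens x * (h x * ldiv G W x + (\<Sum>i\<in>UNIV. W x $ i * pd i h x))"
proof -
  have dd: "dens differentiable (at x)" using Ck_differentiable[OF Ck_dens _ x] by simp
  have "pd i (\<lambda>y. dens y * h y * W y $ i) x = dens x * (h x * pd i (\<lambda>y. W y $ i) x)
      + dens x * (h x * ((\<Sum>j\<in>UNIV. chris G j j i x) * W x $ i)) + dens x * (W x $ i * pd i h x)" for i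
    by (subst pd_mult[OF differentiable_mult[OF dd h] W], subst pd_mult[OF dd h])
      (simp add: pd_dens[OF x] algebra_simps)
  then show ?thesis
    by (simp add: ldiv_eq[OF x] sum.distrib distrib_left flip: sum_distrib_left)
qed

lemma continuous_ldiv:
  assumes "\<And>i. Ck 1 U (\<lambda>y. W y $ i)"
  shows "continuous_on U (ldiv G W)"
proof -
  have "continuous_on U (pd l (\<lambda>y. W y $ l))" "continuous_on U (\<lambda>y. W y $ l)" for l
    using assms[of l] Ck_continuous[OF assms[of l]] by simp_all
  moreover have "continuous_on U (chris G i i k)" for i k
    by (rule Ck_continuous[OF Ck_chris])
  ultimately have "continuous_on U (\<lambda>x. (\<Sum>l\<in>UNIV. pd l (\<lambda>y. W y $ l) x)
      + (\<Sum>k\<in>UNIV. (\<Sum>i\<in>UNIV. chris G i i k x) * W x $ k))"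
    by (intro continuous_on_add continuous_on_sum continuous_on_mult)
  then show ?thesis by (subst continuous_on_cong[OF refl ldiv_eq])
qed

text \<open>Each summand of the coordinate divergence is a partial derivative of a compactly
  supported C^1 function and integrates to 0. The cut-off \<open>h\<close> provides the support,
  since \<open>W\<close> lives only on the chart.\<close>

lemma divergence_chart:
  assumes h: "Ck 1 U h" and W: "\<And>i. Ck 1 U (\<lambda>y. W y $ i)"
    and K: "compact K" "K \<subseteq> U" "\<And>x. x \<in> U \<Longrightarrow> x \<notin> K \<Longrightarrow> h x = 0"
  shows "((\<lambda>x. if x \<in> U then dens x * (h x * ldiv G W x + (\<Sum>i\<in>UNIV. W x $ i * pd i h x)) else 0)
    has_integral 0) UNIV"
proof -
  let ?f = "\<lambda>i y. dens y * h y * W y $ i" and ?e = "\<lambda>i x. if x \<in> U then dens x * h x * W x $ i else 0"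
  have e: "(pd i (?e i) has_integral 0) UNIV" for i
  proof (rule has_integral_pd_zero[OF _ K(1)])
    show "Ck 1 UNIV (?e i)"
      using K(3) by (intro Ck_extend_zero[OF open_U K(1,2)] Ck_mult open_U Ck_dens h W) auto
    show "?e i x = 0" if "x \<notin> K" for x using K(3) that by auto
  qed
  have pe: "pd i (?e i) x = (if x \<in> U then pd i (?f i) x else 0)" for i x
  proof (cases "x \<in> U")
    case True
    then show ?thesis using pd_cong_open[OF open_U True, of "?e i" "?f i"] by simp
  next
    case False
    have "pd i (?e i) x = pd i (\<lambda>_. 0) x"
      by (rule pd_cong_open[of "- K"])
        (use False K in \<open>auto simp: compact_imp_closed open_Compl\<close>)
    then show ?thesis using False by simp
  qed
  have "(\<Sum>i\<in>UNIV. pd i (?e i) x)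
      = (if x \<in> U then dens x * (h x * ldiv G W x + (\<Sum>i\<in>UNIV. W x $ i * pd i h x)) else 0)" for x
  proof (cases "x \<in> U")
    case True
    have "h differentiable (at x)" "(\<lambda>y. W y $ i) differentiable (at x)" for i
      using Ck_differentiable[OF h _ True] Ck_differentiable[OF W _ True] by simp_all
    then show ?thesis using divergence_density[OF True] by (simp add: pe True)
  qed (simp add: pe)
  moreover have "((\<lambda>x. \<Sum>i\<in>UNIV. pd i (?e i) x) has_integral (\<Sum>i\<in>(UNIV::'n set). 0)) UNIV"
    by (rule has_integral_sum[OF finite e])
  ultimately show ?thesis by simp
qed

end

section \<open>The divergence theorem on a compact manifold\<close>

type_synonym ('a, 'n) coord_ball = "('a, 'n) chart \<times> (real^'n) \<times> real"

context riemannian_atlas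
begin

abbreviation bchart :: "('a, 'n) coord_ball \<Rightarrow> ('a, 'n) chart" where "bchart b \<equiv> fst b"
abbreviation centre :: "('a, 'n) coord_ball \<Rightarrow> real^'n" where "centre b \<equiv> fst (snd b)"
abbreviation radius :: "('a, 'n) coord_ball \<Rightarrow> real" where "radius b \<equiv> snd (snd b)"

text \<open>The closed ball has to fit into the chart image: its preimage is then compact in the
  manifold, and the bump reaches 0 before the chart ends.\<close>

definition admissible :: "('a, 'n) coord_ball \<Rightarrow> bool" where
  "admissible b \<longleftrightarrow> bchart b \<in> A \<and> radius b > 0 \<and> cball (centre b) (radius b) \<subseteq> cimg (bchart b)"

definition bsupp :: "('a, 'n) coord_ball \<Rightarrow> 'a set" where
  "bsupp b = {p \<in> cdom (bchart b). coords (bchart b) p \<in> cball (centre b) (radius b)}"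

definition bfun :: "('a, 'n) coord_ball \<Rightarrow> 'a \<Rightarrow> real" where
  "bfun b p = (if p \<in> cdom (bchart b) then bump (centre b) (radius b) (coords (bchart b) p) else 0)"

text \<open>Already the open balls cover, which later makes the sum of the bumps positive
  everywhere.\<close>

lemma finite_cover:
  assumes "compact_space X"
  obtains F where "finite F" "\<And>b. b \<in> F \<Longrightarrow> admissible b"
    "\<And>p. p \<in> topspace X \<Longrightarrow> \<exists>b\<in>F. p \<in> cdom (bchart b) \<and> coords (bchart b) p \<in> ball (centre b) (radius b)"
proof -
  let ?B = "\<lambda>b. {p \<in> cdom (bchart b). coords (bchart b) p \<in> ball (centre b) (radius b)}"
  have op: "openin X U" if "U \<in> ?B ` {b. admissible b}" for U
    using that openin_coords_vimage[OF _ open_ball] by (auto simp: admissible_def)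
  have cover: "topspace X \<subseteq> \<Union> (?B ` {b. admissible b})"
  proof
    fix p assume "p \<in> topspace X"
    then obtain c where c: "c \<in> A" "p \<in> cdom c" by (rule chart_exists)
    have "coords c p \<in> cimg c" using c(2) by (rule imageI)
    then obtain r where r: "r > 0" "cball (coords c p) r \<subseteq> cimg c"
      using cimg_open[OF c(1)] open_contains_cball by metis
    have "admissible (c, coords c p, r)" "p \<in> ?B (c, coords c p, r)"
      using c r by (auto simp: admissible_def)
    then show "p \<in> \<Union> (?B ` {b. admissible b})" by blast
  qed
  have "compactin X (topspace X)" using assms by (simp add: compact_space_def)
  then obtain \<F> where \<F>: "finite \<F>" "\<F> \<subseteq> ?B ` {b. admissible b}" "topspace X \<subseteq> \<Union>\<F>"
    using compactinD[OF _ op cover] by auto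
  from finite_subset_image[OF \<F>(1,2)]
  obtain F where F: "finite F" "F \<subseteq> {b. admissible b}" "\<F> = ?B ` F"
    by (elim exE conjE) (rule that)
  show thesis
  proof (rule that[OF F(1)])
    show "admissible b" if "b \<in> F" for b using F(2) that by blast
    show "\<exists>b\<in>F. p \<in> cdom (bchart b) \<and> coords (bchart b) p \<in> ball (centre b) (radius b)"
      if "p \<in> topspace X" for p
    proof -
      have "p \<in> \<Union> (?B ` F)" using that \<F>(3) F(3) by blast
      then show ?thesis by simp
    qed
  qed
qed

lemma compactin_bsupp:
  assumes "admissible b"
  shows "compactin X (bsupp b)"
  using assms compactin_coords_vimage[of "bchart b" "cball (centre b) (radius b)"]
  by (simp add: bsupp_def admissible_def)

text \<open>The Hausdorff property enters here: the compact set \<open>bsupp b\<close> is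
  closed.\<close>

lemma bsupp_complement_open:
  assumes "admissible b" "d \<in> A"
  shows "open (coords d ` (cdom d \<inter> (topspace X - bsupp b)))"
  by (rule open_coords_image[OF assms(2)])
    (simp add: openin_diff compactin_imp_closedin[OF Hausdorff compactin_bsupp[OF assms(1)]])

lemma bfun_zero: "admissible b \<Longrightarrow> p \<notin> bsupp b \<Longrightarrow> bfun b p = 0"
  by (auto simp: bfun_def bsupp_def admissible_def dist_commute intro!: bump_zero)

lemma bfun_nonneg: "bfun b p \<ge> 0"
  by (simp add: bfun_def bump_nonneg)

lemma bfun_pos: "p \<in> cdom (bchart b) \<Longrightarrow> coords (bchart b) p \<in> ball (centre b) (radius b) \<Longrightarrow> bfun b p > 0"
  by (simp add: bfun_def bump_pos dist_commute)

lemma bfun_zero_open: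
  assumes "admissible b" "d \<in> A" "y \<in> coords d ` (cdom d \<inter> (topspace X - bsupp b))"
  shows "bfun b (point d y) = 0"
  using assms by (auto simp: point_coords bfun_zero)

lemma pd_bfun_zero:
  assumes "admissible b" "d \<in> A" "y \<in> cimg d" "point d y \<notin> bsupp b"
  shows "pd i (\<lambda>z. bfun b (point d z)) y = 0"
proof -
  obtain p where p: "p \<in> cdom d" "y = coords d p" using assms(3) by blast
  have "p \<in> topspace X - bsupp b"
    using p assms point_coords[OF assms(2)] cdom_subset[OF assms(2)] by auto
  then have y: "y \<in> coords d ` (cdom d \<inter> (topspace X - bsupp b))" using p by blast
  have "pd i (\<lambda>z. bfun b (point d z)) y = pd i (\<lambda>_. 0) y"
    by (rule pd_cong_open[OF bsupp_complement_open[OF assms(1,2)] y bfun_zero_open[OF assms(1,2)]])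
  then show ?thesis by simp
qed

text \<open>Two open sets cover the chart image: the overlap with the chart of the ball, where
  \<open>bfun\<close> is a bump after a transition map, and the complement of
  \<open>bsupp b\<close>, where it is 0.\<close>

lemma Ck_bfun:
  assumes b: "admissible b" and d: "d \<in> A"
  shows "Ck 1 (cimg d) (\<lambda>y. bfun b (point d y))"
proof -
  let ?c = "bchart b" and ?O = "coords d ` (cdom d \<inter> (topspace X - bsupp b))"
  have c: "?c \<in> A" using b by (simp add: admissible_def)
  have "Ck 1 (overlap d ?c) (\<lambda>y. bump (centre b) (radius b) (transition d ?c y))"
    by (rule Ck_compose[OF overlap_open[OF d c] Ck_transition[OF d c] Ck_bump]) simp
  moreover have "bfun b (point d y) = bump (centre b) (radius b) (transition d ?c y)" if "y \<in> overlap d ?c" for y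
    using that d by (auto simp: point_coords transition_coords bfun_def)
  ultimately have 1: "Ck 1 (overlap d ?c) (\<lambda>y. bfun b (point d y))"
    by (subst Ck_cong[OF overlap_open[OF d c]])
  have 2: "Ck 1 ?O (\<lambda>y. bfun b (point d y))"
    by (subst Ck_cong[OF bsupp_complement_open[OF b d] bfun_zero_open[OF b d]]) simp_all
  have "cimg d = overlap d ?c \<union> ?O"
    using cdom_subset[OF d] by (auto simp: bsupp_def)
  then show ?thesis
    using Ck_Un[OF overlap_open[OF d c] bsupp_complement_open[OF b d] 1 2] by (simp only:)
qed

definition dir :: "(('a, 'n) chart \<Rightarrow> real^'n \<Rightarrow> real^'n) \<Rightarrow> ('a, 'n) chart \<Rightarrow> ('a \<Rightarrow> real) \<Rightarrow> real^'n \<Rightarrow> real" where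
  "dir W c \<phi> y = (\<Sum>i\<in>UNIV. W c y $ i * pd i (\<lambda>z. \<phi> (point c z)) y)"

lemma pd_point_transform:
  assumes "c \<in> A" "d \<in> A" "y \<in> overlap c d"
    and "(\<lambda>z. \<phi> (point d z)) differentiable (at (transition c d y))"
  shows "pd i (\<lambda>z. \<phi> (point c z)) y
    = (\<Sum>k\<in>UNIV. pd k (\<lambda>z. \<phi> (point d z)) (transition c d y) * jac c d k i y)"
proof -
  have "pd i (\<lambda>z. \<phi> (point c z)) y = pd i (\<lambda>z. \<phi> (point d (transition c d z))) y"
    by (rule pd_cong_open[OF overlap_open[OF assms(1,2)] assms(3)]) (simp add: point_transition[OF assms(1,2)])
  also have "\<dots> = (\<Sum>k\<in>UNIV. pd k (\<lambda>z. \<phi> (point d z)) (transition c d y) * jac c d k i y)"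
    by (rule pd_chain(1)[OF differentiable_transition[OF assms(1-3)] assms(4)])
  finally show ?thesis .
qed

lemma transition_in: "c \<in> A \<Longrightarrow> y \<in> overlap c d \<Longrightarrow> transition c d y \<in> overlap d c"
  using transition_image by blast

lemma dens_transform:
  assumes "c \<in> A" "d \<in> A" "y \<in> overlap c d"
  shows "metric_chart.dens (comp c) y
    = \<bar>det (\<chi> a i. jac c d a i y)\<bar> * metric_chart.dens (comp d) (transition c d y)"
proof -
  have y: "y \<in> cimg c" "transition c d y \<in> cimg d"
    using assms(3) transition_in[OF assms(1,3)] by blast+
  have "det (comp c y) = (det (\<chi> a i. jac c d a i y))\<^sup>2 * det (comp d (transition c d y))"
    by (rule congruence_matrix_inv(2)[OF comp_transform[OF assms] comp_invertible[OF assms(1) y(1)]])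
  then show ?thesis
    by (simp add: metric_chart.dens_def[OF metric_chart[OF assms(1)]]
        metric_chart.dens_def[OF metric_chart[OF assms(2)]] abs_mult real_sqrt_mult)
qed

section \<open>Vector fields given by their components in all charts\<close>

context
  fixes W :: "('a, 'n) chart \<Rightarrow> real^'n \<Rightarrow> real^'n"
  assumes Ck_W: "\<And>c i. c \<in> A \<Longrightarrow> Ck 1 (cimg c) (\<lambda>y. W c y $ i)"
    and W_transform: "\<And>c d y a. c \<in> A \<Longrightarrow> d \<in> A \<Longrightarrow> y \<in> overlap c d \<Longrightarrow>
      W d (transition c d y) $ a = (\<Sum>i\<in>UNIV. jac c d a i y * W c y $ i)"
begin

lemma dir_transform:
  assumes "c \<in> A" "d \<in> A" "y \<in> overlap c d"
    and "(\<lambda>z. \<phi> (point d z)) differentiable (at (transition c d y))"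
  shows "dir W c \<phi> y = dir W d \<phi> (transition c d y)"
proof -
  have "dir W c \<phi> y = (\<Sum>i\<in>UNIV. \<Sum>k\<in>UNIV. W c y $ i * (pd k (\<lambda>z. \<phi> (point d z)) (transition c d y) * jac c d k i y))"
    by (simp add: dir_def pd_point_transform[OF assms] sum_distrib_left)
  also have "\<dots> = dir W d \<phi> (transition c d y)"
    by (subst sum.swap) (simp add: dir_def W_transform[OF assms(1-3)] sum_distrib_left mult_ac)
  finally show ?thesis .
qed

lemma continuous_dir_bfun:
  assumes "admissible b" "d \<in> A"
  shows "continuous_on (cimg d) (dir W d (bfun b))"
proof -
  have "continuous_on (cimg d) (pd i (\<lambda>z. bfun b (point d z)))" for i
    using Ck_bfun[OF assms] by simp
  then show ?thesis
    unfolding dir_def[abs_def]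
    by (intro continuous_on_sum continuous_on_mult Ck_continuous[OF Ck_W[OF assms(2)]])
qed

text \<open>Integrating the divergence against the partition of unity \<open>bfun a / sum bfun\<close> leaves the
  terms \<open>W (bfun a / sum bfun)\<close>, which are sums of expressions antisymmetric in two balls.\<close>

lemma exists_ldiv_nonneg:
  assumes cpt: "compact_space X" and ne: "topspace X \<noteq> {}"
  shows "\<exists>c\<in>A. \<exists>y\<in>cimg c. 0 \<le> ldiv (comp c) (W c) y"
proof (rule ccontr)
  assume "\<not> ?thesis"
  then have neg: "ldiv (comp c) (W c) y < 0" if "c \<in> A" "y \<in> cimg c" for c y
    using that by (meson not_le)
  obtain F where F: "finite F" "\<And>b. b \<in> F \<Longrightarrow> admissible b"
    "\<And>p. p \<in> topspace X \<Longrightarrow> \<exists>b\<in>F. p \<in> cdom (bchart b) \<and> coords (bchart b) p \<in> ball (centre b) (radius b)"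
    using finite_cover[OF cpt] by metis
  have FA: "bchart b \<in> A" if "b \<in> F" for b using F(2)[OF that] by (simp add: admissible_def)
  let ?D = "\<lambda>c. metric_chart.dens (comp c)"
  define P where "P p = (\<Sum>b\<in>F. bfun b p)" for p
  have P_pos: "P p > 0" if p: "p \<in> topspace X" for p
  proof -
    obtain b where "b \<in> F" "bfun b p > 0" using F(3)[OF p] bfun_pos by blast
    then show ?thesis unfolding P_def by (intro sum_pos2[OF F(1)]) (auto simp: bfun_nonneg)
  qed
  have P_pos': "P (point c y) > 0" if "c \<in> A" "y \<in> cimg c" for c y
    by (rule P_pos[OF point_in_topspace[OF that]])
  have Ck_b: "Ck 1 (cimg c) (\<lambda>y. bfun b (point c y))" if "b \<in> F" "c \<in> A" for b c
    by (rule Ck_bfun[OF F(2)[OF that(1)] that(2)])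
  have Ck_P: "Ck 1 (cimg c) (\<lambda>y. P (point c y))" if "c \<in> A" for c
    unfolding P_def by (intro Ck_sum cimg_open Ck_b that)
  have Ck_D: "Ck 1 (cimg c) (?D c)" "\<And>y. y \<in> cimg c \<Longrightarrow> ?D c y > 0" if "c \<in> A" for c
    using metric_chart.Ck_dens[OF metric_chart[OF that]] metric_chart.dens_pos[OF metric_chart[OF that]] by blast+
  \<comment> \<open>By the quotient rule, with \<open>P\<close> the sum of all bumps, the derivative
    of \<open>bfun a / P\<close> along \<open>W\<close> is the sum of \<open>n a b\<close> over
    \<open>b\<close>; exchanging \<open>a\<close> and \<open>b\<close> changes the sign.\<close>
  define n where "n a b c y = (bfun b (point c y) * dir W c (bfun a) y - bfun a (point c y) * dir W c (bfun b) y)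
      / (P (point c y))\<^sup>2" for a b c y
  \<comment> \<open>The exchange term of two balls, weighted by the density in the chart of the
    first and extended by 0.\<close>
  define N where "N a b y = (if y \<in> cimg (bchart a) then ?D (bchart a) y * n a b (bchart a) y else 0)" for a b y
  let ?t = "\<lambda>a y. ?D (bchart a) y
      * (bfun a (point (bchart a) y) / P (point (bchart a) y) * ldiv (comp (bchart a)) (W (bchart a)) y)"
  define T where "T a y = (if y \<in> cimg (bchart a) then ?t a y else 0)" for a y
  let ?K = "\<lambda>a. cball (centre a) (radius a)"
  have K: "compact (?K a)" "?K a \<subseteq> cimg (bchart a)" if "a \<in> F" for a
    using F(2)[OF that] by (auto simp: admissible_def)
  have n_cont: "continuous_on (cimg c) (n a b c)" if "a \<in> F" "b \<in> F" "c \<in> A" for a b c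
    unfolding n_def[abs_def]
    using P_pos'[OF that(3)] F(2) that
    by (intro continuous_on_divide continuous_on_diff continuous_on_mult continuous_on_power
        Ck_continuous[OF Ck_b] Ck_continuous[OF Ck_P] continuous_dir_bfun) fastforce+
  \<comment> \<open>Support in both balls is what allows the term to be read in either
    chart.\<close>
  have n_zero: "n a b c y = 0" if "a \<in> F" "b \<in> F" "c \<in> A" "y \<in> cimg c" "point c y \<notin> bsupp a \<inter> bsupp b" for a b c y
  proof (cases "point c y \<in> bsupp a")
    case False
    then have "bfun a (point c y) = 0" "dir W c (bfun a) y = 0"
      using bfun_zero[OF F(2)[OF that(1)]] pd_bfun_zero[OF F(2)[OF that(1)] that(3,4)] by (simp_all add: dir_def)
    then show ?thesis by (simp add: n_def)
  next
    case True
    then have "point c y \<notin> bsupp b" using that(5) by blast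
    then have "bfun b (point c y) = 0" "dir W c (bfun b) y = 0"
      using bfun_zero[OF F(2)[OF that(2)]] pd_bfun_zero[OF F(2)[OF that(2)] that(3,4)] by (simp_all add: dir_def)
    then show ?thesis by (simp add: n_def)
  qed
  have not_supp: "point (bchart a) y \<notin> bsupp a" if "y \<in> cimg (bchart a)" "y \<notin> ?K a" for a y
    using that by (simp add: bsupp_def coords_point)
  have N_cont: "continuous_on UNIV (N a b)" if "a \<in> F" "b \<in> F" for a b
  proof -
    have "Ck 0 UNIV (\<lambda>y. if y \<in> cimg (bchart a) then ?D (bchart a) y * n a b (bchart a) y else 0)"
    proof (rule Ck_extend_zero[OF cimg_open[OF FA[OF that(1)]] K[OF that(1)]])
      show "Ck 0 (cimg (bchart a)) (\<lambda>y. ?D (bchart a) y * n a b (bchart a) y)"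
        using continuous_on_mult[OF Ck_continuous[OF Ck_D(1)] n_cont] FA that by simp
      show "?D (bchart a) y * n a b (bchart a) y = 0" if "y \<in> cimg (bchart a)" "y \<notin> ?K a" for y
        using n_zero[OF \<open>a \<in> F\<close> \<open>b \<in> F\<close> FA that(1)] not_supp[OF that] \<open>a \<in> F\<close> by simp
    qed
    then show ?thesis unfolding N_def[abs_def] by simp
  qed
  have N_zero: "N a b y = 0" if "a \<in> F" "b \<in> F" "y \<notin> ?K a" for a b y
    using n_zero[OF that(1,2) FA[OF that(1)], of y] not_supp[of y a] that(3) by (auto simp: N_def)
  have T_cont: "continuous_on UNIV (T a)" if "a \<in> F" for a
  proof -
    have "Ck 0 UNIV (\<lambda>y. if y \<in> cimg (bchart a) then ?t a y else 0)"
    proof (rule Ck_extend_zero[OF cimg_open[OF FA[OF that]] K[OF that]])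
      show "Ck 0 (cimg (bchart a)) (\<lambda>y. ?t a y)"
        using P_pos'[OF FA[OF that]] metric_chart.continuous_ldiv[OF metric_chart Ck_W] that FA[OF that]
        unfolding Ck.simps
        by (intro continuous_on_mult continuous_on_divide Ck_continuous[OF Ck_D(1)]
          Ck_continuous[OF Ck_b] Ck_continuous[OF Ck_P]) fastforce+
      show "?t a y = 0"
        if "y \<in> cimg (bchart a)" "y \<notin> ?K a" for y
        using bfun_zero[OF F(2)[OF \<open>a \<in> F\<close>] not_supp[OF that]] by simp
    qed
    then show ?thesis unfolding T_def[abs_def] by simp
  qed
  have T_zero: "T a y = 0" if "a \<in> F" "y \<notin> ?K a" for a y
    using bfun_zero[OF F(2)[OF that(1)] not_supp[of y a]] that by (auto simp: T_def)
  have N_int: "N a b integrable_on UNIV" if "a \<in> F" "b \<in> F" for a b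
    using absolutely_integrable_compact_support[OF N_cont[OF that] K(1)[OF that(1)] N_zero[OF that]]
    by (simp add: set_lebesgue_integral_eq_integral(1))
  have T_int: "T a integrable_on UNIV" if "a \<in> F" for a
    using absolutely_integrable_compact_support[OF T_cont[OF that] K(1)[OF that] T_zero[OF that]]
    by (simp add: set_lebesgue_integral_eq_integral(1))
  \<comment> \<open>This is \<open>divergence_chart\<close> for the cut-off
    \<open>bfun a / P\<close>.\<close>
  have sum_zero: "integral UNIV (T a) + (\<Sum>b\<in>F. integral UNIV (N a b)) = 0" if a: "a \<in> F" for a
  proof -
    let ?c = "bchart a"
    have c: "?c \<in> A" using FA[OF a] .
    let ?h = "\<lambda>y. bfun a (point ?c y) / P (point ?c y)"
    let ?Z = "\<lambda>y. if y \<in> cimg ?c then ?D ?c y * (?h y * ldiv (comp ?c) (W ?c) y + (\<Sum>i\<in>UNIV. W ?c y $ i * pd i ?h y)) else 0"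
    have Ck_h: "Ck 1 (cimg ?c) ?h"
      by (rule Ck_divide[OF cimg_open[OF c] Ck_b[OF a c] Ck_P[OF c]]) (use P_pos'[OF c] in fastforce)
    have h0: "?h y = 0" if "y \<in> cimg ?c" "y \<notin> ?K a" for y
      using bfun_zero[OF F(2)[OF a] not_supp[OF that]] by simp
    have dh: "(\<Sum>i\<in>UNIV. W ?c y $ i * pd i ?h y) = (\<Sum>b\<in>F. n a b ?c y)" if y: "y \<in> cimg ?c" for y
    proof -
      let ?w = "\<lambda>b i. bfun b (point ?c y) * pd i (\<lambda>y. bfun a (point ?c y)) y
          - bfun a (point ?c y) * pd i (\<lambda>y. bfun b (point ?c y)) y"
      have db: "(\<lambda>y. bfun b (point ?c y)) differentiable (at y)" if "b \<in> F" for b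
        using Ck_differentiable[OF Ck_b[OF that c] _ y] by simp
      have dP: "(\<lambda>y. P (point ?c y)) differentiable (at y)"
        using Ck_differentiable[OF Ck_P[OF c] _ y] by simp
      have pP: "pd i (\<lambda>y. P (point ?c y)) y = (\<Sum>b\<in>F. pd i (\<lambda>y. bfun b (point ?c y)) y)" for i
        unfolding P_def by (rule pd_sum[OF db])
      have "W ?c y $ i * pd i ?h y = (\<Sum>b\<in>F. W ?c y $ i * (?w b i) / (P (point ?c y))\<^sup>2)" for i
      proof -
        have "pd i ?h y = (P (point ?c y) * pd i (\<lambda>y. bfun a (point ?c y)) y
            - bfun a (point ?c y) * pd i (\<lambda>y. P (point ?c y)) y) / (P (point ?c y))\<^sup>2"
          using P_pos'[OF c y] by (intro pd_divide db[OF a] dP) simp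
        also have "P (point ?c y) * pd i (\<lambda>y. bfun a (point ?c y)) y - bfun a (point ?c y) * pd i (\<lambda>y. P (point ?c y)) y
            = (\<Sum>b\<in>F. ?w b i)"
          unfolding pP by (simp add: P_def sum_subtractf sum_distrib_left sum_distrib_right)
        finally show ?thesis by (simp add: sum_distrib_left sum_divide_distrib)
      qed
      then have "(\<Sum>i\<in>UNIV. W ?c y $ i * pd i ?h y) = (\<Sum>b\<in>F. \<Sum>i\<in>UNIV. W ?c y $ i * (?w b i) / (P (point ?c y))\<^sup>2)"
        by (simp only: sum.swap[of _ F])
      also have "\<dots> = (\<Sum>b\<in>F. n a b ?c y)"
        by (rule sum.cong[OF refl])
          (simp add: n_def dir_def sum_distrib_left sum_subtractf right_diff_distrib diff_divide_distrib
            sum_divide_distrib mult_ac)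
      finally show ?thesis .
    qed
    have "(?Z
        has_integral 0) UNIV"
      by (rule metric_chart.divergence_chart[OF metric_chart[OF c] Ck_h Ck_W[OF c] K[OF a] h0])
    moreover have "?Z
        = (\<lambda>y. T a y + (\<Sum>b\<in>F. N a b y))"
      by (intro ext) (auto simp: T_def N_def dh distrib_left sum_distrib_left)
    ultimately have "((\<lambda>y. T a y + (\<Sum>b\<in>F. N a b y)) has_integral 0) UNIV" by simp
    moreover have "((\<lambda>y. T a y + (\<Sum>b\<in>F. N a b y)) has_integral
        integral UNIV (T a) + (\<Sum>b\<in>F. integral UNIV (N a b))) UNIV"
      using T_int N_int a F(1) by (intro has_integral_add has_integral_sum) (auto simp: integrable_integral)
    ultimately show ?thesis using has_integral_unique by blast
  qed
  \<comment> \<open>Change of variables over the overlap moves the second integral to the chart of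
    \<open>a\<close>. The density absorbs the absolute Jacobian, and what is left is a scalar that
    changes sign.\<close>
  have antisym: "integral UNIV (N a b) = - integral UNIV (N b a)" if a: "a \<in> F" and b: "b \<in> F" for a b
  proof -
    let ?c = "bchart a" and ?d = "bchart b"
    have c: "?c \<in> A" and d: "?d \<in> A" using FA a b by auto
    let ?S = "overlap ?c ?d" and ?M = "bsupp a \<inter> bsupp b" and ?\<tau> = "transition ?c ?d"
    have M: "compactin X ?M" "?M \<subseteq> cdom ?c" "?M \<subseteq> cdom ?d"
      by (rule compact_Int_closedin[OF compactin_bsupp[OF F(2)[OF a]]
            compactin_imp_closedin[OF Hausdorff compactin_bsupp[OF F(2)[OF b]]]])
        (auto simp: bsupp_def)
    have "integral UNIV (\<lambda>y. - N b a y)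
        = integral UNIV (\<lambda>x. if x \<in> ?S then \<bar>det (\<chi> a i. jac ?c ?d a i x)\<bar> * (- N b a (?\<tau> x)) else 0)"
    proof (rule change_of_variables[OF overlap_open[OF c d] transition_derivative[OF c d] transition_inj[OF c d]])
      show "continuous_on UNIV (\<lambda>y. - N b a y)" using N_cont[OF b a] by (rule continuous_on_minus)
      show "compact (coords ?d ` ?M)" by (rule compact_coords_image[OF d M(1,3)])
      show "coords ?d ` ?M \<subseteq> ?\<tau> ` ?S"
        unfolding transition_image[OF c] using M by blast
      show "- N b a y = 0" if "y \<notin> coords ?d ` ?M" for y
      proof (cases "y \<in> cimg ?d")
        case True
        have "point ?d y \<notin> ?M" using that coords_point[OF True] by (metis image_eqI)
        then show ?thesis using n_zero[OF b a d True] by (simp add: N_def Int_commute)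
      qed (simp add: N_def)
      show "compact (coords ?c ` ?M)" by (rule compact_coords_image[OF c M(1,2)])
      show "- N b a (?\<tau> x) = 0" if x: "x \<in> ?S" "x \<notin> coords ?c ` ?M" for x
      proof -
        have \<tau>x: "?\<tau> x \<in> cimg ?d" using transition_in[OF c x(1)] by blast
        have "x \<in> cimg ?c" using x(1) by blast
        then have "point ?c x \<notin> ?M" using x(2) coords_point by (metis image_eqI)
        then have "point ?d (?\<tau> x) \<notin> ?M" by (simp only: point_transition[OF c d x(1)] not_False_eq_True)
        then show ?thesis using n_zero[OF b a d \<tau>x] by (simp add: N_def Int_commute)
      qed
    qed
    also have "(\<lambda>x. if x \<in> ?S then \<bar>det (\<chi> a i. jac ?c ?d a i x)\<bar> * (- N b a (?\<tau> x)) else 0) = N a b"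
    proof
      fix x
      show "(if x \<in> ?S then \<bar>det (\<chi> a i. jac ?c ?d a i x)\<bar> * (- N b a (?\<tau> x)) else 0) = N a b x"
      proof (cases "x \<in> ?S")
        case True
        have x: "x \<in> cimg ?c" and \<tau>x: "?\<tau> x \<in> cimg ?d" using True transition_in[OF c True] by blast+
        have pt: "point ?d (?\<tau> x) = point ?c x" by (rule point_transition[OF c d True])
        have dir: "dir W ?c (bfun e) x = dir W ?d (bfun e) (?\<tau> x)" if "e \<in> F" for e
          by (rule dir_transform[OF c d True]) (use Ck_differentiable[OF Ck_b[OF that d] _ \<tau>x] in simp)
        have "n a b ?c x = - n b a ?d (?\<tau> x)"
          by (simp add: n_def pt dir a b minus_divide_left)
        then show ?thesis using True x \<tau>x dens_transform[OF c d True] by (simp add: N_def)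
      next
        case False
        have "N a b x = 0"
        proof (cases "x \<in> cimg ?c")
          case True
          have "point ?c x \<notin> ?M"
          proof
            assume "point ?c x \<in> ?M"
            then have "coords ?c (point ?c x) \<in> ?S" using M by blast
            then show False using False coords_point[OF True] by simp
          qed
          then show ?thesis using n_zero[OF a b c True] by (simp add: N_def)
        qed (simp add: N_def)
        then show ?thesis using False by simp
      qed
    qed
    finally show ?thesis by simp
  qed
  \<comment> \<open>Summed over all ordered pairs, an antisymmetric quantity vanishes; only the
    divergence terms \<open>T\<close> remain.\<close>
  have "(\<Sum>a\<in>F. \<Sum>b\<in>F. integral UNIV (N a b)) = - (\<Sum>a\<in>F. \<Sum>b\<in>F. integral UNIV (N b a))"
    unfolding sum_negf[symmetric] by (intro sum.cong refl antisym)
  also have "(\<Sum>a\<in>F. \<Sum>b\<in>F. integral UNIV (N b a)) = (\<Sum>a\<in>F. \<Sum>b\<in>F. integral UNIV (N a b))"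
    by (rule sum.swap)
  finally have NN: "(\<Sum>a\<in>F. \<Sum>b\<in>F. integral UNIV (N a b)) = 0" by simp
  have "(\<Sum>a\<in>F. integral UNIV (T a) + (\<Sum>b\<in>F. integral UNIV (N a b))) = 0"
    using sum_zero by simp
  then have TT: "(\<Sum>a\<in>F. - integral UNIV (T a)) = 0" using NN by (simp add: sum.distrib sum_negf)
  have T_le: "T a y \<le> 0" if "a \<in> F" for a y
  proof (cases "y \<in> cimg (bchart a)")
    case True
    have "ldiv (comp (bchart a)) (W (bchart a)) y \<le> 0" using neg[OF FA[OF that] True] by simp
    then have "bfun a (point (bchart a) y) / P (point (bchart a) y) * ldiv (comp (bchart a)) (W (bchart a)) y \<le> 0"
      using P_pos'[OF FA[OF that] True] bfun_nonneg by (intro mult_nonneg_nonpos divide_nonneg_pos)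
    from mult_nonneg_nonpos[OF less_imp_le[OF Ck_D(2)[OF FA[OF that] True]] this]
    show ?thesis using True by (simp only: T_def if_True)
  qed (simp add: T_def)
  have Tn: "- integral UNIV (T a) \<ge> 0" if "a \<in> F" for a
    using integral_nonneg[of "\<lambda>y. - T a y" UNIV] T_le[OF that] T_int[OF that]
    by (simp add: integrable_neg)
  obtain p where "p \<in> topspace X" using ne by blast
  then obtain a where a: "a \<in> F" using F(3) by blast
  let ?c = "bchart a" and ?y = "centre a"
  \<comment> \<open>The integrals of the functions \<open>- T a\<close> are nonnegative with sum 0,
    so each of them vanishes.\<close>
  have "integral UNIV (T a) = 0"
    using sum_nonneg_eq_0_iff[OF F(1) Tn] TT a by simp
  then have int0: "integral UNIV (\<lambda>y. - T a y) = 0" by simp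
  have "- T a ?y = 0"
  proof (rule integral_zero_nonneg_compact_support[OF continuous_on_minus[OF T_cont[OF a]] K(1)[OF a] _ _ int0])
    show "- T a y = 0" if "y \<notin> ?K a" for y using T_zero[OF a that] by simp
    show "0 \<le> - T a y" for y using T_le[OF a, of y] by simp
  qed
  \<comment> \<open>At the centre of the ball the bump is positive and the divergence negative by
    assumption.\<close>
  moreover have "- T a ?y > 0"
  proof -
    have r: "radius a > 0" using F(2)[OF a] by (simp add: admissible_def)
    then have y: "?y \<in> cimg ?c" using K(2)[OF a] by auto
    have "bfun a (point ?c ?y) > 0"
      by (rule bfun_pos) (use r y in \<open>simp_all add: point_in coords_point\<close>)
    then have "bfun a (point ?c ?y) / P (point ?c ?y) * ldiv (comp ?c) (W ?c) ?y < 0"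
      using P_pos'[OF FA[OF a] y] neg[OF FA[OF a] y] by (intro mult_pos_neg divide_pos_pos)
    from mult_pos_neg[OF Ck_D(2)[OF FA[OF a] y] this] have "T a ?y < 0"
      using y by (simp only: T_def if_True)
    then show ?thesis by simp
  qed
  ultimately show False by simp
qed

end

end

section \<open>Modified conformal vector fields\<close>

context riemannian_atlas
begin

lemma chart_at: "p \<in> topspace X \<Longrightarrow> chart_at A p \<in> A \<and> p \<in> cdom (chart_at A p)"
  unfolding chart_at_def by (rule someI_ex) (use chart_exists in blast)

text \<open>Assumption \<open>s\<close> says that the squared norms computed in charts come from one
  function on the manifold. Its differential transforms by the chain rule, the inverse metric by
  congruence, and the coefficient of \<open>V\<close> is a scalar.\<close>

lemma drift_transform:
  fixes V :: "('a, 'n) chart \<Rightarrow> real^'n \<Rightarrow> real^'n" and \<sigma> :: "'a \<Rightarrow> real" and m :: real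
  assumes Ck_V: "\<And>c i. c \<in> A \<Longrightarrow> Ck 2 (cimg c) (\<lambda>y. V c y $ i)"
    and V: "\<And>c d y a. c \<in> A \<Longrightarrow> d \<in> A \<Longrightarrow> y \<in> overlap c d \<Longrightarrow>
      V d (transition c d y) $ a = (\<Sum>i\<in>UNIV. jac c d a i y * V c y $ i)"
    and s: "\<And>c y. c \<in> A \<Longrightarrow> y \<in> cimg c \<Longrightarrow> V c y \<bullet> (comp c y *v V c y) = s (point c y)"
    and cd: "c \<in> A" "d \<in> A" "y \<in> overlap c d"
  shows "drift (comp d) (V d) (\<lambda>y. \<sigma> (point d y)) m (transition c d y) $ a
    = (\<Sum>i\<in>UNIV. jac c d a i y * drift (comp c) (V c) (\<lambda>y. \<sigma> (point c y)) m y $ i)"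
proof -
  let ?z = "transition c d y"
  let ?J = "\<lambda>a i. jac c d a i y"
  have y: "y \<in> cimg c" and z: "?z \<in> cimg d"
    using cd(3) transition_in[OF cd(1,3)] by blast+
  have pt: "point d ?z = point c y" by (rule point_transition[OF cd])
  have ps: "pd i (\<lambda>z. V e z \<bullet> (comp e z *v V e z)) x = pd i (\<lambda>z. s (point e z)) x"
    if "e \<in> A" "x \<in> cimg e" for e x i
    by (rule pd_cong_open[OF cimg_open[OF that(1)] that(2) s[OF that(1)]])
  have ds: "(\<lambda>z. s (point d z)) differentiable (at ?z)"
  proof -
    have "Ck 2 (cimg d) (\<lambda>z. V d z \<bullet> (comp d z *v V d z))"
      unfolding inner_matrix_vector_mult by (intro Ck_sum Ck_mult cimg_open Ck_comp Ck_V cd)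
    then have "(\<lambda>z. V d z \<bullet> (comp d z *v V d z)) differentiable (at ?z)"
      using Ck_differentiable[OF _ _ z] by simp
    then show ?thesis
      using differentiable_cong_open[OF cimg_open[OF cd(2)] z s[OF cd(2)]] by simp
  qed
  let ?p = "\<lambda>i. pd i (\<lambda>z. s (point d z)) ?z" and ?H = "matrix_inv (comp c y)"
  define k where "k = s (point c y) / m + (2 - real CARD('n)) * \<sigma> (point c y)"
  have H: "matrix_inv (comp d ?z) $ a $ b = (\<Sum>i\<in>UNIV. \<Sum>j\<in>UNIV. ?J a i * ?J b j * ?H $ i $ j)" for a b
    by (rule congruence_matrix_inv(1)[OF comp_transform[OF cd] comp_invertible[OF cd(1) y]])
  have "(\<Sum>b\<in>UNIV. matrix_inv (comp d ?z) $ a $ b * ?p b)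
      = (\<Sum>b\<in>UNIV. \<Sum>i\<in>UNIV. \<Sum>j\<in>UNIV. ?J a i * (?H $ i $ j * (?p b * ?J b j)))"
    by (simp add: H sum_distrib_left mult_ac)
  also have "\<dots> = (\<Sum>i\<in>UNIV. \<Sum>j\<in>UNIV. \<Sum>b\<in>UNIV. ?J a i * (?H $ i $ j * (?p b * ?J b j)))"
    by (subst sum.swap, rule sum.cong[OF refl], rule sum.swap)
  also have "\<dots> = (\<Sum>i\<in>UNIV. ?J a i * (\<Sum>j\<in>UNIV. ?H $ i $ j * pd j (\<lambda>z. s (point c z)) y))"
    by (simp add: pd_point_transform[OF cd ds] sum_distrib_left)
  finally have grad: "(\<Sum>b\<in>UNIV. matrix_inv (comp d ?z) $ a $ b * ?p b)
      = (\<Sum>i\<in>UNIV. ?J a i * (\<Sum>j\<in>UNIV. ?H $ i $ j * pd j (\<lambda>z. s (point c z)) y))" .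
  have "drift (comp d) (V d) (\<lambda>y. \<sigma> (point d y)) m ?z $ a
      = k * V d ?z $ a - (\<Sum>b\<in>UNIV. matrix_inv (comp d ?z) $ a $ b * ?p b) / 2"
    by (simp add: drift_def ps[OF cd(2) z] s[OF cd(2) z] pt k_def)
  also have "\<dots> = (\<Sum>i\<in>UNIV. ?J a i * (k * V c y $ i))
      - (\<Sum>i\<in>UNIV. ?J a i * ((\<Sum>j\<in>UNIV. ?H $ i $ j * pd j (\<lambda>z. s (point c z)) y) / 2))"
    unfolding grad by (simp add: V[OF cd] sum_distrib_left sum_divide_distrib mult_ac)
  also have "\<dots> = (\<Sum>i\<in>UNIV. ?J a i * drift (comp c) (V c) (\<lambda>y. \<sigma> (point c y)) m y $ i)"
    by (simp add: drift_def ps[OF cd(1) y] s[OF cd(1) y] k_def right_diff_distrib sum_subtractf)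
  finally show ?thesis .
qed

section \<open>The conformal equation on the manifold\<close>

context
  fixes V :: "('a, 'n) vector_field" and m :: real and \<sigma> :: "'a \<Rightarrow> real"
  assumes V: "smooth_vector_field X A V" and \<sigma>: "smooth_fun A \<sigma>" and m: "m > 0"
    and conformal: "\<And>p \<xi> \<eta>. p \<in> topspace X \<Longrightarrow> \<xi> \<in> tangent_space A p \<Longrightarrow> \<eta> \<in> tangent_space A p \<Longrightarrow>
      (1/2) * lie_derivative A V g p \<xi> \<eta> - (1/m) * (g p (V p) \<xi> * g p (V p) \<eta>) = \<sigma> p * g p \<xi> \<eta>"
begin

abbreviation Vc :: "('a, 'n) chart \<Rightarrow> real^'n \<Rightarrow> real^'n" where
  "Vc c y \<equiv> V (point c y) c"

abbreviation sqnorm :: "'a \<Rightarrow> real" where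
  "sqnorm p \<equiv> g p (V p) (V p)"

abbreviation Wc :: "('a, 'n) chart \<Rightarrow> real^'n \<Rightarrow> real^'n" where
  "Wc c \<equiv> drift (comp c) (Vc c) (\<lambda>y. \<sigma> (point c y)) m"

lemma V_tangent: "p \<in> topspace X \<Longrightarrow> V p \<in> tangent_space A p"
  using V by (simp add: smooth_vector_field_def)

lemma Ck_Vc: "c \<in> A \<Longrightarrow> Ck k (cimg c) (\<lambda>y. Vc c y $ i)"
  using V by (intro smooth_on_Ck) (simp add: smooth_vector_field_def)

lemma Vc_transform:
  assumes "c \<in> A" "d \<in> A" "y \<in> overlap c d"
  shows "Vc d (transition c d y) $ a = (\<Sum>i\<in>UNIV. jac c d a i y * Vc c y $ i)"
proof -
  obtain p where p: "p \<in> cdom c" "p \<in> cdom d" "y = coords c p" using assms(3) by blast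
  have "V p d = (\<chi> a i. jac c d a i (coords c p)) *v V p c"
    using tangent_transform[OF V_tangent] assms p cdom_subset[OF assms(1)] by blast
  then show ?thesis
    using p by (simp add: transition_coords[OF assms(1)] point_coords assms matrix_vector_mult_def)
qed

lemma sqnorm_chart:
  assumes "c \<in> A" "y \<in> cimg c"
  shows "Vc c y \<bullet> (comp c y *v Vc c y) = sqnorm (point c y)"
  using metric_components[OF assms(1) point_in[OF assms(2)] V_tangent V_tangent]
    point_in_topspace[OF assms] coords_point[OF assms(2)] by simp

text \<open>The conformal equation speaks of \<open>lie_derivative\<close>, whose components are
  taken in the chart chosen by \<open>chart_at\<close>. Testing it on coordinate vectors of
  \<open>c\<close> and applying \<open>lie_transform\<close> yields it in every chart.\<close>

lemma lie_chart:
  assumes "c \<in> A" "y \<in> cimg c"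
  shows "lie (comp c) (Vc c) y i j = 2 / m * (comp c y *v Vc c y) $ i * (comp c y *v Vc c y) $ j
    + 2 * \<sigma> (point c y) * comp c y $ i $ j"
proof -
  let ?p = "point c y" let ?d = "chart_at A ?p" let ?e = "\<lambda>i. coord_vec A c i ?p"
  have p: "?p \<in> topspace X" "?p \<in> cdom c" "coords c ?p = y"
    by (rule point_in_topspace[OF assms] point_in[OF assms(2)] coords_point[OF assms(2)])+
  have d: "?d \<in> A" "?p \<in> cdom ?d" using chart_at[OF p(1)] by blast+
  have y: "y \<in> overlap c ?d" using p d(2) by (metis IntI image_eqI)
  have z: "transition c ?d y = coords ?d ?p" using transition_coords[OF assms(1) p(2)] p(3) by simp
  have e: "?e i \<in> tangent_space A ?p" for i by (rule coord_vec_tangent[OF assms(1) p(2)])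
  have zimg: "transition c ?d y \<in> cimg ?d" using transition_in[OF assms(1) y] by blast
  have "lie (comp c) (Vc c) y i j = (\<Sum>a\<in>UNIV. \<Sum>b\<in>UNIV. jac c ?d a i y * jac c ?d b j y
      * lie (comp ?d) (Vc ?d) (transition c ?d y) a b)"
  proof (rule lie_transform[OF overlap_open[OF assms(1) d(1)] y Ck_transition[OF assms(1) d(1)]])
    show "comp c x $ i $ j = (\<Sum>a\<in>UNIV. \<Sum>b\<in>UNIV. jac c ?d a i x * jac c ?d b j x * comp ?d (transition c ?d x) $ a $ b)"
      if "x \<in> overlap c ?d" for x i j by (rule comp_transform[OF assms(1) d(1) that])
    show "Vc ?d (transition c ?d x) $ a = (\<Sum>i\<in>UNIV. jac c ?d a i x * Vc c x $ i)"
      if "x \<in> overlap c ?d" for x a by (rule Vc_transform[OF assms(1) d(1) that])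
    show "(\<lambda>x. comp ?d x $ i $ j) differentiable (at (transition c ?d y))" for i j
      by (rule Ck_differentiable[OF Ck_comp[OF d(1), of 1] _ zimg]) simp
    show "(\<lambda>x. Vc ?d x $ i) differentiable (at (transition c ?d y))" for i
      by (rule Ck_differentiable[OF Ck_Vc[OF d(1), of 1] _ zimg]) simp
    show "(\<lambda>x. Vc c x $ i) differentiable (at y)" for i
      by (rule Ck_differentiable[OF Ck_Vc[OF assms(1), of 1] _ assms(2)]) simp
  qed
  also have "\<dots> = lie_derivative A V g ?p (?e i) (?e j)"
    using coord_vec_apply[OF assms(1) d(1) p(2) d(2)]
    by (simp add: lie_derivative_def Let_def lie_components_lie z p(3) mult_ac)
  also have "\<dots> = 2 * ((1/m) * (g ?p (V ?p) (?e i) * g ?p (V ?p) (?e j)) + \<sigma> ?p * g ?p (?e i) (?e j))"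
    using conformal[OF p(1) e e, of i j] by simp
  finally have lie_eq: "lie (comp c) (Vc c) y i j
    = 2 * ((1/m) * (g ?p (V ?p) (?e i) * g ?p (V ?p) (?e j)) + \<sigma> ?p * g ?p (?e i) (?e j))" .
  have gV: "g ?p (V ?p) (?e k) = (comp c y *v Vc c y) $ k" for k
  proof -
    have "g ?p (V ?p) (?e k) = g ?p (?e k) (V ?p)" by (rule metric_sym[OF p(1) V_tangent[OF p(1)] e])
    also have "\<dots> = ?e k c \<bullet> (comp c (coords c ?p) *v V ?p c)"
      by (rule metric_components[OF assms(1) p(2) e V_tangent[OF p(1)]])
    finally show ?thesis by (simp add: coord_vec_self[OF assms(1) p(2)] p(3) inner_axis')
  qed
  have "g ?p (?e i) (?e j) = comp c y $ i $ j" by (simp add: components_def)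
  then show ?thesis unfolding lie_eq gV by (simp add: algebra_simps)
qed

lemma Ck_\<sigma>: "c \<in> A \<Longrightarrow> Ck k (cimg c) (\<lambda>y. \<sigma> (point c y))"
  using \<sigma> by (intro smooth_on_Ck) (simp add: smooth_fun_def)

lemma Ck_Wc: "c \<in> A \<Longrightarrow> Ck 1 (cimg c) (\<lambda>y. Wc c y $ i)"
  by (rule metric_chart.Ck_drift[OF metric_chart Ck_Vc Ck_\<sigma> m lie_chart])

lemma Wc_transform:
  assumes "c \<in> A" "d \<in> A" "y \<in> overlap c d"
  shows "Wc d (transition c d y) $ a = (\<Sum>i\<in>UNIV. jac c d a i y * Wc c y $ i)"
  by (rule drift_transform[OF Ck_Vc Vc_transform sqnorm_chart assms])

text \<open>Stated in the chart chosen at \<open>p\<close> since \<open>ricci\<close> is computed in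
  it; other charts are reached through \<open>ldiv_Wc_invariant\<close>.\<close>

lemma ldiv_Wc_le:
  assumes p: "p \<in> topspace X"
  shows "ldiv (comp (chart_at A p)) (Wc (chart_at A p)) (coords (chart_at A p) p)
    \<le> ricci A g p (V p) (V p) + (real CARD('n) - 1) / (real CARD('n) * m\<^sup>2) * (sqnorm p)\<^sup>2"
proof -
  let ?c = "chart_at A p"
  have c: "?c \<in> A" "p \<in> cdom ?c" "point ?c (coords ?c p) = p"
    using chart_at[OF p] point_coords by blast+
  have y: "coords ?c p \<in> cimg ?c" using c(2) by (rule imageI)
  show ?thesis
    using metric_chart.ldiv_drift_le[OF metric_chart Ck_Vc Ck_\<sigma> m lie_chart y] c y
      sqnorm_chart[OF c(1) y]
    by (simp add: ricci_ric)
qed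

lemma ldiv_Wc_invariant:
  assumes "c \<in> A" "d \<in> A" "y \<in> overlap c d"
  shows "ldiv (comp c) (Wc c) y = ldiv (comp d) (Wc d) (transition c d y)"
proof (rule ldiv_transform[OF overlap_open[OF assms(1,2)] assms(3) Ck_transition[OF assms(1,2)]])
  have y: "y \<in> cimg c" "transition c d y \<in> cimg d"
    using assms(3) transition_in[OF assms(1,3)] by blast+
  show "comp c x $ i $ j = (\<Sum>a\<in>UNIV. \<Sum>b\<in>UNIV. jac c d a i x * jac c d b j x * comp d (transition c d x) $ a $ b)"
    if "x \<in> overlap c d" for x i j by (rule comp_transform[OF assms(1,2) that])
  show "Wc d (transition c d x) $ a = (\<Sum>i\<in>UNIV. jac c d a i x * Wc c x $ i)"
    if "x \<in> overlap c d" for x a by (rule Wc_transform[OF assms(1,2) that])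
  show "(\<lambda>x. comp d x $ i $ j) differentiable (at (transition c d y))" for i j
    by (rule Ck_differentiable[OF Ck_comp[OF assms(2), of 1] _ y(2)]) simp
  show "(\<lambda>x. Wc d x $ i) differentiable (at (transition c d y))" for i
    by (rule Ck_differentiable[OF Ck_Wc[OF assms(2)] _ y(2)]) simp
  show "(\<lambda>x. Wc c x $ i) differentiable (at y)" for i
    by (rule Ck_differentiable[OF Ck_Wc[OF assms(1)] _ y(1)]) simp
  show "invertible (comp c y)" by (rule comp_invertible[OF assms(1) y(1)])
qed

text \<open>Boundedness makes the supremum in \<open>max_vnorm\<close> a genuine upper bound. It
  follows from continuity of the norm on finitely many compact coordinate balls covering the
  manifold.\<close>

lemma bdd_above_vnorm:
  assumes "compact_space X"
  shows "bdd_above (vnorm g V ` topspace X)"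
proof -
  obtain F where F: "finite F" "\<And>b. b \<in> F \<Longrightarrow> admissible b"
    "\<And>p. p \<in> topspace X \<Longrightarrow> \<exists>b\<in>F. p \<in> cdom (bchart b) \<and> coords (bchart b) p \<in> ball (centre b) (radius b)"
    using finite_cover[OF assms] by metis
  let ?S = "\<lambda>b. (\<lambda>y. vnorm g V (point (bchart b) y)) ` cball (centre b) (radius b)"
  have "bdd_above (?S b)" if b: "b \<in> F" for b
  proof -
    have c: "bchart b \<in> A" "cball (centre b) (radius b) \<subseteq> cimg (bchart b)"
      using F(2)[OF b] by (auto simp: admissible_def)
    have "Ck 0 (cimg (bchart b)) (\<lambda>y. Vc (bchart b) y \<bullet> (comp (bchart b) y *v Vc (bchart b) y))"
      unfolding inner_matrix_vector_mult by (intro Ck_sum Ck_mult cimg_open Ck_comp Ck_Vc c(1))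
    then have "continuous_on (cimg (bchart b)) (\<lambda>y. sqnorm (point (bchart b) y))"
      using sqnorm_chart[OF c(1)] by (simp cong: continuous_on_cong)
    then have "continuous_on (cimg (bchart b)) (\<lambda>y. vnorm g V (point (bchart b) y))"
      unfolding vnorm_def by (rule continuous_on_real_sqrt)
    then have "compact (?S b)"
      by (intro compact_continuous_image continuous_on_subset[OF _ c(2)]) auto
    then show ?thesis by (simp add: bounded_imp_bdd_above compact_imp_bounded)
  qed
  then have "bdd_above (\<Union>b\<in>F. ?S b)" using F(1) by simp
  moreover have "vnorm g V ` topspace X \<subseteq> (\<Union>b\<in>F. ?S b)"
  proof
    fix t assume "t \<in> vnorm g V ` topspace X"
    then obtain p where p: "p \<in> topspace X" "t = vnorm g V p" by blast
    obtain b where b: "b \<in> F" "p \<in> cdom (bchart b)" "coords (bchart b) p \<in> ball (centre b) (radius b)"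
      using F(3)[OF p(1)] by blast
    have "point (bchart b) (coords (bchart b) p) = p"
      using F(2)[OF b(1)] b(2) point_coords by (simp add: admissible_def)
    then have "t = vnorm g V (point (bchart b) (coords (bchart b) p))" using p by simp
    moreover have "coords (bchart b) p \<in> cball (centre b) (radius b)" using b(3) by simp
    ultimately have "t \<in> ?S b" by (rule image_eqI)
    then show "t \<in> (\<Union>b\<in>F. ?S b)" using b(1) by blast
  qed
  ultimately show ?thesis by (rule bdd_above_mono)
qed

lemma modified_conformal_vanishes:
  assumes cpt: "compact_space X" and dim: "CARD('n) \<ge> 2"
    and ric: "\<And>p. p \<in> topspace X \<Longrightarrow> ricci A g p (V p) (V p)
      \<le> 2 * (1 - real CARD('n)) / (real CARD('n) * m\<^sup>2) * (max_vnorm X g V) ^ 4"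
    and p: "p \<in> topspace X"
  shows "V p = (\<lambda>_. 0)"
proof (rule ccontr)
  assume nz: "V p \<noteq> (\<lambda>_. 0)"
  define K where "K = max_vnorm X g V"
  \<comment> \<open>The zero vector is treated apart because positivity in
    \<open>is_inner_product\<close> concerns nonzero vectors.\<close>
  have sq_nn: "sqnorm q \<ge> 0" if "q \<in> topspace X" for q
  proof (cases "V q = (\<lambda>_. 0)")
    case True
    have "sqnorm q = 0"
      using metric_components[of "chart_at A q" q, OF _ _ V_tangent V_tangent] chart_at[OF that] that True by simp
    then show ?thesis by simp
  next
    case False
    then show ?thesis
      using inner_product[OF that] V_tangent[OF that] unfolding is_inner_product_def by (meson less_imp_le)
  qed
  have le: "vnorm g V q \<le> K" if "q \<in> topspace X" for q
    unfolding K_def max_vnorm_def by (rule cSUP_upper[OF that bdd_above_vnorm[OF cpt]])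
  have "sqnorm p > 0"
    using inner_product[OF p] V_tangent[OF p] nz unfolding is_inner_product_def by blast
  \<comment> \<open>A nonzero value at the single point \<open>p\<close> makes the maximum positive,
    and through it the curvature bound acts at every point, including the zeros of
    \<open>V\<close>.\<close>
  then have K: "K > 0" using le[OF p] by (simp add: vnorm_def) (meson less_le_trans real_sqrt_gt_zero)
  have sq: "(sqnorm q)\<^sup>2 \<le> K ^ 4" if "q \<in> topspace X" for q
  proof -
    have "sqnorm q = (vnorm g V q)\<^sup>2" using sq_nn[OF that] by (simp add: vnorm_def)
    also have "\<dots> \<le> K\<^sup>2" using le[OF that] sq_nn[OF that] by (intro power_mono) (simp_all add: vnorm_def)
    finally have "(sqnorm q)\<^sup>2 \<le> (K\<^sup>2)\<^sup>2" using sq_nn[OF that] by (intro power_mono)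
    then show ?thesis by simp
  qed
  \<comment> \<open>The constant of \<open>ldiv_Wc_le\<close>; the curvature hypothesis reads
    \<open>- 2 * ?k * K ^ 4\<close>. Its positivity is where dimension at least 2 enters.\<close>
  let ?k = "(real CARD('n) - 1) / (real CARD('n) * m\<^sup>2)"
  have k: "?k > 0" using dim m by simp
  have neg: "ldiv (comp (chart_at A q)) (Wc (chart_at A q)) (coords (chart_at A q) q) < 0"
    if q: "q \<in> topspace X" for q
  proof -
    have "ricci A g q (V q) (V q) \<le> - 2 * ?k * K ^ 4"
      using ric[OF q] by (simp add: K_def field_simps)
    moreover have "?k * (sqnorm q)\<^sup>2 \<le> ?k * K ^ 4"
      using sq[OF q] k by (intro mult_left_mono) auto
    moreover have "?k * K ^ 4 > 0" using K by (intro mult_pos_pos[OF k]) simp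
    ultimately show ?thesis using ldiv_Wc_le[OF q] by linarith
  qed
  have "topspace X \<noteq> {}" using p by blast
  from exists_ldiv_nonneg[of Wc, OF Ck_Wc Wc_transform cpt this]
  obtain c y where c: "c \<in> A" "y \<in> cimg c" "0 \<le> ldiv (comp c) (Wc c) y" by blast
  let ?q = "point c y" let ?d = "chart_at A ?q"
  have q: "?q \<in> topspace X" by (rule point_in_topspace[OF c(1,2)])
  have d: "?d \<in> A" "?q \<in> cdom ?d" using chart_at[OF q] by blast+
  have y: "coords c ?q = y" "?q \<in> cdom c" by (rule coords_point[OF c(2)] point_in[OF c(2)])+
  then have "y \<in> overlap c ?d" using d(2) by (metis IntI image_eqI)
  \<comment> \<open>The divergence theorem delivers a point in an arbitrary chart; invariance moves
    it to the chart in which the estimate was made.\<close>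
  then have "ldiv (comp c) (Wc c) y = ldiv (comp ?d) (Wc ?d) (coords ?d ?q)"
    using ldiv_Wc_invariant[OF c(1) d(1)] transition_coords[OF c(1) y(2), of ?d] y(1) by simp
  then show False using neg[OF q] c(3) by simp
qed

end

end

theorem theorem2p2:
  fixes X :: "'a topology" and A :: "('a, 'n::finite) chart set"
    and g :: "('a, 'n) tensor2" and V :: "('a, 'n) vector_field" and m :: real
  assumes "smooth_manifold X A" and "compact_space X" and "CARD('n) \<ge> 2"
    and "riemannian_metric X A g"
    and "m > 0"
    and "modified_conformal X A g m V"
    and "\<forall>p\<in>topspace X. ricci A g p (V p) (V p)
           \<le> 2 * (1 - real CARD('n)) / (real CARD('n) * m\<^sup>2) * (max_vnorm X g V) ^ 4"
  shows "\<forall>p\<in>topspace X. V p = (\<lambda>_. 0)"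
proof -
  interpret riemannian_atlas X A g
    using assms(1,4) by unfold_locales
  obtain \<sigma> where "smooth_vector_field X A V" "smooth_fun A \<sigma>"
    "\<forall>p\<in>topspace X. \<forall>\<xi>\<in>tangent_space A p. \<forall>\<eta>\<in>tangent_space A p.
       (1/2) * lie_derivative A V g p \<xi> \<eta> - (1/m) * (g p (V p) \<xi> * g p (V p) \<eta>) = \<sigma> p * g p \<xi> \<eta>"
    using assms(6) unfolding modified_conformal_def by blast
  then show ?thesis
    using modified_conformal_vanishes[of V \<sigma> m] assms(2,3,5,7) by blast
qed

end
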